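(* Let $X\in\mathbb R^{n_1\times\cdots\times n_D}$ be a tensor of multilinear rank $(m_1,\dots,m_D)$ with a Tucker decomposition $X=G_T(C,U_1,\dots,U_D)=(U_1\otimes\cdots\otimes U_D)C$, where $C\in\mathbb R^{m_1\times\cdots\times m_D}_\star$ and $U_j\in\mathrm{St}(n_j,m_j)$ for all $j$. Endow the domain of $F_{\mathcal T}$ with the Euclidean (i.e. Frobenius) norm. Then, for all $d=1,\dots,D$, $$\kappa_{X\mapsto U_d}[F_{\mathcal T}](X,C,U_1,\dots,U_D)=\begin{cases} 0 & \text{if }U_d\text{ is square (i.e. }m_d=n_d), \\ \sigma_{\min}(C_{(d)})^{-1} & \text{otherwise,} \end{cases}$$ where $\sigma_{\min}(C_{(d)})$ is the smallest singular value of the $d$th flattening $C_{(d)}$ of $C$. Furthermore, $$\kappa_{X\mapsto C}[F_{\mathcal T}](X,C,U_1,\dots,U_D)=1.$$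
   Context: Tensors: For $A\in\mathbb R^{m_1\times\cdots\times m_D}$ and matrices $U_j\in\mathbb R^{n_j\times m_j}$, the multilinear product $(U_1\otimes\cdots\otimes U_D)A\in\mathbb R^{n_1\times\cdots\times n_D}$ is the linear extension of $a_1\otimes\cdots\otimes a_D\mapsto(U_1a_1)\otimes\cdots\otimes(U_Da_D)$. The $d$th flattening $A_{(d)}$ is the $m_d\times\prod_{j\ne d}m_j$ matrix obtained by reshaping $A$ with its $d$th index as row index; $\sigma_{\min}(A_{(d)})$ denotes $\sigma_{m_d}(A_{(d)})$, the $m_d$-th largest singular value. $\mathrm{St}(n,m)$ is the Stiefel manifold of real $n\times m$ matrices with orthonormal columns. A Tucker decomposition of $X\in\mathbb R^{n_1\times\cdots\times n_D}$ is a tuple $(C,U_1,\dots,U_D)$ with $C\in\mathbb R^{m_1\times\cdots\times m_D}$, $U_j\in\mathrm{St}(n_j,m_j)$ and $X=(U_1\otimes\cdots\otimes U_D)C$. The multilinear rank of $X$ is the minimal size $(m_1,\dots,m_D)$ of $C$ in a Tucker decomposition of $X$ (equivalently, $m_j=\operatorname{rank}X_{(j)}$). $\mathbb R^{m_1\times\cdots\times m_D}_\star$ is the open set of tensors in $\mathbb R^{m_1\times\cdots\times m_D}$ of multilinear rank $(m_1,\dots,m_D)$. The input space $\mathcal X$ is the smooth submanifold of $\mathbb R^{n_1\times\cdots\times n_D}$ consisting of the tensors of multilinear rank $(m_1,\dots,m_D)$. Define $$G_T\colon\mathbb R^{m_1\times\cdots\times m_D}_\star\times\mathrm{St}(n_1,m_1)\times\cdots\times\mathrm{St}(n_D,m_D)\to\mathbb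 R^{n_1\times\cdots\times n_D},\quad (C,U_1,\dots,U_D)\mapsto(U_1\otimes\cdots\otimes U_D)C,$$ $$F_{\mathcal T}(X,C,U_1,\dots,U_D):=X-G_T(C,U_1,\dots,U_D),\qquad X\in\mathcal X.$$ All of these manifolds carry the Riemannian metric induced by the Euclidean (Frobenius) inner product of the ambient space, with induced distance $d$. Condition number: Consider an equation $F(x,y,z)=c$ with input $x\in\mathcal X$, output $y\in\mathcal Y$ and latent variable $z\in\mathcal Z$, and a solution $(x_0,y_0,z_0)$. Let $\widehat{\mathcal Z}$ be a sufficiently small neighbourhood of $z_0$ in $\mathcal Z$. Then $$\kappa_{x\mapsto y}[F](x_0,y_0,z_0):=\limsup_{x\to x_0}\ \min_{y\in\mathcal Y,\ z\in\widehat{\mathcal Z},\ F(x,y,z)=c}\frac{d_{\mathcal Y}(y_0,y)}{d_{\mathcal X}(x_0,x)}.$$ (The value does not depend on the choice of sufficiently small $\widehat{\mathcal Z}$.) For $\kappa_{X\mapsto U_d}[F_{\mathcal T}]$, the equation is $F_{\mathcal T}=0$ with $x=X$, $y=U_d$, and $z$ consisting of $C$ and all $U_j$ with $j\neq d$. For $\kappa_{X\mapsto C}[F_{\mathcal T}]$, the equation is $F_{\mathcal T}=0$ with $x=X$, $y=C$ and $z=(U_1,\dots,U_D)$. *)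

theory Defs
  imports "HOL-Analysis.Analysis" "Jordan_Normal_Form.Char_Poly"
begin

section \<open>Tensors and matrices as finitely supported functions\<close>

text \<open>
  The sizes \<open>n 0 \<times> \<dots> \<times> n (D - 1)\<close> of a tensor vary inside the definition of multilinear rank,
  so tensors and matrices are real functions on indices (starting at 0) that vanish outside their
  index set. On each space of a fixed size, the subspace topology inherited from the product
  topology of the function type is the Euclidean one.
\<close>

type_synonym tensor = "(nat \<Rightarrow> nat) \<Rightarrow> real"
type_synonym matrix = "nat \<times> nat \<Rightarrow> real"

definition tensor_indices :: "nat \<Rightarrow> (nat \<Rightarrow> nat) \<Rightarrow> (nat \<Rightarrow> nat) set" where
  "tensor_indices D n = (\<Pi>\<^sub>E j\<in>{..<D}. {..<n j})"

definition tensors :: "nat \<Rightarrow> (nat \<Rightarrow> nat) \<Rightarrow> tensor set" where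
  "tensors D n = {A. \<forall>i. i \<notin> tensor_indices D n \<longrightarrow> A i = 0}"

definition matrix_indices :: "nat \<Rightarrow> nat \<Rightarrow> (nat \<times> nat) set" where
  "matrix_indices n m = {..<n} \<times> {..<m}"

definition stiefel :: "nat \<Rightarrow> nat \<Rightarrow> matrix set" where
  "stiefel n m = {U. (\<forall>e. e \<notin> matrix_indices n m \<longrightarrow> U e = 0) \<and>
     (\<forall>k<m. \<forall>l<m. (\<Sum>i<n. U (i, k) * U (i, l)) = (if k = l then 1 else 0))}"

text \<open>\<open>multilinear_product D n m U A\<close> is \<open>(U 0 \<otimes> \<dots> \<otimes> U (D - 1)) A\<close> for \<open>A\<close> of size \<open>m\<close> and
  \<open>U j\<close> of size \<open>n j \<times> m j\<close>.\<close>

definition multilinear_product ::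
    "nat \<Rightarrow> (nat \<Rightarrow> nat) \<Rightarrow> (nat \<Rightarrow> nat) \<Rightarrow> (nat \<Rightarrow> matrix) \<Rightarrow> tensor \<Rightarrow> tensor" where
  "multilinear_product D n m U A = (\<lambda>i. if i \<in> tensor_indices D n
     then \<Sum>k\<in>tensor_indices D m. (\<Prod>j<D. U j (i j, k j)) * A k else 0)"

definition rank_one_tensor ::
    "nat \<Rightarrow> (nat \<Rightarrow> nat) \<Rightarrow> (nat \<Rightarrow> nat \<Rightarrow> real) \<Rightarrow> tensor" where
  "rank_one_tensor D m a = (\<lambda>k. if k \<in> tensor_indices D m then \<Prod>j<D. a j (k j) else 0)"

text \<open>The defining property of the multilinear product; its linearity in \<open>A\<close> is immediate.\<close>

lemma multilinear_product_rank_one: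
  "multilinear_product D n m U (rank_one_tensor D m a) =
   rank_one_tensor D n (\<lambda>j i. \<Sum>k<m j. U j (i, k) * a j k)"
proof
  fix i
  have "(\<Sum>k\<in>tensor_indices D m. (\<Prod>j<D. U j (i j, k j)) * rank_one_tensor D m a k) =
        (\<Sum>k\<in>tensor_indices D m. \<Prod>j<D. U j (i j, k j) * a j (k j))"
    by (rule sum.cong) (auto simp: rank_one_tensor_def prod.distrib)
  also have "\<dots> = (\<Prod>j<D. \<Sum>k<m j. U j (i j, k) * a j k)"
    unfolding tensor_indices_def by (subst prod_sum_PiE) auto
  finally show "multilinear_product D n m U (rank_one_tensor D m a) i =
      rank_one_tensor D n (\<lambda>j i. \<Sum>k<m j. U j (i, k) * a j k) i"
    by (simp add: multilinear_product_def rank_one_tensor_def)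
qed

text \<open>The column of the entry with index \<open>k\<close> in the \<open>d\<close>th flattening has the mixed-radix digits
  \<open>k j\<close>, \<open>j \<noteq> d\<close>, to the bases \<open>m j\<close>, with the digit of the smallest \<open>j\<close> least significant.\<close>

definition flattening :: "nat \<Rightarrow> (nat \<Rightarrow> nat) \<Rightarrow> nat \<Rightarrow> tensor \<Rightarrow> real mat" where
  "flattening D m d A = mat (m d) (\<Prod>j\<in>{..<D} - {d}. m j)
     (\<lambda>(r, c). A (\<lambda>j\<in>{..<D}. if j = d then r else (c div (\<Prod>l\<in>{..<j} - {d}. m l)) mod m j))"

text \<open>The singular values of \<open>A\<close> are the square roots of the eigenvalues of \<open>A A\<^sup>T\<close>, counted with
  multiplicity. This gives as many values as \<open>A\<close> has rows; for a matrix with more rows than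
  columns, the list is thus padded with zeros. \<open>singular_value A k\<close> is the \<open>k\<close>th largest one,
  \<open>1 \<le> k \<le> dim_row A\<close>.\<close>

definition singular_value :: "real mat \<Rightarrow> nat \<Rightarrow> real" where
  "singular_value A k =
     rev (sorted_list_of_multiset (image_mset sqrt (proots (char_poly (A * transpose_mat A))))) ! (k - 1)"

definition sigma_min :: "real mat \<Rightarrow> real" where
  "sigma_min A = singular_value A (dim_row A)"


section \<open>Tucker decompositions and multilinear rank\<close>

definition tucker_decomposition ::
    "nat \<Rightarrow> (nat \<Rightarrow> nat) \<Rightarrow> (nat \<Rightarrow> nat) \<Rightarrow> tensor \<Rightarrow> tensor \<Rightarrow> (nat \<Rightarrow> matrix) \<Rightarrow> bool" where
  "tucker_decomposition D n m X C U \<longleftrightarrow>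
     C \<in> tensors D m \<and> (\<forall>j<D. U j \<in> stiefel (n j) (m j)) \<and> X = multilinear_product D n m U C"

text \<open>Core sizes may contain zeros here, so that the zero tensor has multilinear rank
  \<open>(0, \<dots>, 0)\<close>.\<close>

definition has_multilinear_rank :: "nat \<Rightarrow> (nat \<Rightarrow> nat) \<Rightarrow> tensor \<Rightarrow> (nat \<Rightarrow> nat) \<Rightarrow> bool" where
  "has_multilinear_rank D n X m \<longleftrightarrow>
     (\<exists>C U. tucker_decomposition D n m X C U) \<and>
     (\<forall>m' C U. tucker_decomposition D n m' X C U \<longrightarrow> (\<forall>j<D. m j \<le> m' j))"

definition tensors_of_rank :: "nat \<Rightarrow> (nat \<Rightarrow> nat) \<Rightarrow> (nat \<Rightarrow> nat) \<Rightarrow> tensor set" where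
  "tensors_of_rank D n m = {X \<in> tensors D n. has_multilinear_rank D n X m}"

abbreviation core_tensors :: "nat \<Rightarrow> (nat \<Rightarrow> nat) \<Rightarrow> tensor set" where
  "core_tensors D m \<equiv> tensors_of_rank D m m"

definition G_T ::
    "nat \<Rightarrow> (nat \<Rightarrow> nat) \<Rightarrow> (nat \<Rightarrow> nat) \<Rightarrow> tensor \<Rightarrow> (nat \<Rightarrow> matrix) \<Rightarrow> tensor" where
  "G_T D n m C U = multilinear_product D n m U C"

definition F_T ::
    "nat \<Rightarrow> (nat \<Rightarrow> nat) \<Rightarrow> (nat \<Rightarrow> nat) \<Rightarrow> tensor \<Rightarrow> tensor \<Rightarrow> (nat \<Rightarrow> matrix) \<Rightarrow> tensor" where
  "F_T D n m X C U = (\<lambda>i. X i - G_T D n m C U i)"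


section \<open>Riemannian distance of an embedded submanifold\<close>

text \<open>Here \<open>I\<close> is a finite index set, and a point is given by its coordinates in \<open>I\<close>. The length is a
  nonnegative Lebesgue integral because piecewise C1 differentiability in the library sense admits derivatives
  that are unbounded near the breakpoints; a curve of infinite length then gets length
  \<open>\<infinity>\<close>, where a real-valued integral would be 0 by convention.\<close>

definition curve_length :: "'i set \<Rightarrow> (real \<Rightarrow> 'i \<Rightarrow> real) \<Rightarrow> ennreal" where
  "curve_length I \<gamma> =
     (\<integral>\<^sup>+t\<in>{0..1}. ennreal (L2_set (\<lambda>i. vector_derivative (\<lambda>s. \<gamma> s i) (at t)) I) \<partial>lborel)"

text \<open>The distance is \<open>\<infinity>\<close> between points of different connected components.\<close>

definition riemannian_dist ::
    "'i set \<Rightarrow> ('i \<Rightarrow> real) set \<Rightarrow> ('i \<Rightarrow> real) \<Rightarrow> ('i \<Rightarrow> real) \<Rightarrow> ennreal" where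
  "riemannian_dist I M x y =
     (INF \<gamma>\<in>{\<gamma>. (\<forall>i\<in>I. (\<lambda>t. \<gamma> t i) piecewise_C1_differentiable_on {0..1}) \<and>
                (\<forall>t\<in>{0..1}. \<gamma> t \<in> M) \<and> \<gamma> 0 = x \<and> \<gamma> 1 = y}. curve_length I \<gamma>)"


section \<open>Condition numbers\<close>

definition neighbourhood_within :: "'z::topological_space set \<Rightarrow> 'z \<Rightarrow> 'z set \<Rightarrow> bool" where
  "neighbourhood_within Z z0 N \<longleftrightarrow>
     N \<subseteq> Z \<and> (\<exists>T. openin (top_of_set Z) T \<and> z0 \<in> T \<and> T \<subseteq> N)"

text \<open>The minimum is rendered as an infimum, which is \<open>\<infinity>\<close> if there is no solution; \<open>W\<close> is the
  neighbourhood of the latent variable.\<close>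

definition condition_number_on ::
    "'x::topological_space set \<Rightarrow> ('x \<Rightarrow> 'x \<Rightarrow> ennreal) \<Rightarrow> 'y set \<Rightarrow> ('y \<Rightarrow> 'y \<Rightarrow> ennreal) \<Rightarrow>
     'z set \<Rightarrow> ('x \<Rightarrow> 'y \<Rightarrow> 'z \<Rightarrow> 'w) \<Rightarrow> 'w \<Rightarrow> 'x \<Rightarrow> 'y \<Rightarrow> ennreal" where
  "condition_number_on XX dX YY dY W F c x0 y0 =
     Limsup (at x0 within XX)
       (\<lambda>x. INF (y, z)\<in>{(y, z). y \<in> YY \<and> z \<in> W \<and> F x y z = c}. dY y0 y / dX x0 x)"

text \<open>\<open>\<kappa>\<close> is the condition number if it is the value for all sufficiently small neighbourhoods
  of \<open>z0\<close>.\<close>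

definition has_condition_number ::
    "'x::topological_space set \<Rightarrow> ('x \<Rightarrow> 'x \<Rightarrow> ennreal) \<Rightarrow> 'y set \<Rightarrow> ('y \<Rightarrow> 'y \<Rightarrow> ennreal) \<Rightarrow>
     'z::topological_space set \<Rightarrow> ('x \<Rightarrow> 'y \<Rightarrow> 'z \<Rightarrow> 'w) \<Rightarrow> 'w \<Rightarrow> 'x \<Rightarrow> 'y \<Rightarrow> 'z \<Rightarrow> ennreal \<Rightarrow> bool" where
  "has_condition_number XX dX YY dY ZZ F c x0 y0 z0 \<kappa> \<longleftrightarrow>
     (\<exists>N. neighbourhood_within ZZ z0 N \<and>
        (\<forall>W. neighbourhood_within ZZ z0 W \<and> W \<subseteq> N \<longrightarrow>
           condition_number_on XX dX YY dY W F c x0 y0 = \<kappa>))"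

lemma has_condition_number_unique:
  assumes "has_condition_number XX dX YY dY ZZ F c x0 y0 z0 \<kappa>"
    and "has_condition_number XX dX YY dY ZZ F c x0 y0 z0 \<kappa>'"
  shows "\<kappa> = \<kappa>'"
proof -
  obtain N where N: "neighbourhood_within ZZ z0 N"
    "\<And>W. neighbourhood_within ZZ z0 W \<Longrightarrow> W \<subseteq> N \<Longrightarrow>
       condition_number_on XX dX YY dY W F c x0 y0 = \<kappa>"
    using assms(1) unfolding has_condition_number_def by blast
  obtain N' where N': "neighbourhood_within ZZ z0 N'"
    "\<And>W. neighbourhood_within ZZ z0 W \<Longrightarrow> W \<subseteq> N' \<Longrightarrow>
       condition_number_on XX dX YY dY W F c x0 y0 = \<kappa>'"
    using assms(2) unfolding has_condition_number_def by blast
  obtain T where T: "openin (top_of_set ZZ) T" "z0 \<in> T" "T \<subseteq> N"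
    using N(1) unfolding neighbourhood_within_def by blast
  obtain T' where T': "openin (top_of_set ZZ) T'" "z0 \<in> T'" "T' \<subseteq> N'"
    using N'(1) unfolding neighbourhood_within_def by blast
  have "openin (top_of_set ZZ) (T \<inter> T')"
    using T(1) T'(1) by (rule openin_Int)
  then have "neighbourhood_within ZZ z0 (N \<inter> N')"
    using N(1) T T' unfolding neighbourhood_within_def by blast
  then show ?thesis
    using N(2)[of "N \<inter> N'"] N'(2)[of "N \<inter> N'"] by auto
qed

text \<open>The latent variable of the factor \<open>U d\<close> consists of the core and the family of all other
  factors, that of the core is the family of all factors.\<close>

definition has_condition_number_factor ::
    "nat \<Rightarrow> (nat \<Rightarrow> nat) \<Rightarrow> (nat \<Rightarrow> nat) \<Rightarrow> nat \<Rightarrow> tensor \<Rightarrow> tensor \<Rightarrow> (nat \<Rightarrow> matrix) \<Rightarrow> ennreal \<Rightarrow> bool"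
  where
  "has_condition_number_factor D n m d X C U \<kappa> \<longleftrightarrow>
     has_condition_number
       (tensors_of_rank D n m) (riemannian_dist (tensor_indices D n) (tensors_of_rank D n m))
       (stiefel (n d) (m d)) (riemannian_dist (matrix_indices (n d) (m d)) (stiefel (n d) (m d)))
       (core_tensors D m \<times> (\<Pi>\<^sub>E j\<in>{..<D} - {d}. stiefel (n j) (m j)))
       (\<lambda>X' Ud (C', V). F_T D n m X' C' (V(d := Ud))) (\<lambda>_. 0)
       X (U d) (C, restrict U ({..<D} - {d})) \<kappa>"

definition has_condition_number_core ::
    "nat \<Rightarrow> (nat \<Rightarrow> nat) \<Rightarrow> (nat \<Rightarrow> nat) \<Rightarrow> tensor \<Rightarrow> tensor \<Rightarrow> (nat \<Rightarrow> matrix) \<Rightarrow> ennreal \<Rightarrow> bool"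
  where
  "has_condition_number_core D n m X C U \<kappa> \<longleftrightarrow>
     has_condition_number
       (tensors_of_rank D n m) (riemannian_dist (tensor_indices D n) (tensors_of_rank D n m))
       (core_tensors D m) (riemannian_dist (tensor_indices D m) (core_tensors D m))
       (\<Pi>\<^sub>E j\<in>{..<D}. stiefel (n j) (m j))
       (\<lambda>X' C' V. F_T D n m X' C' V) (\<lambda>_. 0)
       X C (restrict U {..<D}) \<kappa>"

end

theory Submission
  imports Defs
begin

text \<open>
  Both condition numbers compare first-order changes, and both follow from a decomposition of every
  tensor \<open>x\<close> of the same rank near \<open>X\<close> that is aligned with the given one.

  Fix a mode \<open>d\<close>, let \<open>P\<close> project onto the column space of the \<open>d\<close>th factor of \<open>x\<close>, and let \<open>\<sigma>\<close> be
  the smallest singular value of the \<open>d\<close>th flattening of \<open>C\<close>. Applied in mode \<open>d\<close>, \<open>1 - P\<close> kills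
  \<open>x\<close>, so it maps \<open>X\<close> to a tensor of norm at most \<open>\<parallel>x - X\<parallel>\<close>. The norm of that image is at least
  \<open>\<sigma> \<parallel>(1 - P) U\<^sub>d\<parallel>\<close>. Hence the sines of the principal angles between the two column spaces have norm
  at most \<open>\<parallel>x - X\<parallel> / \<sigma>\<close> (\<open>aligned_decomposition\<close>). Rotating the principal vectors of \<open>U\<^sub>d\<close> into their
  partners along a geodesic gives a factor of \<open>x\<close> whose distance from \<open>U\<^sub>d\<close> is the norm of the
  angles, which agrees with that of the sines to first order (\<open>aligned_factor\<close>). This proves
  \<open>\<kappa> \<le> 1 / \<sigma>\<close>. If \<open>U\<^sub>d\<close> is square, \<open>1 - P = 0\<close>, all angles vanish and \<open>U\<^sub>d\<close> itself is a factor of \<open>x\<close>.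
  The bound is attained by rotating \<open>U\<^sub>d w\<close> out of the column space of \<open>U\<^sub>d\<close>, where \<open>w\<close> is a left
  singular vector for \<open>\<sigma>\<close>: the tensor moves at speed \<open>\<sigma>\<close>, and every admissible factor has to follow
  the angle (\<open>factor_condition_ge\<close>).

  For the core, the aligned factors satisfy \<open>U'\<^sub>j\<^sup>T U\<^sub>j = 1\<close> up to second order, so the core
  \<open>(U'\<^sub>1\<^sup>T \<otimes> \<dots> \<otimes> U'\<^sub>D\<^sup>T) x\<close> differs from \<open>C\<close> by the image of \<open>x - X\<close> under a contraction and a second-order
  term (\<open>core_exchange_all_factors\<close>). This proves \<open>\<kappa> \<le> 1\<close>. Equality holds because \<open>X\<close> and its cores
  have the same norm: stretching \<open>X\<close> stretches all cores alike (\<open>core_condition_ge\<close>).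

  Riemannian distances enter through two bounds only: they are at least the Euclidean distance, and
  at most the length of an explicit curve. Singular values enter through the variational
  description \<open>sigma_min_variational\<close>, which rests on the spectral theorem for real symmetric
  matrices.
\<close>


section \<open>Orthonormal systems in coordinates\<close>

definition inner_on :: "'i set \<Rightarrow> ('i \<Rightarrow> real) \<Rightarrow> ('i \<Rightarrow> real) \<Rightarrow> real" where
  "inner_on I x y = (\<Sum>i\<in>I. x i * y i)"

lemma L2_set_power2: "(L2_set x I)\<^sup>2 = inner_on I x x"
  by (simp add: L2_set_def inner_on_def sum_nonneg power2_eq_square)

lemma L2_set_eq_sqrt_inner_on: "L2_set x I = sqrt (inner_on I x x)"
  by (simp add: L2_set_def inner_on_def power2_eq_square)

lemma abs_inner_on_le: "\<bar>inner_on I x y\<bar> \<le> L2_set x I * L2_set y I"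
proof -
  have "\<bar>inner_on I x y\<bar> \<le> (\<Sum>i\<in>I. \<bar>x i\<bar> * \<bar>y i\<bar>)"
    unfolding inner_on_def by (rule order_trans[OF sum_abs]) (simp add: abs_mult)
  also have "\<dots> \<le> L2_set x I * L2_set y I"
    by (rule L2_set_mult_ineq)
  finally show ?thesis .
qed

lemma abs_le_L2_set: "finite I \<Longrightarrow> i \<in> I \<Longrightarrow> \<bar>x i\<bar> \<le> L2_set x I"
  using member_le_L2_set[of I i "\<lambda>i. \<bar>x i\<bar>"] by (simp add: L2_set_def)

text \<open>The Stiefel condition without the support condition: entries outside the index set are left
  free, so that products and reindexed matrices need no truncation.\<close>

definition orthonormal :: "nat \<Rightarrow> nat \<Rightarrow> matrix \<Rightarrow> bool" where
  "orthonormal n k W \<longleftrightarrow>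
     (\<forall>a<k. \<forall>b<k. (\<Sum>i<n. W (i, a) * W (i, b)) = (if a = b then 1 else 0))"

lemma orthonormalD:
  "orthonormal n k W \<Longrightarrow> a < k \<Longrightarrow> b < k \<Longrightarrow>
     (\<Sum>i<n. W (i, a) * W (i, b)) = (if a = b then 1 else 0)"
  by (simp add: orthonormal_def)

lemma sum_delta_mult_less:
  "a < (k::nat) \<Longrightarrow> (\<Sum>b<k. f b * (if a = b then 1 else 0)) = (f a :: real)"
  "a < (k::nat) \<Longrightarrow> (\<Sum>b<k. f b * (if b = a then 1 else 0)) = (f a :: real)"
  "a < (k::nat) \<Longrightarrow> (\<Sum>b<k. (if a = b then 1 else 0) * f b) = (f a :: real)"
  "a < (k::nat) \<Longrightarrow> (\<Sum>b<k. (if b = a then 1 else 0) * f b) = (f a :: real)"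
  by (simp_all add: if_distrib[of "\<lambda>x. _ * x"] if_distrib[of "\<lambda>x. x * _"] cong: if_cong)

text \<open>Taking combinations of orthonormal columns preserves inner products. With a square orthonormal
  matrix this also says that a change of basis does not change Frobenius norms.\<close>

lemma orthonormal_inner_comb:
  assumes "orthonormal n k W"
  shows "(\<Sum>i<n. (\<Sum>a<k. x a * W (i, a)) * (\<Sum>a<k. y a * W (i, a))) = (\<Sum>a<k. x a * y a)"
proof -
  have "(\<Sum>i<n. (\<Sum>a<k. x a * W (i, a)) * (\<Sum>b<k. y b * W (i, b))) =
      (\<Sum>i<n. \<Sum>a<k. \<Sum>b<k. x a * y b * (W (i, a) * W (i, b)))"
    by (simp add: sum_product mult_ac)
  also have "\<dots> = (\<Sum>a<k. \<Sum>i<n. \<Sum>b<k. x a * y b * (W (i, a) * W (i, b)))"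
    by (rule sum.swap)
  also have "\<dots> = (\<Sum>a<k. \<Sum>b<k. \<Sum>i<n. x a * y b * (W (i, a) * W (i, b)))"
    by (intro sum.cong refl sum.swap)
  also have "\<dots> = (\<Sum>a<k. \<Sum>b<k. x a * y b * (if a = b then 1 else 0))"
    by (intro sum.cong refl)
      (simp only: sum_distrib_left[symmetric], simp add: orthonormalD[OF assms])
  also have "\<dots> = (\<Sum>a<k. x a * y a)"
    by (intro sum.cong refl) (simp add: sum_delta_mult_less)
  finally show ?thesis .
qed

lemma orthonormal_inner_column:
  assumes "orthonormal n k W" "b < k"
  shows "(\<Sum>i<n. (\<Sum>a<k. x a * W (i, a)) * W (i, b)) = x b"
proof -
  have "(\<Sum>i<n. (\<Sum>a<k. x a * W (i, a)) * W (i, b)) =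
        (\<Sum>i<n. (\<Sum>a<k. x a * W (i, a)) * (\<Sum>a<k. (if a = b then 1 else 0) * W (i, a)))"
    using assms(2) by (simp add: sum_delta_mult_less)
  also have "\<dots> = (\<Sum>a<k. x a * (if a = b then 1 else 0))"
    by (rule orthonormal_inner_comb[OF assms(1)])
  also have "\<dots> = x b"
    using assms(2) by (simp add: sum_delta_mult_less)
  finally show ?thesis .
qed

lemma orthonormal_deficit_row:
  assumes "orthonormal n k W" "i < n"
  shows "(\<Sum>j<n. ((if j = i then 1 else 0) - (\<Sum>a<k. W (i, a) * W (j, a)))\<^sup>2)
         = 1 - (\<Sum>a<k. (W (i, a))\<^sup>2)"
proof -
  let ?P = "\<lambda>j. \<Sum>a<k. W (i, a) * W (j, a)"
  have "(\<Sum>j<n. ((if j = i then 1 else 0) - ?P j)\<^sup>2) =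
      (\<Sum>j<n. (if j = i then 1 else 0) * (1 - 2 * ?P j) + ?P j * ?P j)"
    by (intro sum.cong refl) (auto simp: power2_eq_square algebra_simps)
  also have "\<dots> = 1 - 2 * ?P i + (\<Sum>a<k. W (i, a) * W (i, a))"
    using assms(2) orthonormal_inner_comb[OF assms(1), of "\<lambda>a. W (i, a)" "\<lambda>a. W (i, a)"]
    by (simp add: sum.distrib sum_delta_mult_less)
  finally show ?thesis by (simp add: power2_eq_square)
qed

text \<open>The projection onto the orthogonal complement of \<open>k\<close> orthonormal vectors in dimension \<open>n\<close>
  has squared Frobenius norm \<open>n - k\<close>. This trace identity replaces all dimension counting.\<close>

lemma orthonormal_deficit:
  assumes "orthonormal n k W"
  shows "(\<Sum>i<n. \<Sum>j<n. ((if j = i then 1 else 0) - (\<Sum>a<k. W (i, a) * W (j, a)))\<^sup>2)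
         = real n - real k"
proof -
  have "(\<Sum>i<n. \<Sum>j<n. ((if j = i then 1 else 0) - (\<Sum>a<k. W (i, a) * W (j, a)))\<^sup>2)
      = (\<Sum>i<n. 1 - (\<Sum>a<k. (W (i, a))\<^sup>2))"
    by (intro sum.cong refl orthonormal_deficit_row[OF assms]) auto
  also have "\<dots> = real n - (\<Sum>a<k. \<Sum>i<n. W (i, a) * W (i, a))"
    by (simp add: sum_subtractf power2_eq_square) (rule sum.swap)
  also have "\<dots> = real n - real k"
    by (simp add: orthonormalD[OF assms])
  finally show ?thesis .
qed

lemma orthonormal_card_le:
  assumes "orthonormal n k W" shows "k \<le> n"
proof -
  have "0 \<le> real n - real k"
    unfolding orthonormal_deficit[OF assms, symmetric] by (intro sum_nonneg) simp
  then show ?thesis by simp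
qed

text \<open>The deficit vanishes for \<open>n\<close> vectors in dimension \<open>n\<close>, and it is a sum of squares.\<close>

lemma orthonormal_complete:
  assumes "orthonormal n n W" "i < n" "j < n"
  shows "(\<Sum>a<n. W (i, a) * W (j, a)) = (if i = j then 1 else 0)"
proof -
  have "\<forall>i\<in>{..<n}. (\<Sum>j<n. ((if j = i then 1 else 0) - (\<Sum>a<n. W (i, a) * W (j, a)))\<^sup>2) = 0"
    using orthonormal_deficit[OF assms(1)]
    by (subst sum_nonneg_eq_0_iff[symmetric]) (auto intro!: sum_nonneg)
  then have "\<forall>j\<in>{..<n}. ((if j = i then 1 else 0) - (\<Sum>a<n. W (i, a) * W (j, a)))\<^sup>2 = 0"
    using assms(2) by (subst sum_nonneg_eq_0_iff[symmetric]) auto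
  then show ?thesis using assms(3) by (auto split: if_splits)
qed

lemma orthonormal_complete_expansion:
  assumes "orthonormal n n W" "i < n"
  shows "(\<Sum>a<n. (\<Sum>j<n. W (j, a) * x j) * W (i, a)) = x i"
proof -
  have "(\<Sum>a<n. (\<Sum>j<n. W (j, a) * x j) * W (i, a)) =
      (\<Sum>a<n. \<Sum>j<n. x j * (W (i, a) * W (j, a)))"
    by (simp add: sum_distrib_right sum_distrib_left mult_ac)
  also have "\<dots> = (\<Sum>j<n. x j * (\<Sum>a<n. W (i, a) * W (j, a)))"
    by (subst sum.swap) (simp add: sum_distrib_left)
  also have "\<dots> = (\<Sum>j<n. x j * (if i = j then 1 else 0))"
    using assms by (intro sum.cong refl) (simp add: orthonormal_complete)
  also have "\<dots> = x i"
    using assms(2) by (simp add: sum_delta_mult_less)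
  finally show ?thesis .
qed

lemma orthonormal_complete_parseval:
  assumes "orthonormal n n W"
  shows "(\<Sum>a<n. (\<Sum>j<n. W (j, a) * x j) * (\<Sum>j<n. W (j, a) * y j)) = (\<Sum>i<n. x i * y i)"
proof -
  have "(\<Sum>i<n. x i * y i) = (\<Sum>i<n. (\<Sum>a<n. (\<Sum>j<n. W (j, a) * x j) * W (i, a)) *
      (\<Sum>a<n. (\<Sum>j<n. W (j, a) * y j) * W (i, a)))"
    by (intro sum.cong refl) (simp add: orthonormal_complete_expansion[OF assms])
  then show ?thesis by (simp add: orthonormal_inner_comb[OF assms])
qed

text \<open>The deficit is positive for \<open>k < n\<close>, so some coordinate vector has a nonzero component
  orthogonal to the system; the vector \<open>u\<close> is that component, normalised.\<close>

lemma orthonormal_unit_complement: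
  assumes "orthonormal n k W" "k < n"
  obtains u where "(\<Sum>i<n. (u i)\<^sup>2) = 1" "\<And>a. a < k \<Longrightarrow> (\<Sum>i<n. u i * W (i, a)) = 0"
    "\<And>i. i \<ge> n \<Longrightarrow> u i = 0"
proof -
  let ?v = "\<lambda>i j. (if j = i then 1 else 0) - (\<Sum>a<k. W (i, a) * W (j, a))"
  have "(\<Sum>i<n. \<Sum>j<n. (?v i j)\<^sup>2) > 0"
    using orthonormal_deficit[OF assms(1)] assms(2) by simp
  then obtain i where i: "i < n" "(\<Sum>j<n. (?v i j)\<^sup>2) > 0"
    by (metis (lifting) lessThan_iff not_less sum_nonpos)
  let ?r = "sqrt (\<Sum>j<n. (?v i j)\<^sup>2)"
  have r: "?r > 0" using i by simp
  show ?thesis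
  proof (rule that[of "\<lambda>j. if j < n then ?v i j / ?r else 0"])
    have "(\<Sum>j<n. (if j < n then ?v i j / ?r else 0)\<^sup>2) = (\<Sum>j<n. (?v i j)\<^sup>2 / ?r\<^sup>2)"
      by (intro sum.cong refl) (simp only: lessThan_iff if_True power_divide)
    also have "\<dots> = (\<Sum>j<n. (?v i j)\<^sup>2) / ?r\<^sup>2"
      by (rule sum_divide_distrib[symmetric])
    also have "\<dots> = 1" using i(2) by simp
    finally show "(\<Sum>j<n. (if j < n then ?v i j / ?r else 0)\<^sup>2) = 1" .
  next
    fix b assume b: "b < k"
    have "(\<Sum>j<n. (if j < n then ?v i j / ?r else 0) * W (j, b)) = (\<Sum>j<n. (?v i j * W (j, b)) / ?r)"
      by (intro sum.cong refl) simp
    also have "\<dots> = (\<Sum>j<n. ?v i j * W (j, b)) / ?r"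
      by (rule sum_divide_distrib[symmetric])
    also have "(\<Sum>j<n. ?v i j * W (j, b)) = 0"
      using i(1) orthonormal_inner_column[OF assms(1) b, of "\<lambda>a. W (i, a)"]
      by (simp add: left_diff_distrib sum_subtractf sum_delta_mult_less)
    finally show "(\<Sum>j<n. (if j < n then ?v i j / ?r else 0) * W (j, b)) = 0" by simp
  qed simp
qed

lemma orthonormal_extend_column:
  assumes "orthonormal n k W" "(\<Sum>i<n. (u i)\<^sup>2) = 1"
    and "\<And>a. a < k \<Longrightarrow> (\<Sum>i<n. u i * W (i, a)) = 0"
  shows "orthonormal n (Suc k) (\<lambda>(i, a). if a = k then u i else W (i, a))"
  using assms unfolding orthonormal_def
  by (auto simp: less_Suc_eq power2_eq_square mult.commute)

lemma orthonormal_extend: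
  assumes "orthonormal n k W" "k \<le> n'" "n' \<le> n"
  shows "\<exists>W'. orthonormal n n' W' \<and> (\<forall>i. \<forall>a<k. W' (i, a) = W (i, a))"
  using assms(2,3)
proof (induction rule: dec_induct)
  case base
  then show ?case using assms(1) by blast
next
  case (step l)
  then obtain W' where W': "orthonormal n l W'" "\<forall>i. \<forall>a<k. W' (i, a) = W (i, a)"
    by auto
  obtain u where u: "(\<Sum>i<n. (u i)\<^sup>2) = 1" "\<And>a. a < l \<Longrightarrow> (\<Sum>i<n. u i * W' (i, a)) = 0"
    using orthonormal_unit_complement[OF W'(1)] step.prems by (metis Suc_le_lessD)
  show ?case
    using orthonormal_extend_column[OF W'(1) u] W'(2) step.hyps
    by (intro exI[of _ "\<lambda>(i, a). if a = l then u i else W' (i, a)"]) auto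
qed

section \<open>Diagonalisation of symmetric matrices\<close>

lemma compact_box_functions: "compact {x :: nat \<Rightarrow> real. \<forall>i. x i \<in> (if i < m then {-1..1} else {0})}"
proof -
  have "compactin (product_topology (\<lambda>i. euclidean) UNIV)
      (PiE UNIV (\<lambda>i. if i < m then {-1..1::real} else {0}))"
    by (subst compactin_PiE) (auto simp: compactin_euclidean_iff)
  then show ?thesis
    by (simp add: euclidean_product_topology compactin_euclidean_iff PiE_UNIV_domain Pi_def)
qed

lemma closed_Collect_sum_eq:
  assumes "\<And>i. continuous_on UNIV (f i)"
  shows "closed {x :: nat \<Rightarrow> real. (\<Sum>i<m. f i x) = (c :: real)}"
  by (intro closed_Collect_eq continuous_intros assms) 

lemma compact_unit_complement:
  "compact {x :: nat \<Rightarrow> real. (\<forall>i\<ge>m. x i = 0) \<and> (\<Sum>i<m. (x i)\<^sup>2) = 1 \<and>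
      (\<forall>a<k. (\<Sum>i<m. x i * W (i, a)) = 0)}" (is "compact ?K")
proof -
  have coord: "continuous_on UNIV (\<lambda>x :: nat \<Rightarrow> real. x i)" for i
    by (rule continuous_on_product_coordinates)
  have "?K = {x. \<forall>i. x i \<in> (if i < m then {-1..1} else {0})} \<inter>
      ({x. (\<Sum>i<m. (x i)\<^sup>2) = 1} \<inter> (\<Inter>a\<in>{..<k}. {x. (\<Sum>i<m. x i * W (i, a)) = 0}))"
    (is "_ = ?B \<inter> ?C")
  proof -
    have "\<bar>x i\<bar> \<le> 1" if "(\<Sum>i<m. (x i)\<^sup>2) = (1::real)" "i < m" for x i
      using abs_le_L2_set[of "{..<m}" i x] that by (simp add: L2_set_def)
    then show ?thesis by (auto simp: abs_le_iff split: if_splits; smt (verit))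
  qed
  moreover have "closed ?C"
    by (intro closed_Int closed_INT ballI closed_Collect_sum_eq continuous_intros coord)
  ultimately show ?thesis using compact_Int_closed[OF compact_box_functions] by simp
qed


text \<open>The Rayleigh quotient of \<open>S\<close> attains its minimum on the unit sphere of the orthogonal
  complement of the eigenvectors found so far, and a minimiser \<open>w\<close> is a new eigenvector: the first
  variation shows that \<open>S w\<close> is orthogonal to everything in that complement that is orthogonal
  to \<open>w\<close>.\<close>

lemma symmetric_eigenvector_in_complement:
  fixes S :: "nat \<Rightarrow> nat \<Rightarrow> real"
  assumes sym: "\<And>i j. S i j = S j i"
    and W: "orthonormal m k W" "k < m"
    and eig: "\<And>a i. a < k \<Longrightarrow> i < m \<Longrightarrow> (\<Sum>j<m. S i j * W (j, a)) = l a * W (i, a)"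
  shows "\<exists>w c. (\<Sum>i<m. (w i)\<^sup>2) = 1 \<and> (\<forall>a<k. (\<Sum>i<m. w i * W (i, a)) = 0) \<and>
           (\<forall>i<m. (\<Sum>j<m. S i j * w j) = c * w i)"
proof -
  define K where "K = {x :: nat \<Rightarrow> real. (\<forall>i\<ge>m. x i = 0) \<and> (\<Sum>i<m. (x i)\<^sup>2) = 1 \<and>
      (\<forall>a<k. (\<Sum>i<m. x i * W (i, a)) = 0)}"
  define B where "B x y = (\<Sum>i<m. \<Sum>j<m. S i j * x i * y j)" for x y :: "nat \<Rightarrow> real"
  define ip where "ip x y = (\<Sum>i<m. x i * y i)" for x y :: "nat \<Rightarrow> real"
  have coord: "continuous_on A (\<lambda>x :: nat \<Rightarrow> real. x i)" for i A
    by (rule continuous_on_subset[OF continuous_on_product_coordinates]) simp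
  have B_add: "B (\<lambda>i. x i + t * y i) (\<lambda>i. x i + t * y i) = B x x + 2 * t * B x y + t\<^sup>2 * B y y"
    for x y t
  proof -
    have "B y x = B x y"
      unfolding B_def by (subst sum.swap) (simp add: sym mult_ac)
    moreover have "B (\<lambda>i. x i + t * y i) (\<lambda>i. x i + t * y i) =
        B x x + t * B x y + t * B y x + t\<^sup>2 * B y y"
      unfolding B_def
      by (simp add: algebra_simps sum.distrib sum_distrib_left power2_eq_square)
    ultimately show ?thesis by simp
  qed
  have B_scale: "B (\<lambda>i. x i * s) (\<lambda>i. x i * s) = s\<^sup>2 * B x x" for x s
    unfolding B_def by (simp add: algebra_simps sum_distrib_left power2_eq_square)
  have ip_add: "ip (\<lambda>i. x i + t * y i) z = ip x z + t * ip y z" for x y z t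
    unfolding ip_def by (simp add: algebra_simps sum.distrib sum_distrib_left)
  have ip_commute: "ip x y = ip y x" for x y
    unfolding ip_def by (simp add: mult.commute)
  have ip_nonneg: "0 \<le> ip x x" for x
    unfolding ip_def by (intro sum_nonneg) simp
  define col where "col a i = W (i, a)" for a i
  have K_iff: "x \<in> K \<longleftrightarrow> (\<forall>i\<ge>m. x i = 0) \<and> ip x x = 1 \<and> (\<forall>a<k. ip x (col a) = 0)" for x
    by (simp add: K_def ip_def col_def power2_eq_square)
  have "compact K"
    unfolding K_def by (rule compact_unit_complement)
  moreover have "K \<noteq> {}"
  proof -
    obtain u where "(\<Sum>i<m. (u i)\<^sup>2) = 1" "\<And>a. a < k \<Longrightarrow> (\<Sum>i<m. u i * W (i, a)) = 0"
      "\<And>i. i \<ge> m \<Longrightarrow> u i = 0"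
      using orthonormal_unit_complement[OF W] by blast
    then have "u \<in> K" by (simp add: K_def)
    then show ?thesis by blast
  qed
  moreover have "continuous_on K (\<lambda>x. B x x)"
    unfolding B_def by (intro continuous_intros coord)
  ultimately obtain w where w: "w \<in> K" "\<And>x. x \<in> K \<Longrightarrow> B w w \<le> B x x"
    using continuous_attains_inf[of K "\<lambda>x. B x x"] by auto
  have ww: "ip w w = 1" "\<And>a. a < k \<Longrightarrow> ip w (col a) = 0" "\<And>i. i \<ge> m \<Longrightarrow> w i = 0"
    using w(1) by (auto simp: K_iff)
  define Sw where "Sw i = (\<Sum>j<m. S i j * w j)" for i
  have B_Sw: "B w x = ip Sw x" for x
    unfolding B_def ip_def Sw_def
    by (subst sum.swap) (simp add: sum_distrib_left sum_distrib_right sym mult_ac)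
  have min: "B w w * ip y y \<le> B y y"
    if "\<And>i. i \<ge> m \<Longrightarrow> y i = 0" "\<And>a. a < k \<Longrightarrow> ip y (col a) = 0" "ip y y > 0" for y
  proof -
    define s where "s = 1 / sqrt (ip y y)"
    have s: "s\<^sup>2 * ip y y = 1" using that(3) by (simp add: s_def power_divide)
    have scale: "ip (\<lambda>i. y i * s) x = s * ip y x" for x
      by (simp add: ip_def sum_distrib_left mult_ac)
    have "ip (\<lambda>i. y i * s) (\<lambda>i. y i * s) = 1"
      using scale[of "\<lambda>i. y i * s"] scale[of y] ip_commute[of y "\<lambda>i. y i * s"] s
      by (simp add: power2_eq_square)
    then have "(\<lambda>i. y i * s) \<in> K"
      using that(1,2) by (simp add: K_iff scale)
    then have "B w w \<le> s\<^sup>2 * B y y"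
      using w(2) B_scale by metis
    then have "B w w * ip y y \<le> s\<^sup>2 * B y y * ip y y"
      using that(3) by (simp add: mult_right_mono)
    also have "\<dots> = B y y" using s by (simp add: algebra_simps)
    finally show ?thesis .
  qed
  have variation: "B w v = 0"
    if v: "\<And>i. i \<ge> m \<Longrightarrow> v i = 0" "\<And>a. a < k \<Longrightarrow> ip v (col a) = 0" "ip w v = 0" for v
  proof -
    have "0 \<le> 2 * t * B w v + t\<^sup>2 * (B v v - B w w * ip v v)" for t
    proof -
      let ?y = "\<lambda>i. w i + t * v i"
      have "ip ?y ?y = 1 + t\<^sup>2 * ip v v"
      proof -
        have "ip ?y ?y = ip w ?y + t * ip v ?y" by (rule ip_add)
        moreover have "ip w ?y = 1" "ip v ?y = t * ip v v"
          using ip_add[of w t v w] ip_add[of w t v v] ip_commute[of v w] v(3) ww(1)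
            ip_commute[of w ?y] ip_commute[of v ?y] by auto
        ultimately show ?thesis by (simp add: power2_eq_square)
      qed
      moreover have "0 \<le> t\<^sup>2 * ip v v" by (simp add: ip_nonneg)
      ultimately have "B w w * (1 + t\<^sup>2 * ip v v) \<le> B ?y ?y"
        using min[of ?y] ww v by (simp add: ip_add)
      then show ?thesis by (simp add: B_add algebra_simps)
    qed
    then have "\<forall>t. 0 \<le> t * (2 * B w v) + t\<^sup>2 * (B v v - B w w * ip v v)"
      by (simp add: mult_ac)
    then have pos: "0 \<le> t * b + t\<^sup>2 * c" if "b = 2 * B w v" "c = B v v - B w w * ip v v" for t b c
      using that by blast
    define b c where "b = 2 * B w v" and "c = B v v - B w w * ip v v"
    have "b = 0"
    proof (rule ccontr)
      assume "b \<noteq> 0"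
      \<comment> \<open>with this \<open>t\<close> the linear term is twice as large as the bound for the quadratic one\<close>
      define h where "h = 2 * (\<bar>c\<bar> + 1)"
      define t where "t = - b / h"
      have "h > 0" by (simp add: h_def)
      then have t2: "t\<^sup>2 * (2 * (\<bar>c\<bar> + 1)) = - t * b"
        unfolding h_def[symmetric] by (simp add: t_def power2_eq_square)
      have "t * b = - (b * b / h)" by (simp add: t_def)
      moreover have "b * b / h > 0"
        using \<open>b \<noteq> 0\<close> \<open>h > 0\<close> by (intro divide_pos_pos) (simp add: zero_less_mult_iff, auto)
      ultimately have "t * b < 0" by simp
      have "t\<^sup>2 * c \<le> t\<^sup>2 * (\<bar>c\<bar> + 1)" by (intro mult_left_mono) auto
      with t2 have "t * b + t\<^sup>2 * c \<le> t * b / 2" by (simp add: algebra_simps)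
      with pos[OF b_def c_def, of t] \<open>t * b < 0\<close> show False by simp
    qed
    then show ?thesis by (simp add: b_def)
  qed
  define c where "c = B w w"
  define z where "z i = (if i < m then Sw i + (- c) * w i else 0)" for i
  have ip_z: "ip z x = ip Sw x - c * ip w x" for x
    by (simp add: ip_def z_def algebra_simps sum_subtractf sum_distrib_left)
  have "ip Sw (col a) = 0" if "a < k" for a
  proof -
    have "ip Sw (col a) = (\<Sum>i<m. \<Sum>j<m. w j * (S j i * W (i, a)))"
      by (simp add: ip_def Sw_def col_def sum_distrib_left sum_distrib_right sym mult_ac)
    also have "\<dots> = (\<Sum>j<m. w j * (l a * W (j, a)))"
      by (subst sum.swap) (simp add: eig[OF that] flip: sum_distrib_left)
    also have "\<dots> = l a * ip w (col a)"
      by (simp add: ip_def col_def sum_distrib_left mult_ac)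
    finally show ?thesis using ww(2)[OF that] by simp
  qed
  then have z_col: "ip z (col a) = 0" if "a < k" for a
    using that ww(2) by (simp add: ip_z)
  have z_w: "ip w z = 0"
    using ip_commute[of w z] ww(1) B_Sw[of w] by (simp add: ip_z c_def)
  have "B w z = 0"
    by (rule variation) (auto simp: z_col z_w, simp add: z_def)
  then have "ip z z = 0"
    using z_w B_Sw[of z] by (simp add: ip_z)
  then have "\<forall>i\<in>{..<m}. z i * z i = 0"
    unfolding ip_def by (subst (asm) sum_nonneg_eq_0_iff) auto
  then have "\<forall>i<m. Sw i = c * w i"
    by (auto simp: z_def)
  then show ?thesis
    using ww by (intro exI[of _ w] exI[of _ c]) (simp add: Sw_def ip_def col_def power2_eq_square)
qed

theorem symmetric_orthonormal_eigenbasis: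
  fixes S :: "nat \<Rightarrow> nat \<Rightarrow> real"
  assumes sym: "\<And>i j. S i j = S j i"
  obtains W l where "orthonormal m m W"
    "\<And>a i. a < m \<Longrightarrow> i < m \<Longrightarrow> (\<Sum>j<m. S i j * W (j, a)) = l a * W (i, a)"
proof -
  have "\<exists>W l. orthonormal m k W \<and>
      (\<forall>a<k. \<forall>i<m. (\<Sum>j<m. S i j * W (j, a)) = l a * W (i, a))" if "k \<le> m" for k
    using that
  proof (induction k)
    case 0
    then show ?case by (simp add: orthonormal_def)
  next
    case (Suc k)
    then obtain W l where W: "orthonormal m k W"
      and l: "\<And>a i. a < k \<Longrightarrow> i < m \<Longrightarrow> (\<Sum>j<m. S i j * W (j, a)) = l a * W (i, a)"
      by auto
    obtain w c where w: "(\<Sum>i<m. (w i)\<^sup>2) = 1" "\<And>a. a < k \<Longrightarrow> (\<Sum>i<m. w i * W (i, a)) = 0"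
      "\<And>i. i < m \<Longrightarrow> (\<Sum>j<m. S i j * w j) = c * w i"
      using symmetric_eigenvector_in_complement[OF sym W _ l] Suc.prems by auto
    show ?case
      using orthonormal_extend_column[OF W w(1,2)] l w(3)
      by (intro exI[of _ "\<lambda>(i, a). if a = k then w i else W (i, a)"] exI[of _ "l(k := c)"])
        (auto simp: less_Suc_eq)
  qed
  then show ?thesis using that by blast
qed

lemma eigenbasis_quadratic_form:
  fixes S :: "nat \<Rightarrow> nat \<Rightarrow> real"
  assumes "orthonormal m m W"
    and "\<And>a i. a < m \<Longrightarrow> i < m \<Longrightarrow> (\<Sum>j<m. S i j * W (j, a)) = l a * W (i, a)"
    and sym: "\<And>i j. S i j = S j i"
  shows "(\<Sum>i<m. \<Sum>j<m. S i j * x i * x j) = (\<Sum>a<m. l a * (\<Sum>i<m. W (i, a) * x i)\<^sup>2)"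
proof -
  let ?Sx = "\<lambda>i. \<Sum>j<m. S i j * x j"
  have "(\<Sum>i<m. \<Sum>j<m. S i j * x i * x j) = (\<Sum>i<m. x i * ?Sx i)"
    by (simp add: sum_distrib_left mult_ac)
  also have "\<dots> = (\<Sum>a<m. (\<Sum>j<m. W (j, a) * x j) * (\<Sum>j<m. W (j, a) * ?Sx j))"
    by (rule orthonormal_complete_parseval[OF assms(1), symmetric])
  also have "(\<Sum>j<m. W (j, a) * ?Sx j) = l a * (\<Sum>j<m. W (j, a) * x j)" if "a < m" for a
  proof -
    have "(\<Sum>j<m. W (j, a) * ?Sx j) = (\<Sum>j<m. \<Sum>i<m. x i * (S i j * W (j, a)))"
      by (simp add: sum_distrib_left sym mult_ac)
    also have "\<dots> = (\<Sum>i<m. x i * (l a * W (i, a)))"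
      by (subst sum.swap) (simp add: assms(2)[OF that] flip: sum_distrib_left)
    finally show ?thesis by (simp add: sum_distrib_left mult_ac)
  qed
  then have "(\<Sum>a<m. (\<Sum>j<m. W (j, a) * x j) * (\<Sum>j<m. W (j, a) * ?Sx j)) =
      (\<Sum>a<m. l a * (\<Sum>i<m. W (i, a) * x i)\<^sup>2)"
    by (intro sum.cong refl) (simp add: power2_eq_square)
  finally show ?thesis .
qed

section \<open>The smallest singular value\<close>

lemma proots_prod_linear_factors: "proots (\<Prod>a\<leftarrow>as. [:- a, 1:]) = mset as" for as :: "real list"
proof (induction as)
  case (Cons a as)
  have "(\<Prod>a\<leftarrow>as. [:- a, 1:]) \<noteq> 0" by (auto simp: prod_list_zero_iff)
  then have "proots ([:- a, 1:] * (\<Prod>a\<leftarrow>as. [:- a, 1:])) = {#a#} + mset as"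
    using Cons.IH by (subst proots_mult) auto
  then show ?case by simp
qed simp

lemma char_poly_orthonormal_eigenbasis:
  fixes M :: "real mat"
  assumes M: "M \<in> carrier_mat m m" and W: "orthonormal m m W"
    and eig: "\<And>a i. a < m \<Longrightarrow> i < m \<Longrightarrow> (\<Sum>j<m. M $$ (i, j) * W (j, a)) = l a * W (i, a)"
  shows "char_poly M = (\<Prod>a\<leftarrow>map l [0..<m]. [:- a, 1:])"
proof -
  define P where "P = mat m m W"
  define B where "B = mat m m (\<lambda>(i, j). if i = j then l i else 0)"
  have carr: "P \<in> carrier_mat m m" "B \<in> carrier_mat m m" "transpose_mat P \<in> carrier_mat m m"
    by (simp_all add: P_def B_def)
  have PQ: "P * transpose_mat P = 1\<^sub>m m"
    using orthonormal_complete[OF W]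
    by (intro eq_matI) (auto simp: P_def scalar_prod_def lessThan_atLeast0)
  have QP: "transpose_mat P * P = 1\<^sub>m m"
    using orthonormalD[OF W]
    by (intro eq_matI) (auto simp: P_def scalar_prod_def lessThan_atLeast0)
  have MP: "M * P = P * B"
  proof (rule eq_matI)
    fix i j assume "i < dim_row (P * B)" "j < dim_col (P * B)"
    then have ij: "i < m" "j < m" by (simp_all add: P_def B_def)
    have "(M * P) $$ (i, j) = (\<Sum>k<m. M $$ (i, k) * W (k, j))"
      using ij M by (auto simp: P_def scalar_prod_def lessThan_atLeast0)
    also have "\<dots> = (\<Sum>k<m. W (i, k) * (if k = j then l k else 0))"
      using ij by (simp add: eig if_distrib[of "\<lambda>x. _ * x"] cong: if_cong)
    also have "\<dots> = (P * B) $$ (i, j)"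
      using ij by (auto simp: P_def B_def scalar_prod_def lessThan_atLeast0)
    finally show "(M * P) $$ (i, j) = (P * B) $$ (i, j)" .
  qed (use M in \<open>auto simp: P_def B_def\<close>)
  have "M = M * (P * transpose_mat P)"
    using M PQ by simp
  also have "\<dots> = P * B * transpose_mat P"
    using assoc_mult_mat[OF M carr(1,3)] MP by simp
  finally have "similar_mat M B"
    unfolding similar_mat_def using similar_mat_witI[OF PQ QP _ M carr(2,1,3)] by blast
  then have "char_poly M = char_poly B" by (rule char_poly_similar)
  also have "\<dots> = (\<Prod>a\<leftarrow>diag_mat B. [:- a, 1:])"
    by (rule char_poly_upper_triangular[OF carr(2)]) (auto simp: B_def)
  also have "diag_mat B = map l [0..<m]"
    by (auto simp: diag_mat_def B_def)
  finally show ?thesis .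
qed

lemma last_rev_sorted_list_of_multiset:
  fixes xs :: "real list"
  assumes "xs \<noteq> []"
  shows "rev (sort xs) ! (length xs - 1) = Min (set xs)"
proof -
  have "rev (sort xs) ! (length xs - 1) = sort xs ! 0"
    using assms by (subst rev_nth) auto
  also have "\<dots> = Min (set (sort xs))"
  proof -
    obtain y ys where "sort xs = y # ys"
      using assms by (metis neq_Nil_conv set_empty set_sort)
    then show ?thesis using sorted_sort[of xs] by (auto simp: Min_insert2)
  qed
  finally show ?thesis by simp
qed

text \<open>An orthonormal eigenbasis of \<open>A A\<^sup>T\<close> makes both its characteristic polynomial and the
  quadratic form of \<open>A A\<^sup>T\<close> explicit. So the smallest singular value is the minimum gain of
  \<open>x \<mapsto> A\<^sup>T x\<close>.\<close>

theorem sigma_min_variational: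
  fixes A :: "real mat"
  assumes A: "A \<in> carrier_mat m c" and "1 \<le> m"
  defines "q \<equiv> \<lambda>x. \<Sum>k<c. (\<Sum>i<m. x i * A $$ (i, k))\<^sup>2"
  shows "0 \<le> sigma_min A"
    and "\<And>x. (sigma_min A)\<^sup>2 * (\<Sum>i<m. (x i)\<^sup>2) \<le> q x"
    and "\<exists>w. (\<Sum>i<m. (w i)\<^sup>2) = 1 \<and> q w = (sigma_min A)\<^sup>2"
proof -
  define S where "S i j = (\<Sum>k<c. A $$ (i, k) * A $$ (j, k))" for i j
  have sym: "S i j = S j i" for i j by (simp add: S_def mult.commute)
  obtain W l where W: "orthonormal m m W"
    and eig: "\<And>a i. a < m \<Longrightarrow> i < m \<Longrightarrow> (\<Sum>j<m. S i j * W (j, a)) = l a * W (i, a)"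
    by (rule symmetric_orthonormal_eigenbasis[of S m]) (rule sym, erule that, assumption)
  have q_S: "q x = (\<Sum>i<m. \<Sum>j<m. S i j * x i * x j)" for x
  proof -
    have "q x = (\<Sum>k<c. \<Sum>i<m. \<Sum>j<m. A $$ (i, k) * A $$ (j, k) * x i * x j)"
      by (simp add: q_def power2_eq_square sum_product mult_ac)
    also have "\<dots> = (\<Sum>i<m. \<Sum>j<m. \<Sum>k<c. A $$ (i, k) * A $$ (j, k) * x i * x j)"
      by (subst sum.swap, rule sum.cong[OF refl], rule sum.swap)
    finally show ?thesis by (simp add: S_def sum_distrib_right)
  qed
  have q_diag: "q x = (\<Sum>a<m. l a * (\<Sum>i<m. W (i, a) * x i)\<^sup>2)" for x
    unfolding q_S using W eig sym by (rule eigenbasis_quadratic_form[of m W S l x]) assumption+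
  have q_col: "q (\<lambda>i. W (i, a)) = l a" if "a < m" for a
  proof -
    have "q (\<lambda>i. W (i, a)) = (\<Sum>b<m. l b * (if b = a then 1 else 0))"
      unfolding q_diag using that by (intro sum.cong refl) (simp add: orthonormalD[OF W])
    then show ?thesis using that by (simp add: sum_delta_mult_less)
  qed
  have l_nonneg: "0 \<le> l a" if "a < m" for a
    unfolding q_col[OF that, symmetric] q_def by (intro sum_nonneg) simp
  let ?M = "A * transpose_mat A"
  have M: "?M \<in> carrier_mat m m" using A by simp
  have "char_poly ?M = (\<Prod>a\<leftarrow>map l [0..<m]. [:- a, 1:])"
  proof (rule char_poly_orthonormal_eigenbasis[OF M W])
    fix a i assume ai: "a < m" "i < m"
    have "?M $$ (i, j) = S i j" if "j < m" for j
      using A that ai by (auto simp: S_def scalar_prod_def lessThan_atLeast0)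
    then show "(\<Sum>j<m. ?M $$ (i, j) * W (j, a)) = l a * W (i, a)"
      using eig[OF ai] by simp
  qed
  then have "proots (char_poly ?M) = mset (map l [0..<m])"
    by (simp only: proots_prod_linear_factors)
  then have "image_mset sqrt (proots (char_poly ?M)) = mset (map (sqrt \<circ> l) [0..<m])"
    by (simp add: multiset.map_comp)
  then have "singular_value A m = rev (sort (map (sqrt \<circ> l) [0..<m])) ! (m - 1)"
    by (simp only: singular_value_def sorted_list_of_multiset_mset)
  then have "sigma_min A = rev (sort (map (sqrt \<circ> l) [0..<m])) ! (m - 1)"
    using A by (simp add: sigma_min_def)
  also have "\<dots> = Min ((sqrt \<circ> l) ` {..<m})"
    using last_rev_sorted_list_of_multiset[of "map (sqrt \<circ> l) [0..<m]"] \<open>1 \<le> m\<close>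
    by (simp add: atLeast0LessThan)
  finally have sigma: "sigma_min A = Min ((sqrt \<circ> l) ` {..<m})" .
  have "sigma_min A \<in> (sqrt \<circ> l) ` {..<m}"
    unfolding sigma using \<open>1 \<le> m\<close> by (intro Min_in) (auto simp: lessThan_empty_iff)
  then obtain a where a: "a < m" "sigma_min A = sqrt (l a)" by auto
  show nonneg: "0 \<le> sigma_min A" using a l_nonneg by simp
  have le: "(sigma_min A)\<^sup>2 \<le> l b" if "b < m" for b
  proof -
    have "sigma_min A \<le> sqrt (l b)" unfolding sigma using that by (intro Min_le) auto
    then have "(sigma_min A)\<^sup>2 \<le> (sqrt (l b))\<^sup>2" using nonneg by (intro power_mono) auto
    then show ?thesis using l_nonneg[OF that] by simp
  qed
  show "(sigma_min A)\<^sup>2 * (\<Sum>i<m. (x i)\<^sup>2) \<le> q x" for x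
  proof -
    have "(\<Sum>i<m. (x i)\<^sup>2) = (\<Sum>a<m. (\<Sum>i<m. W (i, a) * x i)\<^sup>2)"
      using orthonormal_complete_parseval[OF W, of x x] by (simp add: power2_eq_square)
    then have "(sigma_min A)\<^sup>2 * (\<Sum>i<m. (x i)\<^sup>2) =
        (\<Sum>a<m. (sigma_min A)\<^sup>2 * (\<Sum>i<m. W (i, a) * x i)\<^sup>2)"
      by (simp add: sum_distrib_left)
    also have "\<dots> \<le> q x"
      unfolding q_diag by (intro sum_mono mult_right_mono le) auto
    finally show ?thesis .
  qed
  show "\<exists>w. (\<Sum>i<m. (w i)\<^sup>2) = 1 \<and> q w = (sigma_min A)\<^sup>2"
    using q_col[OF a(1)] a l_nonneg orthonormalD[OF W a(1) a(1)]
    by (intro exI[of _ "\<lambda>i. W (i, a)"]) (simp add: power2_eq_square)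
qed

section \<open>Flattenings as families of slices\<close>

lemma finite_tensor_indices [simp]: "finite (tensor_indices D n)"
  unfolding tensor_indices_def by (intro finite_PiE) auto

lemma tensor_indices_less: "k \<in> tensor_indices D m \<Longrightarrow> j < D \<Longrightarrow> k j < m j"
  unfolding tensor_indices_def by (auto dest: PiE_mem)

lemma tensor_indices_update:
  assumes "k \<in> tensor_indices D m" "d < D" "r < m' d" "\<And>j. j \<noteq> d \<Longrightarrow> m j = m' j"
  shows "k(d := r) \<in> tensor_indices D m'"
proof -
  have "k j < m' j" if "j < D" "j \<noteq> d" for j
    using tensor_indices_less[OF assms(1) that(1)] assms(4)[OF that(2)] by simp
  moreover have "k j = undefined" if "\<not> j < D" for j
    using assms(1) that unfolding tensor_indices_def by (auto simp: PiE_iff extensional_def)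
  ultimately show ?thesis
    using assms(2,3) unfolding tensor_indices_def by (auto simp: PiE_iff extensional_def)
qed

text \<open>The residues of \<open>c\<close> modulo the partial products of the bases are determined by the lower
  digits, so the digits determine \<open>c\<close>; surjectivity follows by counting.\<close>

lemma digits_bij_betw:
  "bij_betw (\<lambda>c. \<lambda>j\<in>{..<D}. (c div (\<Prod>l<j. b l)) mod b j) {..<(\<Prod>l<D. b l)} (tensor_indices D b)"
  (is "bij_betw ?f ?A ?B")
proof -
  have "inj_on ?f ?A"
  proof (rule inj_onI)
    fix c c' assume c: "c \<in> ?A" "c' \<in> ?A" "?f c = ?f c'"
    have digit: "(c div (\<Prod>l<j. b l)) mod b j = (c' div (\<Prod>l<j. b l)) mod b j" if "j < D" for j
      using fun_cong[OF c(3), of j] that by simp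
    have "c mod (\<Prod>l<j. b l) = c' mod (\<Prod>l<j. b l)" if "j \<le> D" for j
      using that by (induction j) (simp_all add: mod_mult2_eq digit)
    from this[of D] show "c = c'" using c(1,2) by simp
  qed
  moreover have "?f ` ?A = ?B"
  proof (rule card_subset_eq)
    show "?f ` ?A \<subseteq> ?B"
    proof (rule image_subsetI)
      fix c assume "c \<in> ?A"
      then have "(\<Prod>l<D. b l) \<noteq> 0" by (auto simp del: prod_zero_iff)
      then have "b j > 0" if "j < D" for j using that by (auto simp: prod_zero_iff)
      then show "?f c \<in> ?B" by (auto simp: tensor_indices_def)
    qed
    show "card (?f ` ?A) = card ?B"
      using \<open>inj_on ?f ?A\<close> by (simp add: card_image tensor_indices_def card_PiE)
  qed simp
  ultimately show ?thesis by (simp add: bij_betw_def)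
qed

lemma sum_tensor_indices_split:
  assumes "d < D"
  shows "(\<Sum>k\<in>tensor_indices D m. f k) =
    (\<Sum>k\<in>tensor_indices D (m(d := 1)). \<Sum>r<m d. f (k(d := r)))"
proof -
  have "bij_betw (\<lambda>(k, r). k(d := r)) (tensor_indices D (m(d := 1)) \<times> {..<m d}) (tensor_indices D m)"
  proof (rule bij_betw_byWitness[of _ "\<lambda>k. (k(d := 0), k d)"])
    show "\<forall>a\<in>tensor_indices D (m(d := 1)) \<times> {..<m d}.
        (\<lambda>k. (k(d := 0), k d)) ((\<lambda>(k, r). k(d := r)) a) = a"
      using tensor_indices_less[OF _ assms, of _ "m(d := 1)"] by (auto simp: fun_eq_iff)
    show "\<forall>k\<in>tensor_indices D m. (\<lambda>(k, r). k(d := r)) ((\<lambda>k. (k(d := 0), k d)) k) = k"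
      by simp
    show "(\<lambda>(k, r). k(d := r)) ` (tensor_indices D (m(d := 1)) \<times> {..<m d}) \<subseteq> tensor_indices D m"
      using tensor_indices_update[OF _ assms, of _ "m(d := 1)" _ m] by auto
    show "(\<lambda>k. (k(d := 0), k d)) ` tensor_indices D m \<subseteq> tensor_indices D (m(d := 1)) \<times> {..<m d}"
      using tensor_indices_update[OF _ assms, of _ m 0 "m(d := 1)"] tensor_indices_less[OF _ assms]
      by auto
  qed
  from sum.reindex_bij_betw[OF this, of f] show ?thesis
    by (simp add: sum.cartesian_product case_prod_unfold)
qed

text \<open>\<open>slice_form D m d C x\<close> is \<open>\<parallel>C\<^sub>(\<^sub>d\<^sub>)\<^sup>T x\<parallel>\<^sup>2\<close>. The columns of the flattening are
  indexed here by the multi-indices whose \<open>d\<close>th entry is \<open>0\<close>, which avoids mixed-radix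
  arithmetic.\<close>

definition slice_form :: "nat \<Rightarrow> (nat \<Rightarrow> nat) \<Rightarrow> nat \<Rightarrow> tensor \<Rightarrow> (nat \<Rightarrow> real) \<Rightarrow> real" where
  "slice_form D m d C x =
     (\<Sum>k\<in>tensor_indices D (m(d := 1)). (\<Sum>r<m d. x r * C (k(d := r)))\<^sup>2)"

text \<open>Changing the base in position \<open>d\<close> to \<open>1\<close> turns the products over all positions but \<open>d\<close> into
  products over all positions, and the digit in position \<open>d\<close> into \<open>0\<close>.\<close>

lemma flattening_slice_form:
  assumes "d < D"
  shows "(\<Sum>c<(\<Prod>j\<in>{..<D} - {d}. m j). (\<Sum>r<m d. x r * flattening D m d C $$ (r, c))\<^sup>2) =
    slice_form D m d C x"
proof -
  let ?b = "m(d := 1)"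
  have prod: "(\<Prod>l\<in>{..<j} - {d}. m l) = (\<Prod>l<j. ?b l)" for j
    by (rule prod.mono_neutral_cong_left) (auto split: if_splits)
  have "(\<Sum>r<m d. x r * flattening D m d C $$ (r, c)) = (\<Sum>r<m d. x r *
      C ((\<lambda>j\<in>{..<D}. (c div (\<Prod>l<j. ?b l)) mod ?b j)(d := r)))"
    if "c < (\<Prod>l<D. ?b l)" for c
  proof (intro sum.cong refl)
    fix r assume "r \<in> {..<m d}"
    have "(\<lambda>j\<in>{..<D}. if j = d then r else (c div (\<Prod>l\<in>{..<j} - {d}. m l)) mod m j) =
        (\<lambda>j\<in>{..<D}. (c div (\<Prod>l<j. ?b l)) mod ?b j)(d := r)"
      unfolding prod using assms by (auto simp: fun_eq_iff restrict_def)
    then show "x r * flattening D m d C $$ (r, c) =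
        x r * C ((\<lambda>j\<in>{..<D}. (c div (\<Prod>l<j. ?b l)) mod ?b j)(d := r))"
      using \<open>r \<in> {..<m d}\<close> that by (simp add: flattening_def prod del: fun_upd_apply)
  qed
  then have "(\<Sum>c<(\<Prod>j\<in>{..<D} - {d}. m j). (\<Sum>r<m d. x r * flattening D m d C $$ (r, c))\<^sup>2) =
      (\<Sum>c<(\<Prod>l<D. ?b l). (\<Sum>r<m d. x r *
        C ((\<lambda>j\<in>{..<D}. (c div (\<Prod>l<j. ?b l)) mod ?b j)(d := r)))\<^sup>2)"
    unfolding prod by (intro sum.cong refl) (simp del: fun_upd_apply)
  also have "\<dots> = slice_form D m d C x"
    unfolding slice_form_def by (rule sum.reindex_bij_betw[OF digits_bij_betw])
  finally show ?thesis .
qed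

lemma sigma_min_flattening:
  fixes C :: tensor
  assumes "d < D" "1 \<le> m d"
  defines "\<sigma> \<equiv> sigma_min (flattening D m d C)"
  shows "0 \<le> \<sigma>"
    and "\<And>x. \<sigma>\<^sup>2 * (\<Sum>r<m d. (x r)\<^sup>2) \<le> slice_form D m d C x"
    and "\<exists>w. (\<Sum>r<m d. (w r)\<^sup>2) = 1 \<and> slice_form D m d C w = \<sigma>\<^sup>2"
proof -
  let ?A = "flattening D m d C" and ?c = "\<Prod>j\<in>{..<D} - {d}. m j"
  have "?A \<in> carrier_mat (m d) ?c" by (simp add: flattening_def)
  note var = sigma_min_variational[OF this assms(2), folded \<sigma>_def]
  have slice: "(\<Sum>c<?c. (\<Sum>r<m d. x r * ?A $$ (r, c))\<^sup>2) = slice_form D m d C x" for x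
    by (rule flattening_slice_form[OF assms(1)])
  show "0 \<le> \<sigma>" by (rule var(1))
  show "\<sigma>\<^sup>2 * (\<Sum>r<m d. (x r)\<^sup>2) \<le> slice_form D m d C x" for x
    using var(2)[of x] by (simp only: slice)
  show "\<exists>w. (\<Sum>r<m d. (w r)\<^sup>2) = 1 \<and> slice_form D m d C w = \<sigma>\<^sup>2"
    using var(3) by (simp only: slice)
qed

section \<open>The algebra of multilinear products\<close>

definition id_matrix :: matrix where
  "id_matrix = (\<lambda>(i, k). if i = k then 1 else 0)"

definition matrix_mult :: "nat \<Rightarrow> matrix \<Rightarrow> matrix \<Rightarrow> matrix" where
  "matrix_mult h A B = (\<lambda>(i, k). \<Sum>r<h. A (i, r) * B (r, k))"

definition matrix_transpose :: "matrix \<Rightarrow> matrix" where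
  "matrix_transpose A = (\<lambda>(i, k). A (k, i))"

text \<open>The factors of the product with \<open>A\<close> in mode \<open>d\<close> alone. The identity has no fixed size, so the
  same family serves for all sizes of the other modes.\<close>

definition in_mode :: "nat \<Rightarrow> matrix \<Rightarrow> nat \<Rightarrow> matrix" where
  "in_mode d A = (\<lambda>j. if j = d then A else id_matrix)"

lemma multilinear_product_cong:
  assumes "\<And>j a b. j < D \<Longrightarrow> a < n j \<Longrightarrow> b < m j \<Longrightarrow> U j (a, b) = V j (a, b)"
    and "\<And>k. k \<in> tensor_indices D m \<Longrightarrow> A k = B k"
  shows "multilinear_product D n m U A = multilinear_product D n m V B"
  unfolding multilinear_product_def
  by (intro ext if_cong sum.cong prod.cong arg_cong2[of _ _ _ _ "(*)"] refl)
    (simp_all add: assms tensor_indices_less)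

lemma multilinear_product_in_tensors: "multilinear_product D n m U A \<in> tensors D n"
  by (simp add: tensors_def multilinear_product_def)

lemma multilinear_product_compose:
  "multilinear_product D n m U (multilinear_product D m l V A) =
   multilinear_product D n l (\<lambda>j. matrix_mult (m j) (U j) (V j)) A"
proof
  fix i
  have "(\<Sum>k\<in>tensor_indices D m. (\<Prod>j<D. U j (i j, k j)) *
          (\<Sum>p\<in>tensor_indices D l. (\<Prod>j<D. V j (k j, p j)) * A p)) =
      (\<Sum>p\<in>tensor_indices D l. (\<Sum>k\<in>tensor_indices D m.
          \<Prod>j<D. U j (i j, k j) * V j (k j, p j)) * A p)"
    by (simp add: sum_distrib_left sum_distrib_right prod.distrib mult_ac) (rule sum.swap)
  also have "\<dots> = (\<Sum>p\<in>tensor_indices D l.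
      (\<Prod>j<D. matrix_mult (m j) (U j) (V j) (i j, p j)) * A p)"
  proof (intro sum.cong refl arg_cong2[of _ _ _ _ "(*)"])
    fix p
    have "(\<Prod>j<D. \<Sum>r<m j. U j (i j, r) * V j (r, p j)) =
        (\<Sum>k\<in>tensor_indices D m. \<Prod>j<D. U j (i j, k j) * V j (k j, p j))"
      unfolding tensor_indices_def by (subst prod_sum_PiE) auto
    then show "(\<Sum>k\<in>tensor_indices D m. \<Prod>j<D. U j (i j, k j) * V j (k j, p j)) =
        (\<Prod>j<D. matrix_mult (m j) (U j) (V j) (i j, p j))"
      by (simp add: matrix_mult_def)
  qed
  finally show "multilinear_product D n m U (multilinear_product D m l V A) i =
      multilinear_product D n l (\<lambda>j. matrix_mult (m j) (U j) (V j)) A i"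
    by (simp add: multilinear_product_def)
qed

lemma prod_id_matrix:
  assumes "i \<in> tensor_indices D m" "k \<in> tensor_indices D m"
  shows "(\<Prod>j<D. id_matrix (i j, k j)) = (if k = i then 1 else 0)"
proof (cases "k = i")
  case False
  then obtain j where "j < D" "i j \<noteq> k j"
    using assms unfolding tensor_indices_def by (metis PiE_ext lessThan_iff)
  then show ?thesis using False by (auto simp: id_matrix_def intro!: prod_zero)
qed (simp add: id_matrix_def)

lemma multilinear_product_id:
  assumes "A \<in> tensors D m"
    and "\<And>j a b. j < D \<Longrightarrow> a < m j \<Longrightarrow> b < m j \<Longrightarrow> V j (a, b) = id_matrix (a, b)"
  shows "multilinear_product D m m V A = A"
proof
  fix i
  have "multilinear_product D m m V A = multilinear_product D m m (\<lambda>_. id_matrix) A"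
    by (rule multilinear_product_cong) (use assms(2) in auto)
  moreover have "multilinear_product D m m (\<lambda>_. id_matrix) A i = A i"
  proof (cases "i \<in> tensor_indices D m")
    case True
    then have "(\<Sum>k\<in>tensor_indices D m. (\<Prod>j<D. id_matrix (i j, k j)) * A k) =
        (\<Sum>k\<in>tensor_indices D m. if k = i then A k else 0)"
      by (intro sum.cong refl) (simp add: prod_id_matrix)
    then show ?thesis using True by (simp add: multilinear_product_def)
  next
    case False
    then show ?thesis using assms(1) by (simp add: multilinear_product_def tensors_def)
  qed
  ultimately show "multilinear_product D m m V A i = A i" by simp
qed

lemma multilinear_product_linear:
  "multilinear_product D n m U (\<lambda>k. s * A k + t * B k) i =
   s * multilinear_product D n m U A i + t * multilinear_product D n m U B i"
  by (simp add: multilinear_product_def sum_distrib_left sum.distrib algebra_simps)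

lemma multilinear_product_diff:
  "multilinear_product D n m U (\<lambda>k. A k - B k) i =
   multilinear_product D n m U A i - multilinear_product D n m U B i"
  using multilinear_product_linear[of D n m U 1 A "-1" B] by simp

lemma prod_update:
  fixes D d :: nat
  assumes "d < D"
  shows "(\<Prod>j<D. (U(d := A)) j (i j, k j)) = A (i d, k d) * (\<Prod>j\<in>{..<D} - {d}. U j (i j, k j))"
  using assms by (subst prod.remove[of "{..<D}" d]) (auto intro!: prod.cong)

lemma multilinear_product_linear_in_factor:
  assumes "d < D"
  shows "multilinear_product D n m (U(d := \<lambda>e. s * A e + t * B e)) C i =
    s * multilinear_product D n m (U(d := A)) C i + t * multilinear_product D n m (U(d := B)) C i"
proof -
  have "(\<Prod>j<D. (U(d := \<lambda>e. s * A e + t * B e)) j (i j, k j)) * C k =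
      s * ((\<Prod>j<D. (U(d := A)) j (i j, k j)) * C k) +
      t * ((\<Prod>j<D. (U(d := B)) j (i j, k j)) * C k)" for k
    unfolding prod_update[OF assms] by (simp only: distrib_right mult.assoc)
  then show ?thesis
    unfolding multilinear_product_def by (simp only: sum.distrib sum_distrib_left[symmetric]) simp
qed

lemma multilinear_product_adjoint:
  "inner_on (tensor_indices D n) (multilinear_product D n m U A) B =
   inner_on (tensor_indices D m) A
     (multilinear_product D m n (\<lambda>j. matrix_transpose (U j)) B)"
proof -
  define P where "P i k = (\<Prod>j<D. U j (i j, k j))" for i k
  have "inner_on (tensor_indices D n) (multilinear_product D n m U A) B =
      (\<Sum>i\<in>tensor_indices D n. \<Sum>k\<in>tensor_indices D m. A k * (P i k * B i))"
    by (simp add: inner_on_def multilinear_product_def P_def[symmetric] sum_distrib_left mult_ac)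
  also have "\<dots> = (\<Sum>k\<in>tensor_indices D m. \<Sum>i\<in>tensor_indices D n. A k * (P i k * B i))"
    by (rule sum.swap)
  also have "\<dots> = inner_on (tensor_indices D m) A
      (multilinear_product D m n (\<lambda>j. matrix_transpose (U j)) B)"
    by (simp add: inner_on_def multilinear_product_def matrix_transpose_def P_def[symmetric]
        sum_distrib_left)
  finally show ?thesis .
qed

lemma matrix_mult_transpose_orthonormal:
  assumes "orthonormal n m U" "a < m" "b < m"
  shows "matrix_mult n (matrix_transpose U) U (a, b) = id_matrix (a, b)"
  using orthonormalD[OF assms] by (simp add: matrix_mult_def matrix_transpose_def id_matrix_def)

lemma multilinear_product_transpose_cancel:
  assumes "\<And>j. j < D \<Longrightarrow> orthonormal (n j) (m j) (U j)" and "A \<in> tensors D m"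
  shows "multilinear_product D m n (\<lambda>j. matrix_transpose (U j)) (multilinear_product D n m U A) = A"
  unfolding multilinear_product_compose
  by (rule multilinear_product_id[OF assms(2)], rule matrix_mult_transpose_orthonormal)
    (use assms(1) in auto)

text \<open>The transposed factors are adjoint and cancel the product on the left.\<close>

lemma multilinear_product_isometry:
  assumes "\<And>j. j < D \<Longrightarrow> orthonormal (n j) (m j) (U j)"
  shows "L2_set (multilinear_product D n m U A) (tensor_indices D n) = L2_set A (tensor_indices D m)"
proof -
  define A' where "A' k = (if k \<in> tensor_indices D m then A k else 0)" for k
  have "multilinear_product D n m U A = multilinear_product D n m U A'"
    by (rule multilinear_product_cong) (simp_all add: A'_def)
  moreover have "inner_on (tensor_indices D n)
      (multilinear_product D n m U A') (multilinear_product D n m U A') =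
      inner_on (tensor_indices D m) A' A'"
    unfolding multilinear_product_adjoint
    by (subst multilinear_product_transpose_cancel[OF assms]) (auto simp: A'_def tensors_def)
  moreover have "inner_on (tensor_indices D m) A' A' = inner_on (tensor_indices D m) A A"
    by (simp add: inner_on_def A'_def)
  ultimately show ?thesis by (simp add: L2_set_eq_sqrt_inner_on)
qed

text \<open>The adjoint of an isometry is a contraction.\<close>

lemma multilinear_product_transpose_contraction:
  assumes "\<And>j. j < D \<Longrightarrow> orthonormal (n j) (m j) (U j)"
  shows "L2_set (multilinear_product D m n (\<lambda>j. matrix_transpose (U j)) X) (tensor_indices D m)
         \<le> L2_set X (tensor_indices D n)"
proof -
  let ?Y = "multilinear_product D m n (\<lambda>j. matrix_transpose (U j)) X"
  let ?y = "L2_set ?Y (tensor_indices D m)"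
  have "?y\<^sup>2 = inner_on (tensor_indices D n) (multilinear_product D n m U ?Y) X"
    by (simp add: L2_set_power2 multilinear_product_adjoint)
  also have "\<dots> \<le> ?y * L2_set X (tensor_indices D n)"
    using abs_inner_on_le[of "tensor_indices D n" "multilinear_product D n m U ?Y" X]
    by (simp add: multilinear_product_isometry[OF assms])
  finally show ?thesis
    using L2_set_nonneg[of ?Y "tensor_indices D m"]
    by (cases "?y = 0") (auto simp: power2_eq_square)
qed

subsection \<open>Products in a single mode\<close>

lemma orthonormal_id_matrix: "orthonormal n n id_matrix"
  by (simp add: orthonormal_def id_matrix_def sum_delta_mult_less)

lemma multilinear_product_in_mode_entry:
  assumes "d < D" and k: "k \<in> tensor_indices D (m(d := 1))" and "i < n'"
  shows "multilinear_product D (m(d := n')) m (in_mode d A) C (k(d := i)) =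
    (\<Sum>r<m d. A (i, r) * C (k(d := r)))"
proof -
  have ki: "k(d := i) \<in> tensor_indices D (m(d := n'))"
    using assms by (intro tensor_indices_update[OF k]) auto
  have kd: "p d = 0" if "p \<in> tensor_indices D (m(d := 1))" for p
    using tensor_indices_less[OF that \<open>d < D\<close>] by simp
  have entry: "(\<Prod>j<D. in_mode d A j ((k(d := i)) j, (p(d := r)) j)) = A (i, r) * (if p = k then 1 else 0)"
    if p: "p \<in> tensor_indices D (m(d := 1))" for p r
  proof -
    have "(\<Prod>j<D. in_mode d A j ((k(d := i)) j, (p(d := r)) j)) =
        A (i, r) * (\<Prod>j\<in>{..<D} - {d}. id_matrix (k j, p j))"
      using \<open>d < D\<close> by (subst prod.remove[of "{..<D}" d]) (auto simp: in_mode_def intro!: prod.cong)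
    also have "(\<Prod>j\<in>{..<D} - {d}. id_matrix (k j, p j)) = (\<Prod>j<D. id_matrix (k j, p j))"
      using \<open>d < D\<close> kd[OF k] kd[OF p]
      by (subst prod.remove[of "{..<D}" d]) (auto simp: id_matrix_def)
    finally show ?thesis by (simp add: prod_id_matrix[OF k p])
  qed
  have "multilinear_product D (m(d := n')) m (in_mode d A) C (k(d := i)) =
      (\<Sum>p\<in>tensor_indices D (m(d := 1)). \<Sum>r<m d. A (i, r) * (if p = k then 1 else 0) * C (p(d := r)))"
    using ki unfolding multilinear_product_def sum_tensor_indices_split[OF \<open>d < D\<close>, of _ m]
    by (simp add: entry del: fun_upd_apply)
  also have "\<dots> = (\<Sum>p\<in>tensor_indices D (m(d := 1)).
      if p = k then \<Sum>r<m d. A (i, r) * C (p(d := r)) else 0)"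
    by (intro sum.cong refl) simp
  also have "\<dots> = (\<Sum>r<m d. A (i, r) * C (k(d := r)))"
    using k by simp
  finally show ?thesis .
qed

lemma multilinear_product_in_mode_norm:
  assumes "d < D"
  shows "(L2_set (multilinear_product D (m(d := n')) m (in_mode d A) C) (tensor_indices D (m(d := n'))))\<^sup>2
    = (\<Sum>i<n'. slice_form D m d C (\<lambda>r. A (i, r)))"
proof -
  have "(L2_set (multilinear_product D (m(d := n')) m (in_mode d A) C) (tensor_indices D (m(d := n'))))\<^sup>2
    = (\<Sum>k\<in>tensor_indices D (m(d := 1)). \<Sum>i<n'. (\<Sum>r<m d. A (i, r) * C (k(d := r)))\<^sup>2)"
    unfolding L2_set_power2 inner_on_def sum_tensor_indices_split[OF assms, of _ "m(d := n')"]
    by (simp add: multilinear_product_in_mode_entry[OF assms] power2_eq_square del: fun_upd_apply)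
      (simp add: multilinear_product_in_mode_entry[OF assms])
  also have "\<dots> = (\<Sum>i<n'. slice_form D m d C (\<lambda>r. A (i, r)))"
    unfolding slice_form_def by (rule sum.swap)
  finally show ?thesis .
qed

lemma multilinear_product_factor_mode:
  assumes "d < D"
  shows "multilinear_product D n m (U(d := A)) C =
    multilinear_product D n (m(d := n d)) (U(d := id_matrix))
      (multilinear_product D (m(d := n d)) m (in_mode d A) C)"
  unfolding multilinear_product_compose
  by (rule multilinear_product_cong)
    (auto simp: matrix_mult_def in_mode_def id_matrix_def sum_delta_mult_less)

text \<open>The orthonormal factors in the other modes do not change norms, so only the flattening of
  the core in mode \<open>d\<close> and the rows of the matrix in mode \<open>d\<close> matter.\<close>

lemma multilinear_product_update_norm:
  assumes "d < D" and "\<And>j. j < D \<Longrightarrow> j \<noteq> d \<Longrightarrow> orthonormal (n j) (m j) (U j)"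
  shows "(L2_set (multilinear_product D n m (U(d := A)) C) (tensor_indices D n))\<^sup>2 =
    (\<Sum>i<n d. slice_form D m d C (\<lambda>r. A (i, r)))"
proof -
  have orth: "orthonormal (n j) ((m(d := n d)) j) ((U(d := id_matrix)) j)" if "j < D" for j
    using assms(2)[OF that] orthonormal_id_matrix by (cases "j = d") auto
  have "L2_set (multilinear_product D n m (U(d := A)) C) (tensor_indices D n) =
      L2_set (multilinear_product D (m(d := n d)) m (in_mode d A) C) (tensor_indices D (m(d := n d)))"
    by (subst multilinear_product_factor_mode[OF assms(1)], rule multilinear_product_isometry, rule orth)
  then show ?thesis by (simp only: multilinear_product_in_mode_norm[OF assms(1)])
qed

lemma slice_form_nonneg: "0 \<le> slice_form D m d C x"
  unfolding slice_form_def by (intro sum_nonneg) simp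

lemma slice_form_scale: "slice_form D m d C (\<lambda>r. s * x r) = s\<^sup>2 * slice_form D m d C x"
proof -
  have "(\<Sum>r<m d. s * x r * C (k(d := r))) = s * (\<Sum>r<m d. x r * C (k(d := r)))" for k
    by (simp add: sum_distrib_left mult_ac)
  then show ?thesis
    by (simp only: slice_form_def power_mult_distrib sum_distrib_left[of "s\<^sup>2"])
qed

lemma slice_form_eq_L2_set:
  "sqrt (slice_form D m d C x) =
   L2_set (\<lambda>k. \<Sum>r<m d. x r * C (k(d := r))) (tensor_indices D (m(d := 1)))"
  by (simp add: slice_form_def L2_set_def)

lemma slice_form_le:
  assumes "d < D"
  shows "slice_form D m d C x \<le> (\<Sum>r<m d. (x r)\<^sup>2) * (L2_set C (tensor_indices D m))\<^sup>2"
proof -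
  have "(\<Sum>r<m d. x r * C (k(d := r)))\<^sup>2 \<le> (\<Sum>r<m d. (x r)\<^sup>2) * (\<Sum>r<m d. (C (k(d := r)))\<^sup>2)" for k
    by (rule Cauchy_Schwarz_ineq_sum)
  then have "slice_form D m d C x \<le> (\<Sum>k\<in>tensor_indices D (m(d := 1)).
      (\<Sum>r<m d. (x r)\<^sup>2) * (\<Sum>r<m d. (C (k(d := r)))\<^sup>2))"
    unfolding slice_form_def by (intro sum_mono)
  also have "\<dots> = (\<Sum>r<m d. (x r)\<^sup>2) * (L2_set C (tensor_indices D m))\<^sup>2"
    unfolding L2_set_power2 inner_on_def sum_tensor_indices_split[OF assms, of _ m]
    by (simp add: sum_distrib_left power2_eq_square)
  finally show ?thesis .
qed

text \<open>For fixed \<open>x\<close>, the square root of the slice form is a seminorm of the core. So lower bounds for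
  singular values survive small perturbations of the core.\<close>

lemma sqrt_slice_form_triangle:
  assumes "d < D"
  shows "sqrt (slice_form D m d C x) \<le> sqrt (slice_form D m d C' x) +
    sqrt (\<Sum>r<m d. (x r)\<^sup>2) * L2_set (\<lambda>k. C k - C' k) (tensor_indices D m)"
proof -
  have "sqrt (slice_form D m d C x) \<le> sqrt (slice_form D m d C' x) +
      sqrt (slice_form D m d (\<lambda>k. C k - C' k) x)"
    unfolding slice_form_eq_L2_set
    by (rule order_trans[OF _ L2_set_triangle_ineq])
      (simp add: sum.distrib[symmetric] algebra_simps)
  also have "sqrt (slice_form D m d (\<lambda>k. C k - C' k) x) \<le>
      sqrt ((\<Sum>r<m d. (x r)\<^sup>2) * (L2_set (\<lambda>k. C k - C' k) (tensor_indices D m))\<^sup>2)"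
    by (intro real_sqrt_le_mono slice_form_le assms)
  also have "\<dots> = sqrt (\<Sum>r<m d. (x r)\<^sup>2) * L2_set (\<lambda>k. C k - C' k) (tensor_indices D m)"
    by (simp add: real_sqrt_mult)
  finally show ?thesis by simp
qed

section \<open>Multilinear rank\<close>

lemma stiefel_iff:
  "U \<in> stiefel n m \<longleftrightarrow> (\<forall>e. e \<notin> matrix_indices n m \<longrightarrow> U e = 0) \<and> orthonormal n m U"
  by (simp add: stiefel_def orthonormal_def)

definition cut_matrix :: "nat \<Rightarrow> nat \<Rightarrow> matrix \<Rightarrow> matrix" where
  "cut_matrix n m A = (\<lambda>e. if e \<in> matrix_indices n m then A e else 0)"

lemma cut_matrix_apply [simp]: "i < n \<Longrightarrow> a < m \<Longrightarrow> cut_matrix n m A (i, a) = A (i, a)"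
  by (simp add: cut_matrix_def matrix_indices_def)

lemma cut_matrix_stiefel: "orthonormal n m A \<Longrightarrow> cut_matrix n m A \<in> stiefel n m"
  by (simp add: stiefel_iff orthonormal_def) (simp add: cut_matrix_def)

text \<open>All flattenings have full row rank, expressed by a positive lower bound for their singular
  values.\<close>

definition nondegenerate :: "nat \<Rightarrow> (nat \<Rightarrow> nat) \<Rightarrow> tensor \<Rightarrow> bool" where
  "nondegenerate D m C \<longleftrightarrow>
     (\<forall>d<D. \<exists>s>0. \<forall>x. s\<^sup>2 * (\<Sum>r<m d. (x r)\<^sup>2) \<le> slice_form D m d C x)"

text \<open>The orthogonal projection onto the column space of \<open>U\<close> with \<open>m\<close> orthonormal columns, and the
  complementary projection.\<close>

definition proj_onto :: "nat \<Rightarrow> matrix \<Rightarrow> matrix" where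
  "proj_onto m U = matrix_mult m U (matrix_transpose U)"

definition proj_off :: "nat \<Rightarrow> matrix \<Rightarrow> matrix" where
  "proj_off m U = (\<lambda>e. id_matrix e - proj_onto m U e)"

lemma matrix_mult_id_left: "i < h \<Longrightarrow> matrix_mult h id_matrix A (i, k) = A (i, k)"
  by (simp add: matrix_mult_def id_matrix_def sum_delta_mult_less)

lemma matrix_mult_id_right: "k < h \<Longrightarrow> matrix_mult h A id_matrix (i, k) = A (i, k)"
  by (simp add: matrix_mult_def id_matrix_def sum_delta_mult_less)

lemma matrix_mult_proj_onto:
  "matrix_mult n (proj_onto m U) A (i, k) = (\<Sum>b<m. (\<Sum>j<n. U (j, b) * A (j, k)) * U (i, b))"
  unfolding matrix_mult_def proj_onto_def matrix_transpose_def
  by (simp add: sum_distrib_left sum_distrib_right mult_ac) (rule sum.swap)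

lemma matrix_mult_proj_off:
  assumes "i < n"
  shows "matrix_mult n (proj_off m U) A (i, k) =
    A (i, k) - (\<Sum>b<m. (\<Sum>j<n. U (j, b) * A (j, k)) * U (i, b))"
  using matrix_mult_proj_onto[of n m U A i k] matrix_mult_id_left[OF assms, of A k]
  by (simp add: matrix_mult_def proj_off_def left_diff_distrib sum_subtractf)

lemma proj_off_self:
  assumes "orthonormal n m U" "i < n" "k < m"
  shows "matrix_mult n (proj_off m U) U (i, k) = 0"
  using assms by (simp add: matrix_mult_proj_off orthonormalD sum_delta_mult_less)

lemma in_mode_compose:
  assumes "d < D"
  shows "multilinear_product D n n (in_mode d A) (multilinear_product D n m U C) =
    multilinear_product D n m (U(d := matrix_mult (n d) A (U d))) C"
  unfolding multilinear_product_compose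
  by (rule multilinear_product_cong) (auto simp: in_mode_def matrix_mult_id_left)

lemma L2_set_zero_tensor:
  assumes "A \<in> tensors D n" "L2_set A (tensor_indices D n) = 0"
  shows "A = (\<lambda>_. 0)"
  using assms by (auto simp: tensors_def L2_set_eq_0_iff fun_eq_iff) 

text \<open>A Tucker decomposition of \<open>X\<close> confines \<open>X\<close> in mode \<open>d\<close> to the column space of the
  \<open>d\<close>th factor.\<close>

lemma proj_off_tucker:
  assumes "d < D" "orthonormal (n d) (m d) (U d)"
  shows "multilinear_product D n n (in_mode d (proj_off (m d) (U d))) (multilinear_product D n m U C)
    = (\<lambda>_. 0)"
proof -
  have "multilinear_product D n m (U(d := matrix_mult (n d) (proj_off (m d) (U d)) (U d))) C =
      multilinear_product D n m (U(d := \<lambda>_. 0)) C"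
    by (rule multilinear_product_cong) (auto simp: proj_off_self[OF assms(2)])
  also have "\<dots> = (\<lambda>_. 0)"
    using multilinear_product_linear_in_factor[OF assms(1), of n m U 0 "\<lambda>_. 0" 0 "\<lambda>_. 0" C] by auto
  finally show ?thesis unfolding in_mode_compose[OF assms(1)] .
qed

text \<open>Off another column space, a Tucker decomposition loses at least \<open>s\<close> times what its \<open>d\<close>th factor
  loses. This converts closeness of tensors into closeness of column spaces.\<close>

lemma proj_off_tucker_norm:
  assumes "d < D" and "\<And>j. j < D \<Longrightarrow> orthonormal (n j) (m j) (U j)"
    and "\<And>x. s\<^sup>2 * (\<Sum>r<m d. (x r)\<^sup>2) \<le> slice_form D m d C x"
  shows "s\<^sup>2 * (\<Sum>i<n d. \<Sum>r<m d. (matrix_mult (n d) (proj_off m' V) (U d) (i, r))\<^sup>2) \<le>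
    (L2_set (multilinear_product D n n (in_mode d (proj_off m' V)) (multilinear_product D n m U C))
      (tensor_indices D n))\<^sup>2"
proof -
  have "(L2_set (multilinear_product D n n (in_mode d (proj_off m' V)) (multilinear_product D n m U C))
      (tensor_indices D n))\<^sup>2 =
      (\<Sum>i<n d. slice_form D m d C (\<lambda>r. matrix_mult (n d) (proj_off m' V) (U d) (i, r)))"
    unfolding in_mode_compose[OF assms(1)]
    by (rule multilinear_product_update_norm[OF assms(1)]) (rule assms(2))
  moreover have "s\<^sup>2 * (\<Sum>i<n d. \<Sum>r<m d. (matrix_mult (n d) (proj_off m' V) (U d) (i, r))\<^sup>2) \<le>
      (\<Sum>i<n d. slice_form D m d C (\<lambda>r. matrix_mult (n d) (proj_off m' V) (U d) (i, r)))"
    unfolding sum_distrib_left[of "s\<^sup>2" _ "{..<n d}"] by (intro sum_mono assms(3))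
  ultimately show ?thesis by simp
qed

text \<open>The operator is self-adjoint and idempotent, so \<open>\<parallel>Y\<parallel>\<^sup>2 = \<langle>X, Y\<rangle>\<close> for the image \<open>Y\<close> of \<open>X\<close>.\<close>

lemma proj_off_contraction:
  assumes "d < D" "orthonormal (n d) k V"
  shows "L2_set (multilinear_product D n n (in_mode d (proj_off k V)) X) (tensor_indices D n)
    \<le> L2_set X (tensor_indices D n)"
proof -
  let ?Q = "proj_off k V"
  let ?Y = "multilinear_product D n n (in_mode d ?Q) X"
  have sym: "?Q (i, j) = ?Q (j, i)" for i j
    by (simp add: proj_off_def proj_onto_def matrix_mult_def matrix_transpose_def id_matrix_def
        mult.commute)
  have idem: "matrix_mult (n d) ?Q ?Q (i, j) = ?Q (i, j)" if "i < n d" "j < n d" for i j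
  proof -
    have "(\<Sum>l<n d. V (l, b) * ?Q (l, j)) = 0" if "b < k" for b
    proof -
      have "(\<Sum>l<n d. V (l, b) * ?Q (l, j)) = matrix_mult (n d) ?Q V (j, b)"
        unfolding matrix_mult_def by (simp add: sym[of j] mult.commute)
      then show ?thesis using proj_off_self[OF assms(2) \<open>j < n d\<close> that] by simp
    qed
    then show ?thesis using that by (simp add: matrix_mult_proj_off)
  qed
  have "(L2_set ?Y (tensor_indices D n))\<^sup>2 = inner_on (tensor_indices D n) X
      (multilinear_product D n n (\<lambda>j. matrix_transpose (in_mode d ?Q j)) ?Y)"
    unfolding L2_set_power2 by (rule multilinear_product_adjoint)
  also have "multilinear_product D n n (\<lambda>j. matrix_transpose (in_mode d ?Q j)) ?Y = ?Y"
    unfolding multilinear_product_compose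
  proof (rule multilinear_product_cong)
    fix j a b assume "j < D" "a < n j" "b < n j"
    have "matrix_mult (n j) (matrix_transpose (in_mode d ?Q j)) (in_mode d ?Q j) (a, b) =
        matrix_mult (n j) (in_mode d ?Q j) (in_mode d ?Q j) (a, b)"
      by (simp add: matrix_mult_def matrix_transpose_def in_mode_def id_matrix_def sym[of a] eq_commute)
    also have "\<dots> = in_mode d ?Q j (a, b)"
      using \<open>a < n j\<close> \<open>b < n j\<close> by (auto simp: in_mode_def idem matrix_mult_id_left)
    finally show "matrix_mult (n j) (matrix_transpose (in_mode d ?Q j)) (in_mode d ?Q j) (a, b) =
        in_mode d ?Q j (a, b)" .
  qed simp
  also have "inner_on (tensor_indices D n) X ?Y \<le>
      L2_set X (tensor_indices D n) * L2_set ?Y (tensor_indices D n)"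
    using abs_inner_on_le[of "tensor_indices D n" X ?Y] by simp
  finally show ?thesis
    using L2_set_nonneg[of ?Y "tensor_indices D n"]
    by (cases "L2_set ?Y (tensor_indices D n) = 0") (auto simp: power2_eq_square)
qed

text \<open>If the columns of \<open>U\<close> lie in the column space of \<open>V\<close>, their coordinates with respect to \<open>V\<close> form
  an orthonormal system in dimension \<open>m'\<close>.\<close>

lemma orthonormal_contained_le:
  assumes U: "orthonormal n m U" and V: "orthonormal n m' V"
    and contained: "\<And>i r. i < n \<Longrightarrow> r < m \<Longrightarrow> matrix_mult n (proj_off m' V) U (i, r) = 0"
  shows "m \<le> m'"
proof -
  define B where "B = (\<lambda>(b, r). \<Sum>j<n. V (j, b) * U (j, r))"
  have U_eq: "U (i, r) = (\<Sum>b<m'. B (b, r) * V (i, b))" if "i < n" "r < m" for i r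
    using contained[OF that] that by (simp add: matrix_mult_proj_off B_def)
  have "orthonormal m' m B"
    unfolding orthonormal_def
  proof (intro allI impI)
    fix a b assume ab: "a < m" "b < m"
    have "(\<Sum>i<n. (\<Sum>c<m'. B (c, a) * V (i, c)) * (\<Sum>c<m'. B (c, b) * V (i, c))) =
        (\<Sum>i<n. U (i, a) * U (i, b))"
      using ab by (intro sum.cong refl) (simp add: U_eq)
    then show "(\<Sum>c<m'. B (c, a) * B (c, b)) = (if a = b then 1 else 0)"
      using orthonormalD[OF U ab] by (simp add: orthonormal_inner_comb[OF V])
  qed
  then show ?thesis by (rule orthonormal_card_le)
qed

text \<open>In any other Tucker decomposition, the column space of the \<open>d\<close>th factor contains that of \<open>U d\<close>:
  the projection off it kills the tensor, hence kills \<open>U d\<close>, as the core is nondegenerate.\<close>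

theorem nondegenerate_imp_rank:
  assumes C: "C \<in> tensors D m" "nondegenerate D m C"
    and U: "\<And>j. j < D \<Longrightarrow> U j \<in> stiefel (n j) (m j)"
  shows "multilinear_product D n m U C \<in> tensors_of_rank D n m"
proof -
  let ?X = "multilinear_product D n m U C"
  have "m d \<le> m' d"
    if tucker: "tucker_decomposition D n m' ?X C' U'" and d: "d < D" for m' C' U' d
  proof -
    obtain s where s: "s > 0" "\<And>x. s\<^sup>2 * (\<Sum>r<m d. (x r)\<^sup>2) \<le> slice_form D m d C x"
      using C(2) d unfolding nondegenerate_def by blast
    have X: "?X = multilinear_product D n m' U' C'" and U': "orthonormal (n d) (m' d) (U' d)"
      using tucker d by (auto simp: tucker_decomposition_def stiefel_iff)
    let ?R = "matrix_mult (n d) (proj_off (m' d) (U' d)) (U d)"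
    have "multilinear_product D n n (in_mode d (proj_off (m' d) (U' d))) ?X = (\<lambda>_. 0)"
      unfolding X using d U' by (rule proj_off_tucker)
    then have "s\<^sup>2 * (\<Sum>i<n d. \<Sum>r<m d. (?R (i, r))\<^sup>2) \<le> 0"
      using proj_off_tucker_norm[OF d _ s(2), of n U "m' d" "U' d"] U
      by (simp add: stiefel_iff L2_set_0')
    then have "(\<Sum>i<n d. \<Sum>r<m d. (?R (i, r))\<^sup>2) \<le> 0"
      using s(1) by (simp add: mult_le_0_iff)
    then have "(\<Sum>i<n d. \<Sum>r<m d. (?R (i, r))\<^sup>2) = 0"
      by (simp add: order_antisym sum_nonneg)
    then have "?R (i, r) = 0" if "i < n d" "r < m d" for i r
      using that by (subst (asm) sum_nonneg_eq_0_iff; simp add: sum_nonneg sum_nonneg_eq_0_iff)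
    moreover have "orthonormal (n d) (m d) (U d)"
      using U[OF d] by (simp add: stiefel_iff)
    ultimately show ?thesis
      using orthonormal_contained_le[of "n d" "m d" "U d" "m' d" "U' d"] U' by blast
  qed
  moreover have "tucker_decomposition D n m ?X C U"
    using C(1) U by (simp add: tucker_decomposition_def)
  ultimately show ?thesis
    unfolding tensors_of_rank_def has_multilinear_rank_def
    using multilinear_product_in_tensors by blast
qed

corollary nondegenerate_imp_core:
  assumes "C \<in> tensors D m" "nondegenerate D m C"
  shows "C \<in> core_tensors D m"
proof -
  have "multilinear_product D m m (\<lambda>j. cut_matrix (m j) (m j) id_matrix) C \<in> core_tensors D m"
    using assms by (rule nondegenerate_imp_rank) (intro cut_matrix_stiefel orthonormal_id_matrix)
  then show ?thesis
    by (subst (asm) multilinear_product_id[OF assms(1)]) auto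
qed

text \<open>If the \<open>d\<close>th flattening of the core had a unit vector \<open>w\<close> in its left kernel, the core would
  be confined in mode \<open>d\<close> to the orthogonal complement of \<open>w\<close>, and an orthonormal basis of that
  complement would give a smaller Tucker decomposition.\<close>

theorem core_sigma_min_pos:
  assumes C: "C \<in> core_tensors D m" and d: "d < D" "1 \<le> m d"
  shows "0 < sigma_min (flattening D m d C)"
proof (rule ccontr)
  assume "\<not> 0 < sigma_min (flattening D m d C)"
  then have "sigma_min (flattening D m d C) = 0"
    using sigma_min_flattening(1)[of d D m, OF d, of C] by simp
  then obtain w where w: "(\<Sum>r<m d. (w r)\<^sup>2) = 1" "slice_form D m d C w = 0"
    using sigma_min_flattening(3)[of d D m, OF d, of C] by auto
  have CT: "C \<in> tensors D m" using C by (simp add: tensors_of_rank_def)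
  have "orthonormal (m d) 1 (\<lambda>(i, a). w i)"
    using w(1) by (simp add: orthonormal_def power2_eq_square)
  then obtain W where W: "orthonormal (m d) (m d) W" "\<And>i. W (i, 0) = w i"
    using orthonormal_extend[of "m d" 1 _ "m d"] d(2) by fastforce
  define Q where "Q = (\<lambda>(i, a). W (i, Suc a))"
  define m' where "m' = m(d := m d - 1)"
  define E where "E = (\<lambda>(i, r). w i * w r)"
  have Q: "orthonormal (m d) (m d - 1) Q"
    using W(1) by (auto simp: orthonormal_def Q_def)
  have QQ: "matrix_mult (m d - 1) Q (matrix_transpose Q) (i, j) = id_matrix (i, j) - E (i, j)"
    if "i < m d" "j < m d" for i j
  proof -
    have "(\<Sum>a<m d. W (i, a) * W (j, a)) = w i * w j + (\<Sum>a<m d - 1. W (i, Suc a) * W (j, Suc a))"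
      using sum.lessThan_Suc_shift[of "\<lambda>a. W (i, a) * W (j, a)" "m d - 1"] d(2) W(2) by simp
    then show ?thesis
      using orthonormal_complete[OF W(1) that]
      by (simp add: matrix_mult_def matrix_transpose_def Q_def E_def id_matrix_def)
  qed
  define C' where "C' = multilinear_product D m' m (in_mode d (matrix_transpose Q)) C"
  define V where "V j = cut_matrix (m j) (m' j) (in_mode d Q j)" for j
  have "orthonormal (m j) (m' j) (in_mode d Q j)" for j
    using Q orthonormal_id_matrix by (cases "j = d") (auto simp: m'_def in_mode_def)
  then have V: "V j \<in> stiefel (m j) (m' j)" for j
    unfolding V_def by (rule cut_matrix_stiefel)
  have "multilinear_product D m m' V C' = multilinear_product D m m' (in_mode d Q) C'"
    by (rule multilinear_product_cong) (simp_all add: V_def)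
  also have "\<dots> = multilinear_product D m m ((in_mode d id_matrix)(d := \<lambda>e. 1 * id_matrix e + (- 1) * E e)) C"
    unfolding C'_def multilinear_product_compose
    using QQ by (intro multilinear_product_cong) (auto simp: in_mode_def m'_def matrix_mult_id_left)
  also have "\<dots> = C"
  proof
    fix i
    have upd: "(in_mode d id_matrix)(d := A) = in_mode d A" for A
      by (auto simp: in_mode_def)
    have "(L2_set (multilinear_product D (m(d := m d)) m (in_mode d E) C)
        (tensor_indices D (m(d := m d))))\<^sup>2 = 0"
      unfolding multilinear_product_in_mode_norm[OF d(1)]
      by (simp add: E_def slice_form_scale w(2))
    then have "multilinear_product D m m (in_mode d E) C = (\<lambda>_. 0)"
      by (intro L2_set_zero_tensor[OF multilinear_product_in_tensors]) simp
    moreover have "multilinear_product D m m (in_mode d id_matrix) C = C"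
      by (rule multilinear_product_id[OF CT]) (simp add: in_mode_def)
    ultimately show "multilinear_product D m m
        ((in_mode d id_matrix)(d := \<lambda>e. 1 * id_matrix e + (- 1) * E e)) C i = C i"
      using multilinear_product_linear_in_factor[OF d(1), of m m "in_mode d id_matrix" 1 id_matrix
          "- 1" E C i] unfolding upd by simp
  qed
  finally have "tucker_decomposition D m m' C C' V"
    using V multilinear_product_in_tensors unfolding tucker_decomposition_def C'_def by metis
  then have "m d \<le> m' d"
    using C d(1) unfolding tensors_of_rank_def has_multilinear_rank_def by blast
  then show False using d(2) by (simp add: m'_def)
qed

lemma core_nondegenerate:
  assumes "C \<in> core_tensors D m" "\<And>j. j < D \<Longrightarrow> 1 \<le> m j"
  shows "nondegenerate D m C"
  unfolding nondegenerate_def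
proof (intro allI impI)
  fix d assume "d < D"
  then show "\<exists>s>0. \<forall>x. s\<^sup>2 * (\<Sum>r<m d. (x r)\<^sup>2) \<le> slice_form D m d C x"
    using core_sigma_min_pos[OF assms(1)] sigma_min_flattening(2)[of d D m] assms(2)
    by (intro exI[of _ "sigma_min (flattening D m d C)"]) auto
qed

text \<open>Cores of full multilinear rank form an open set: perturbing the core by less than its
  smallest singular values keeps all of them positive.\<close>

lemma core_perturbation:
  assumes "C' \<in> tensors D m" "r > 0"
    and "\<And>d x. d < D \<Longrightarrow> r\<^sup>2 * (\<Sum>r<m d. (x r)\<^sup>2) \<le> slice_form D m d C x"
    and "L2_set (\<lambda>k. C k - C' k) (tensor_indices D m) < r"
  shows "C' \<in> core_tensors D m"
proof (rule nondegenerate_imp_core[OF assms(1)], unfold nondegenerate_def, intro allI impI)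
  fix d assume d: "d < D"
  let ?e = "L2_set (\<lambda>k. C k - C' k) (tensor_indices D m)"
  have "(r - ?e)\<^sup>2 * (\<Sum>r<m d. (x r)\<^sup>2) \<le> slice_form D m d C' x" for x
  proof -
    let ?x = "sqrt (\<Sum>r<m d. (x r)\<^sup>2)"
    have x2: "?x\<^sup>2 = (\<Sum>r<m d. (x r)\<^sup>2)" by (simp add: sum_nonneg)
    have "r * ?x = sqrt (r\<^sup>2 * (\<Sum>r<m d. (x r)\<^sup>2))"
      using assms(2) by (simp add: real_sqrt_mult)
    also have "\<dots> \<le> sqrt (slice_form D m d C x)"
      by (intro real_sqrt_le_mono assms(3) d)
    also have "\<dots> \<le> sqrt (slice_form D m d C' x) + ?x * ?e"
      by (rule sqrt_slice_form_triangle[OF d])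
    finally have "(r - ?e) * ?x \<le> sqrt (slice_form D m d C' x)"
      by (simp add: algebra_simps)
    then have "((r - ?e) * ?x)\<^sup>2 \<le> (sqrt (slice_form D m d C' x))\<^sup>2"
      using assms(4) by (intro power_mono) (auto simp: sum_nonneg)
    then show ?thesis
      by (simp add: power_mult_distrib x2 slice_form_nonneg)
  qed
  then show "\<exists>s>0. \<forall>x. s\<^sup>2 * (\<Sum>r<m d. (x r)\<^sup>2) \<le> slice_form D m d C' x"
    using assms(4) by (intro exI[of _ "r - ?e"]) auto
qed

section \<open>Bounds for the Riemannian distance\<close>

lemma L2_set_diff_commute:
  fixes x y :: "'i \<Rightarrow> real"
  shows "L2_set (\<lambda>i. x i - y i) I = L2_set (\<lambda>i. y i - x i) I"
  by (simp add: L2_set_def power2_commute)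

text \<open>A curve is at least as long as its chord: project it onto the direction of the chord and
  apply the fundamental theorem of calculus.\<close>

lemma chord_le_riemannian_dist:
  assumes "finite I"
  shows "ennreal (L2_set (\<lambda>i. y i - x i) I) \<le> riemannian_dist I M x y"
  unfolding riemannian_dist_def
proof (rule INF_greatest)
  fix \<gamma> :: "real \<Rightarrow> 'a \<Rightarrow> real"
  assume "\<gamma> \<in> {\<gamma>. (\<forall>i\<in>I. (\<lambda>t. \<gamma> t i) piecewise_C1_differentiable_on {0..1}) \<and>
      (\<forall>t\<in>{0..1}. \<gamma> t \<in> M) \<and> \<gamma> 0 = x \<and> \<gamma> 1 = y}"
  then have pC1: "\<And>i. i \<in> I \<Longrightarrow> (\<lambda>t. \<gamma> t i) piecewise_C1_differentiable_on {0..1}"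
    and ends: "\<gamma> 0 = x" "\<gamma> 1 = y" by auto
  define L where "L = L2_set (\<lambda>i. y i - x i) I"
  have "\<forall>i\<in>I. \<exists>S. finite S \<and> (\<lambda>t. \<gamma> t i) C1_differentiable_on ({0..1} - S)"
    using pC1 unfolding piecewise_C1_differentiable_on_def by blast
  then obtain T where T: "\<forall>i\<in>I. finite (T i) \<and> (\<lambda>t. \<gamma> t i) C1_differentiable_on ({0..1} - T i)"
    by metis
  define S where "S = (\<Union>i\<in>I. T i)"
  have "finite S" unfolding S_def using T assms by blast
  define v where "v t i = vector_derivative (\<lambda>s. \<gamma> s i) (at t)" for t i
  define u where "u i = (y i - x i) / L" for i
  define f where "f t = (\<Sum>i\<in>I. u i * \<gamma> t i)" for t
  define f' where "f' t = (\<Sum>i\<in>I. u i * v t i)" for t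
  define A where "A = {0..1} - S"
  have C1: "(\<lambda>t. \<gamma> t i) C1_differentiable_on A" if "i \<in> I" for i
  proof -
    have "(\<lambda>t. \<gamma> t i) C1_differentiable_on ({0..1} - T i)" using T that by blast
    then show ?thesis
      by (rule C1_differentiable_on_subset) (use that in \<open>auto simp: A_def S_def\<close>)
  qed
  have deriv: "((\<lambda>t. \<gamma> t i) has_vector_derivative v t i) (at t)" if "i \<in> I" "t \<in> A" for i t
    using C1[OF that(1)] that(2) unfolding C1_differentiable_on_eq v_def
    by (simp add: vector_derivative_works)
  have cont_v: "continuous_on A (\<lambda>t. v t i)" if "i \<in> I" for i
    using C1[OF that] unfolding C1_differentiable_on_eq v_def by simp
  have f_deriv: "(f has_vector_derivative f' t) (at t)" if "t \<in> {0..1} - S" for t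
    unfolding f_def f'_def has_real_derivative_iff_has_vector_derivative[symmetric]
    using deriv that unfolding A_def[symmetric] has_real_derivative_iff_has_vector_derivative[symmetric]
    by (intro DERIV_sum DERIV_cmult) auto
  have "continuous_on {0..1} f"
    unfolding f_def using pC1
    by (intro continuous_intros) (auto simp: piecewise_C1_differentiable_on_def)
  then have "(f' has_integral (f 1 - f 0)) {0..1}"
    using f_deriv \<open>finite S\<close> by (intro fundamental_theorem_of_calculus_strong) auto
  define F where "F t = indicator A t *\<^sub>R f' t" for t
  have "(F has_integral (f 1 - f 0)) {0..1}"
    by (rule has_integral_spike_finite[OF \<open>finite S\<close> _ \<open>(f' has_integral (f 1 - f 0)) {0..1}\<close>])
      (auto simp: F_def A_def)
  then have F_int: "(F has_integral (f 1 - f 0)) UNIV"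
    by (rule has_integral_on_superset) (auto simp: F_def A_def)
  have "A \<in> sets borel"
    unfolding A_def using \<open>finite S\<close> by (intro sets.Diff) (auto intro: borel_closed finite_imp_closed)
  moreover have "continuous_on A f'"
    unfolding f'_def by (intro continuous_intros cont_v)
  ultimately have F_meas: "F \<in> borel_measurable lborel"
    unfolding F_def using borel_measurable_continuous_on_indicator[of A f'] by simp
  \<comment> \<open>also for \<open>L = 0\<close>, where \<open>u = 0\<close> by the convention for division by zero\<close>
  have f_diff: "f 1 - f 0 = L"
  proof -
    have "f 1 - f 0 = (\<Sum>i\<in>I. u i * (y i - x i))"
      by (simp add: f_def ends sum_subtractf right_diff_distrib)
    also have "\<dots> = (\<Sum>i\<in>I. (y i - x i) * (y i - x i)) / L"
      by (simp add: u_def sum_divide_distrib)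
    also have "(\<Sum>i\<in>I. (y i - x i) * (y i - x i)) = L * L"
      using L2_set_power2[of "\<lambda>i. y i - x i" I] by (simp add: L_def inner_on_def power2_eq_square)
    finally show ?thesis by simp
  qed
  have "L2_set u I \<le> 1"
  proof -
    have "L2_set u I = L2_set (\<lambda>i. inverse L * (y i - x i)) I"
      by (rule L2_set_cong) (simp_all add: u_def divide_inverse mult.commute)
    also have "\<dots> = inverse L * L"
      unfolding L_def by (rule L2_set_right_distrib[symmetric]) simp
    finally show ?thesis by (cases "L = 0") simp_all
  qed
  have F_le: "\<bar>F t\<bar> \<le> L2_set (v t) I" for t
  proof -
    have "\<bar>f' t\<bar> \<le> L2_set u I * L2_set (v t) I"
      using abs_inner_on_le[of I u "v t"] by (simp add: f'_def inner_on_def)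
    also have "\<dots> \<le> L2_set (v t) I"
      using \<open>L2_set u I \<le> 1\<close> by (simp add: mult_left_le_one_le)
    finally show ?thesis by (simp add: F_def indicator_def)
  qed
  have "ennreal L \<le> (\<integral>\<^sup>+t. ennreal (norm (F t)) \<partial>lborel)"
  proof (cases "(\<integral>\<^sup>+t. ennreal (norm (F t)) \<partial>lborel) = \<infinity>")
    case False
    then have "integrable lborel F"
      using F_meas by (intro integrableI_bounded) (simp_all add: top.not_eq_extremum)
    then have "(F has_integral (LINT t|lborel. F t)) UNIV"
      by (rule has_integral_integral_lborel)
    then have "(LINT t|lborel. F t) = L"
      using has_integral_unique[OF _ F_int] f_diff by simp
    then show ?thesis
      using integral_norm_bound_ennreal[OF \<open>integrable lborel F\<close>] by (simp add: L_def)
  qed simp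
  also have "\<dots> \<le> curve_length I \<gamma>"
    unfolding curve_length_def
  proof (rule nn_integral_mono)
    fix t
    show "ennreal (norm (F t)) \<le>
        ennreal (L2_set (\<lambda>i. vector_derivative (\<lambda>s. \<gamma> s i) (at t)) I) * indicator {0..1} t"
      using F_le[of t] by (auto simp: v_def[abs_def] F_def A_def indicator_def intro: ennreal_leI)
  qed
  finally show "ennreal (L2_set (\<lambda>i. y i - x i) I) \<le> curve_length I \<gamma>"
    by (simp add: L_def)
qed

lemma riemannian_dist_le_curve:
  fixes \<gamma> \<gamma>' :: "real \<Rightarrow> 'i \<Rightarrow> real"
  assumes deriv: "\<And>i t. i \<in> I \<Longrightarrow> ((\<lambda>s. \<gamma> s i) has_real_derivative \<gamma>' t i) (at t)"
    and cont: "\<And>i. i \<in> I \<Longrightarrow> continuous_on UNIV (\<lambda>t. \<gamma>' t i)"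
    and M: "\<And>t. 0 \<le> t \<Longrightarrow> t \<le> 1 \<Longrightarrow> \<gamma> t \<in> M"
    and speed: "\<And>t. 0 \<le> t \<Longrightarrow> t \<le> 1 \<Longrightarrow> L2_set (\<gamma>' t) I \<le> K"
    and "x = \<gamma> 0" "y = \<gamma> 1"
  shows "riemannian_dist I M x y \<le> ennreal K"
proof -
  have vd: "vector_derivative (\<lambda>s. \<gamma> s i) (at t) = \<gamma>' t i" if "i \<in> I" for i t
    using deriv[OF that, of t]
    by (simp add: has_real_derivative_iff_has_vector_derivative vector_derivative_at)
  have "(\<lambda>t. \<gamma> t i) piecewise_C1_differentiable_on {0..1}" if "i \<in> I" for i
  proof (rule C1_differentiable_imp_piecewise)
    show "(\<lambda>t. \<gamma> t i) C1_differentiable_on {0..1}"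
      unfolding C1_differentiable_on_def
      using deriv[OF that] cont[OF that]
      by (intro exI[of _ "\<lambda>t. \<gamma>' t i"])
        (auto simp: has_real_derivative_iff_has_vector_derivative intro: continuous_on_subset)
  qed
  then have "riemannian_dist I M x y \<le> curve_length I \<gamma>"
    unfolding riemannian_dist_def using M assms(5,6) by (intro INF_lower) auto
  also have "\<dots> \<le> (\<integral>\<^sup>+t. ennreal K * indicator {0..1::real} t \<partial>lborel)"
    unfolding curve_length_def
  proof (rule nn_integral_mono)
    fix t :: real
    have "L2_set (\<lambda>i. vector_derivative (\<lambda>s. \<gamma> s i) (at t)) I = L2_set (\<gamma>' t) I"
      by (rule L2_set_cong) (simp_all add: vd)
    then show "ennreal (L2_set (\<lambda>i. vector_derivative (\<lambda>s. \<gamma> s i) (at t)) I) * indicator {0..1} t \<le>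
        ennreal K * indicator {0..1} t"
      using speed[of t] by (auto simp: indicator_def intro: ennreal_leI)
  qed
  also have "\<dots> = ennreal K"
    by (subst nn_integral_cmult_indicator) auto
  finally show ?thesis .
qed

lemma riemannian_dist_le_segment:
  assumes "\<And>t. 0 \<le> t \<Longrightarrow> t \<le> 1 \<Longrightarrow> (\<lambda>i. x i + t * (y i - x i)) \<in> M"
  shows "riemannian_dist I M x y \<le> ennreal (L2_set (\<lambda>i. y i - x i) I)"
  by (rule riemannian_dist_le_curve[where \<gamma> = "\<lambda>t i. x i + t * (y i - x i)" and \<gamma>' = "\<lambda>t i. y i - x i"])
    (use assms in \<open>auto intro!: derivative_eq_intros\<close>)

section \<open>Principal angles between column spaces\<close>

text \<open>The right singular vectors of \<open>V\<^sup>T U\<close> give adapted orthonormal bases of the two column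
  spaces: the \<open>k\<close>th vector of one basis is orthogonal to all vectors of the other except the
  \<open>k\<close>th, and \<open>c k\<close> is the cosine of the \<open>k\<close>th principal angle. If the projection of \<open>U\<close> off
  the column space of \<open>V\<close> has norm less than 1, all cosines are positive, so that the second
  basis can be normalised.\<close>

lemma principal_vectors:
  assumes U: "orthonormal n m U" and V: "orthonormal n m V"
  defines "R \<equiv> \<lambda>i a. matrix_mult n (proj_off m V) U (i, a)"
  assumes R: "(\<Sum>i<n. \<Sum>a<m. (R i a)\<^sup>2) < 1"
  shows "\<exists>E u q c. orthonormal m m E \<and> orthonormal n m u \<and> orthonormal n m q \<and>
    (\<forall>i<n. \<forall>a<m. U (i, a) = (\<Sum>k<m. u (i, k) * E (a, k))) \<and>
    (\<forall>k<m. \<forall>l<m. (\<Sum>i<n. u (i, k) * q (i, l)) = (if k = l then c k else 0)) \<and>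
    (\<forall>k<m. 0 < c k \<and> c k \<le> 1) \<and>
    (\<Sum>k<m. 1 - (c k)\<^sup>2) = (\<Sum>i<n. \<Sum>a<m. (R i a)\<^sup>2) \<and>
    (\<forall>i<n. \<forall>j<n. (\<Sum>k<m. q (i, k) * q (j, k)) = (\<Sum>b<m. V (i, b) * V (j, b)))"
proof -
  define B where "B b a = (\<Sum>i<n. V (i, b) * U (i, a))" for b a
  define S where "S a a' = (\<Sum>b<m. B b a * B b a')" for a a'
  have S_sym: "S a a' = S a' a" for a a' by (simp add: S_def mult.commute)
  obtain E l where E: "orthonormal m m E"
    and eig: "\<And>k a. k < m \<Longrightarrow> a < m \<Longrightarrow> (\<Sum>a'<m. S a a' * E (a', k)) = l k * E (a, k)"
    by (rule symmetric_orthonormal_eigenbasis[of S m]) (rule S_sym, erule that, assumption)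
  define BE where "BE = (\<lambda>(b, k). \<Sum>a<m. B b a * E (a, k))"
  define u where "u = (\<lambda>(i, k). \<Sum>a<m. U (i, a) * E (a, k))"
  define p where "p = (\<lambda>(i, k). \<Sum>b<m. BE (b, k) * V (i, b))"
  have BE_inner: "(\<Sum>b<m. BE (b, k) * BE (b, k')) = (if k = k' then l k else 0)"
    if "k < m" "k' < m" for k k'
  proof -
    have "(\<Sum>b<m. BE (b, k) * BE (b, k')) =
        (\<Sum>b<m. \<Sum>a<m. \<Sum>a'<m. E (a, k) * (B b a * B b a' * E (a', k')))"
      unfolding BE_def prod.case sum_product by (intro sum.cong refl) (simp add: mult_ac)
    also have "\<dots> = (\<Sum>a<m. \<Sum>b<m. \<Sum>a'<m. E (a, k) * (B b a * B b a' * E (a', k')))"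
      by (rule sum.swap)
    also have "\<dots> = (\<Sum>a<m. \<Sum>a'<m. \<Sum>b<m. E (a, k) * (B b a * B b a' * E (a', k')))"
      by (rule sum.cong[OF refl], rule sum.swap)
    also have "\<dots> = (\<Sum>a<m. E (a, k) * (\<Sum>a'<m. S a a' * E (a', k')))"
      by (simp add: S_def sum_distrib_left sum_distrib_right)
    also have "\<dots> = (\<Sum>a<m. E (a, k) * (l k' * E (a, k')))"
      using that by (intro sum.cong refl) (simp add: eig)
    also have "\<dots> = l k' * (\<Sum>a<m. E (a, k) * E (a, k'))"
      by (simp add: sum_distrib_left mult_ac)
    finally show ?thesis using orthonormalD[OF E that] by simp
  qed
  have BE_u: "BE (b, k) = (\<Sum>i<n. V (i, b) * u (i, k))" for b k
    unfolding BE_def B_def u_def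
    by (simp add: sum_distrib_left sum_distrib_right mult_ac) (rule sum.swap)
  have u_comb: "(\<Sum>i<n. u (i, k) * u (i, k')) = (if k = k' then 1 else 0)"
    if "k < m" "k' < m" for k k'
  proof -
    have "(\<Sum>i<n. u (i, k) * u (i, k')) =
        (\<Sum>i<n. (\<Sum>a<m. E (a, k) * U (i, a)) * (\<Sum>a<m. E (a, k') * U (i, a)))"
      by (simp add: u_def mult.commute)
    then show ?thesis
      using orthonormalD[OF E that] by (simp add: orthonormal_inner_comb[OF U])
  qed
  have pp: "(\<Sum>i<n. p (i, k) * p (i, k')) = (if k = k' then l k else 0)"
    if "k < m" "k' < m" for k k'
    unfolding p_def using BE_inner[OF that] by (simp add: orthonormal_inner_comb[OF V])
  have up: "(\<Sum>i<n. u (i, k) * p (i, k')) = (if k = k' then l k else 0)"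
    if "k < m" "k' < m" for k k'
  proof -
    have "(\<Sum>i<n. u (i, k) * p (i, k')) = (\<Sum>i<n. \<Sum>b<m. BE (b, k') * (V (i, b) * u (i, k)))"
      by (simp add: p_def sum_distrib_left mult_ac)
    also have "\<dots> = (\<Sum>b<m. BE (b, k') * BE (b, k))"
      by (subst sum.swap) (simp add: BE_u sum_distrib_left)
    finally show ?thesis using BE_inner[OF that(2,1)] by auto
  qed
  \<comment> \<open>\<open>p\<close> is the projection of \<open>u\<close> onto the column space of \<open>V\<close>, and \<open>R\<close> in the basis \<open>E\<close> is what is lost\<close>
  have R_eq: "(\<Sum>a<m. R i a * E (a, k)) = u (i, k) - p (i, k)" if "i < n" for i k
  proof -
    have "R i a = U (i, a) - (\<Sum>b<m. B b a * V (i, b))" for a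
      unfolding R_def B_def by (rule matrix_mult_proj_off[OF that])
    then have "(\<Sum>a<m. R i a * E (a, k)) =
        u (i, k) - (\<Sum>a<m. \<Sum>b<m. B b a * E (a, k) * V (i, b))"
      by (simp add: u_def left_diff_distrib right_diff_distrib sum_subtractf sum_distrib_left
          sum_distrib_right mult_ac)
    also have "(\<Sum>a<m. \<Sum>b<m. B b a * E (a, k) * V (i, b)) = p (i, k)"
      unfolding p_def BE_def by (subst sum.swap) (simp add: sum_distrib_right)
    finally show ?thesis .
  qed
  have "(\<Sum>i<n. \<Sum>a<m. (R i a)\<^sup>2) = (\<Sum>i<n. \<Sum>k<m. (u (i, k) - p (i, k))\<^sup>2)"
  proof (rule sum.cong[OF refl])
    fix i assume "i \<in> {..<n}"
    have "(\<Sum>a<m. (R i a)\<^sup>2) = (\<Sum>k<m. (\<Sum>a<m. E (a, k) * R i a) * (\<Sum>a<m. E (a, k) * R i a))"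
      unfolding orthonormal_complete_parseval[OF E] by (simp add: power2_eq_square)
    also have "\<dots> = (\<Sum>k<m. (u (i, k) - p (i, k))\<^sup>2)"
      using \<open>i \<in> {..<n}\<close> by (simp add: R_eq[symmetric] power2_eq_square mult.commute)
    finally show "(\<Sum>a<m. (R i a)\<^sup>2) = (\<Sum>k<m. (u (i, k) - p (i, k))\<^sup>2)" .
  qed
  also have "\<dots> = (\<Sum>k<m. \<Sum>i<n. u (i, k) * u (i, k) - 2 * (u (i, k) * p (i, k)) + p (i, k) * p (i, k))"
    by (subst sum.swap, intro sum.cong refl) (simp add: power2_eq_square algebra_simps)
  also have "\<dots> = (\<Sum>k<m. 1 - l k)"
    by (intro sum.cong refl)
      (simp add: sum.distrib sum_subtractf sum_distrib_left[symmetric] u_comb up pp)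
  finally have R_sum: "(\<Sum>k<m. 1 - l k) = (\<Sum>i<n. \<Sum>a<m. (R i a)\<^sup>2)" by simp
  have l_le: "l k \<le> 1" if "k < m" for k
  proof -
    have "0 \<le> (\<Sum>i<n. (u (i, k) - p (i, k))\<^sup>2)" by (intro sum_nonneg) simp
    also have "\<dots> = (\<Sum>i<n. u (i, k) * u (i, k) - 2 * (u (i, k) * p (i, k)) + p (i, k) * p (i, k))"
      by (intro sum.cong refl) (simp add: power2_eq_square algebra_simps)
    also have "\<dots> = 1 - l k"
      using that by (simp add: sum.distrib sum_subtractf sum_distrib_left[symmetric] u_comb up pp)
    finally show ?thesis by simp
  qed
  have l_pos: "0 < l k" if "k < m" for k
  proof -
    have "1 - l k \<le> (\<Sum>k<m. 1 - l k)"
      using that l_le by (intro member_le_sum) auto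
    then show ?thesis using R R_sum by simp
  qed
  define c where "c k = sqrt (l k)" for k
  have c2: "c k * c k = l k" and c_pos: "0 < c k" "c k \<le> 1" if "k < m" for k
    using l_pos[OF that] l_le[OF that] by (auto simp: c_def)
  define q where "q = (\<lambda>(i, k). p (i, k) / c k)"
  define Y where "Y = (\<lambda>(b, k). BE (b, k) / c k)"
  have q_orth: "orthonormal n m q"
    unfolding orthonormal_def
  proof (intro allI impI)
    fix k k' assume kk: "k < m" "k' < m"
    have "(\<Sum>i<n. q (i, k) * q (i, k')) = (\<Sum>i<n. p (i, k) * p (i, k')) / (c k * c k')"
      by (simp add: q_def sum_divide_distrib)
    then show "(\<Sum>i<n. q (i, k) * q (i, k')) = (if k = k' then 1 else 0)"
      using pp[OF kk] l_pos[OF kk(1)] c_pos[OF kk(2)] by (auto simp: c2[OF kk(2)])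
  qed
  have Y_orth: "orthonormal m m Y"
    unfolding orthonormal_def
  proof (intro allI impI)
    fix k k' assume kk: "k < m" "k' < m"
    have "(\<Sum>b<m. Y (b, k) * Y (b, k')) = (\<Sum>b<m. BE (b, k) * BE (b, k')) / (c k * c k')"
      by (simp add: Y_def sum_divide_distrib)
    then show "(\<Sum>b<m. Y (b, k) * Y (b, k')) = (if k = k' then 1 else 0)"
      using BE_inner[OF kk] l_pos[OF kk(1)] c_pos[OF kk(2)] by (auto simp: c2[OF kk(2)])
  qed
  have q_Y: "q (i, k) = (\<Sum>b<m. Y (b, k) * V (i, b))" for i k
    by (simp add: q_def p_def Y_def sum_divide_distrib)
  have "(\<Sum>k<m. q (i, k) * q (j, k)) = (\<Sum>b<m. V (i, b) * V (j, b))" for i j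
    unfolding q_Y by (rule orthonormal_complete_parseval[OF Y_orth])
  moreover have "U (i, a) = (\<Sum>k<m. u (i, k) * E (a, k))" if "a < m" for i a
    using orthonormal_complete_expansion[OF E that, of "\<lambda>a. U (i, a)"]
    by (simp add: u_def mult.commute)
  moreover have "(\<Sum>i<n. u (i, k) * q (i, k')) = (if k = k' then c k else 0)"
    if "k < m" "k' < m" for k k'
  proof -
    have "(\<Sum>i<n. u (i, k) * q (i, k')) = (\<Sum>i<n. u (i, k) * p (i, k')) / c k'"
      by (simp add: q_def sum_divide_distrib)
    then show ?thesis using up[OF that] c2[OF that(1)] c_pos[OF that(1)] by (auto simp: field_simps)
  qed
  moreover have "(\<Sum>k<m. 1 - (c k)\<^sup>2) = (\<Sum>i<n. \<Sum>a<m. (R i a)\<^sup>2)"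
    unfolding R_sum[symmetric] by (intro sum.cong refl) (simp add: c2 power2_eq_square)
  moreover have "orthonormal n m u"
    using u_comb by (simp add: orthonormal_def)
  ultimately show ?thesis
    using E q_orth c_pos by (intro exI[of _ E] exI[of _ u] exI[of _ q] exI[of _ c]) simp
qed


text \<open>The inequality \<open>x \<le> tan x\<close> without its restriction to acute angles.\<close>

lemma mult_cos_le_sin:
  fixes x :: real
  assumes "0 \<le> x" "x \<le> pi"
  shows "x * cos x \<le> sin x"
proof -
  have "sin 0 - 0 * cos 0 \<le> sin x - x * cos x"
  proof (rule DERIV_nonneg_imp_nondecreasing[OF assms(1)])
    fix t assume t: "0 \<le> t" "t \<le> x"
    have "((\<lambda>x. sin x - x * cos x) has_real_derivative t * sin t) (at t)"
      by (auto intro!: derivative_eq_intros)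
    moreover have "0 \<le> t * sin t"
      using t assms by (intro mult_nonneg_nonneg sin_ge_zero) auto
    ultimately show "\<exists>y. ((\<lambda>x. sin x - x * cos x) has_real_derivative y) (at t) \<and> 0 \<le> y"
      by blast
  qed
  then show ?thesis by simp
qed

lemma arccos_power2_le:
  fixes c :: real
  assumes "0 < c" "c \<le> 1"
  shows "(arccos c)\<^sup>2 * c\<^sup>2 \<le> 1 - c\<^sup>2"
proof -
  have "arccos c * cos (arccos c) \<le> sin (arccos c)"
    using assms by (intro mult_cos_le_sin arccos_lbound arccos_ubound) auto
  then have "(arccos c * c)\<^sup>2 \<le> (sqrt (1 - c\<^sup>2))\<^sup>2"
    using assms arccos_lbound[of c] by (intro power_mono) (auto simp: sin_arccos_abs)
  then show ?thesis
    using assms by (simp add: power_mult_distrib power_le_one)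
qed

text \<open>Rotating every principal vector at constant speed into its partner moves \<open>U\<close> to \<open>U'\<close>
  along a geodesic of the Stiefel manifold whose speed is the norm of the vector of principal
  angles.\<close>

lemma stiefel_dist_le_principal_angles:
  assumes E: "orthonormal m m E" and u: "orthonormal n m u" and q: "orthonormal n m q"
    and cross: "\<And>k l. k < m \<Longrightarrow> l < m \<Longrightarrow> (\<Sum>i<n. u (i, k) * q (i, l)) = (if k = l then c k else 0)"
    and c: "\<And>k. k < m \<Longrightarrow> 0 < c k \<and> c k \<le> 1"
    and U: "U = cut_matrix n m (\<lambda>(i, a). \<Sum>k<m. u (i, k) * E (a, k))"
    and U': "U' = cut_matrix n m (\<lambda>(i, a). \<Sum>k<m. q (i, k) * E (a, k))"
  shows "riemannian_dist (matrix_indices n m) (stiefel n m) U U' \<le>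
    ennreal (sqrt (\<Sum>k<m. (arccos (c k))\<^sup>2))"
proof -
  define \<theta> where "\<theta> k = arccos (c k)" for k
  define z where "z = (\<lambda>(i, k). (q (i, k) - c k * u (i, k)) / sin (\<theta> k))"
  have cos_\<theta>: "cos (\<theta> k) = c k" if "k < m" for k
    using c[OF that] by (simp add: \<theta>_def cos_arccos_abs)
  have sin2: "(sin (\<theta> k))\<^sup>2 = 1 - (c k)\<^sup>2" if "k < m" for k
    using sin_squared_eq[of "\<theta> k"] cos_\<theta>[OF that] by simp
  have qu: "(\<Sum>i<n. (q (i, k) - c k * u (i, k)) * (q (i, l) - c l * u (i, l))) =
      (if k = l then 1 - (c k)\<^sup>2 else 0)" if "k < m" "l < m" for k l
  proof -
    have "(\<Sum>i<n. (q (i, k) - c k * u (i, k)) * (q (i, l) - c l * u (i, l))) =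
        (\<Sum>i<n. q (i, k) * q (i, l)) - c l * (\<Sum>i<n. u (i, l) * q (i, k))
        - c k * (\<Sum>i<n. u (i, k) * q (i, l)) + c k * c l * (\<Sum>i<n. u (i, k) * u (i, l))"
      by (simp add: algebra_simps sum.distrib sum_subtractf sum_distrib_left)
    then show ?thesis
      using orthonormalD[OF q that] orthonormalD[OF u that] cross[OF that] cross[OF that(2,1)]
      by (auto simp: power2_eq_square)
  qed
  have zz: "(\<Sum>i<n. z (i, k) * z (i, l)) = (if k = l \<and> sin (\<theta> k) \<noteq> 0 then 1 else 0)"
    if "k < m" "l < m" for k l
  proof -
    have "(\<Sum>i<n. z (i, k) * z (i, l)) = (if k = l then 1 - (c k)\<^sup>2 else 0) / (sin (\<theta> k) * sin (\<theta> l))"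
      unfolding qu[OF that, symmetric] by (simp add: z_def sum_divide_distrib)
    then show ?thesis
      using sin2[OF that(1)] by (auto simp: power2_eq_square)
  qed
  have uz: "(\<Sum>i<n. u (i, k) * z (i, l)) = 0" if "k < m" "l < m" for k l
  proof -
    have "(\<Sum>i<n. u (i, k) * z (i, l)) =
        ((\<Sum>i<n. u (i, k) * q (i, l)) - c l * (\<Sum>i<n. u (i, k) * u (i, l))) / sin (\<theta> l)"
      by (simp add: z_def sum_divide_distrib[symmetric] right_diff_distrib sum_subtractf
          sum_distrib_left mult_ac)
    then show ?thesis
      using cross[OF that] orthonormalD[OF u that] by auto
  qed
  \<comment> \<open>for angle zero both sides vanish: then \<open>z\<close> is zero by division by zero, and the partners coincide\<close>
  have sin_z: "sin (\<theta> k) * z (i, k) = q (i, k) - c k * u (i, k)" if "k < m" "i < n" for i k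
  proof (cases "sin (\<theta> k) = 0")
    case True
    have "(\<Sum>i<n. (q (i, k) - c k * u (i, k)) * (q (i, k) - c k * u (i, k))) = 0"
      using qu[OF that(1) that(1)] sin2[OF that(1)] True by simp
    then have "\<forall>i\<in>{..<n}. (q (i, k) - c k * u (i, k)) * (q (i, k) - c k * u (i, k)) = 0"
      by (subst (asm) sum_nonneg_eq_0_iff) auto
    then show ?thesis using True that(2) by simp
  qed (simp add: z_def)
  define g where "g t = (\<lambda>(i, k). cos (t * \<theta> k) * u (i, k) + sin (t * \<theta> k) * z (i, k))" for t
  define g' where "g' t = (\<lambda>(i, k). \<theta> k * (cos (t * \<theta> k) * z (i, k) - sin (t * \<theta> k) * u (i, k)))" for t
  define \<gamma> where "\<gamma> t = cut_matrix n m (\<lambda>(i, a). \<Sum>k<m. g t (i, k) * E (a, k))" for t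
  define \<gamma>' where "\<gamma>' t = (\<lambda>(i, a). \<Sum>k<m. g' t (i, k) * E (a, k))" for t
  have pair: "(\<Sum>i<n. (x * u (i, k) + y * z (i, k)) * (x' * u (i, l) + y' * z (i, l))) =
      x * x' * (if k = l then 1 else 0) + y * y' * (if k = l \<and> sin (\<theta> k) \<noteq> 0 then 1 else 0)"
    if "k < m" "l < m" for k l x y x' y'
  proof -
    have "(\<Sum>i<n. (x * u (i, k) + y * z (i, k)) * (x' * u (i, l) + y' * z (i, l))) =
        x * x' * (\<Sum>i<n. u (i, k) * u (i, l)) + x * y' * (\<Sum>i<n. u (i, k) * z (i, l))
        + y * x' * (\<Sum>i<n. u (i, l) * z (i, k)) + y * y' * (\<Sum>i<n. z (i, k) * z (i, l))"
      by (simp add: algebra_simps sum.distrib sum_distrib_left)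
    then show ?thesis
      using orthonormalD[OF u that] uz[OF that] uz[OF that(2,1)] zz[OF that] by simp
  qed
  have \<theta>_0: "\<theta> k = 0" if "k < m" "sin (\<theta> k) = 0" for k
  proof -
    have "(c k)\<^sup>2 = 1" using sin2[OF that(1)] that(2) by simp
    then have "c k = 1" using c[OF that(1)] by (simp add: power2_eq_1_iff)
    then show ?thesis by (simp add: \<theta>_def)
  qed
  have g_orth: "orthonormal n m (g t)" for t
    unfolding orthonormal_def
  proof (intro allI impI)
    fix k l assume kl: "k < m" "l < m"
    have "(\<Sum>i<n. g t (i, k) * g t (i, l)) = cos (t * \<theta> k) * cos (t * \<theta> l) * (if k = l then 1 else 0)
        + sin (t * \<theta> k) * sin (t * \<theta> l) * (if k = l \<and> sin (\<theta> k) \<noteq> 0 then 1 else 0)"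
      unfolding g_def prod.case by (rule pair[OF kl])
    also have "\<dots> = (if k = l then 1 else 0)"
      using \<theta>_0[OF kl(1)] by (auto simp: power2_eq_square[symmetric])
    finally show "(\<Sum>i<n. g t (i, k) * g t (i, l)) = (if k = l then 1 else 0)" .
  qed
  have rotate: "orthonormal n m (\<lambda>(i, a). \<Sum>k<m. h (i, k) * E (a, k))" if h: "orthonormal n m h" for h
    unfolding orthonormal_def
  proof (intro allI impI)
    fix a b assume "a < m" "b < m"
    then show "(\<Sum>i<n. (case (i, a) of (i, a) \<Rightarrow> \<Sum>k<m. h (i, k) * E (a, k)) *
        (case (i, b) of (i, a) \<Rightarrow> \<Sum>k<m. h (i, k) * E (a, k))) = (if a = b then 1 else 0)"
      using orthonormal_inner_comb[OF h, of "\<lambda>k. E (a, k)" "\<lambda>k. E (b, k)"]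
        orthonormal_complete[OF E, of a b]
      by (simp add: mult.commute)
  qed
  show ?thesis
  proof (rule riemannian_dist_le_curve[where \<gamma> = \<gamma> and \<gamma>' = \<gamma>'])
    fix e t assume "e \<in> matrix_indices n m"
    then obtain i a where e: "e = (i, a)" "i < n" "a < m" by (auto simp: matrix_indices_def)
    have "((\<lambda>s. \<Sum>k<m. g s (i, k) * E (a, k)) has_real_derivative \<gamma>' t e) (at t)"
      unfolding e g_def \<gamma>'_def g'_def prod.case
      by (auto intro!: derivative_eq_intros sum.cong simp: algebra_simps)
    then show "((\<lambda>s. \<gamma> s e) has_real_derivative \<gamma>' t e) (at t)"
      using e by (simp add: \<gamma>_def)
  next
    fix e show "continuous_on UNIV (\<lambda>t. \<gamma>' t e)"
      unfolding \<gamma>'_def g'_def by (cases e) (auto intro!: continuous_intros)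
  next
    fix t show "\<gamma> t \<in> stiefel n m"
      unfolding \<gamma>_def by (intro cut_matrix_stiefel rotate g_orth)
  next
    fix t
    have "(L2_set (\<gamma>' t) (matrix_indices n m))\<^sup>2 = (\<Sum>i<n. \<Sum>a<m. \<gamma>' t (i, a) * \<gamma>' t (i, a))"
      by (simp add: L2_set_power2 inner_on_def matrix_indices_def sum.cartesian_product)
    also have "\<dots> = (\<Sum>i<n. \<Sum>k<m. g' t (i, k) * g' t (i, k))"
      unfolding \<gamma>'_def prod.case by (intro sum.cong[OF refl] orthonormal_inner_comb[OF E])
    also have "\<dots> = (\<Sum>k<m. \<Sum>i<n. g' t (i, k) * g' t (i, k))"
      by (rule sum.swap)
    also have "\<dots> \<le> (\<Sum>k<m. (\<theta> k)\<^sup>2)"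
    proof (rule sum_mono)
      fix k assume "k \<in> {..<m}"
      then have k: "k < m" by simp
      have "(\<Sum>i<n. g' t (i, k) * g' t (i, k)) = (\<Sum>i<n.
          (- \<theta> k * sin (t * \<theta> k) * u (i, k) + \<theta> k * cos (t * \<theta> k) * z (i, k)) *
          (- \<theta> k * sin (t * \<theta> k) * u (i, k) + \<theta> k * cos (t * \<theta> k) * z (i, k)))"
        by (intro sum.cong refl) (simp add: g'_def algebra_simps)
      also have "\<dots> \<le> (\<theta> k)\<^sup>2 * (sin (t * \<theta> k))\<^sup>2 + (\<theta> k)\<^sup>2 * (cos (t * \<theta> k))\<^sup>2"
        unfolding pair[OF k k] using \<theta>_0[OF k]
        by (cases "sin (\<theta> k) = 0") (simp_all add: power2_eq_square algebra_simps)
      finally show "(\<Sum>i<n. g' t (i, k) * g' t (i, k)) \<le> (\<theta> k)\<^sup>2"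
        by (simp add: distrib_left[symmetric])
    qed
    finally show "L2_set (\<gamma>' t) (matrix_indices n m) \<le> sqrt (\<Sum>k<m. (arccos (c k))\<^sup>2)"
      unfolding \<theta>_def by (rule real_le_rsqrt)
  next
    show "U = \<gamma> 0" by (simp add: U \<gamma>_def g_def)
    have "g 1 (i, k) = q (i, k)" if "i < n" "k < m" for i k
      using sin_z[OF that(2,1)] that by (simp add: g_def cos_\<theta>)
    then show "U' = \<gamma> 1"
      unfolding U' \<gamma>_def by (auto simp: fun_eq_iff cut_matrix_def matrix_indices_def)
  qed
qed

text \<open>Write \<open>U = u E\<^sup>T\<close> with the principal vectors \<open>u\<close> of \<open>U\<close> and take \<open>U' = q E\<^sup>T\<close> with their
  partners \<open>q\<close> in the column space of \<open>V\<close>. Then \<open>U'\<^sup>T U\<close> is symmetric with the cosines of the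
  principal angles as eigenvalues, so it differs from the identity only to second order in the norm
  \<open>s\<close> of the sines.\<close>

theorem aligned_factor:
  assumes U: "U \<in> stiefel n m" and V: "orthonormal n m V"
    and s: "s\<^sup>2 = (\<Sum>i<n. \<Sum>a<m. (matrix_mult n (proj_off m V) U (i, a))\<^sup>2)" "0 \<le> s" "s < 1"
  shows "\<exists>U'. U' \<in> stiefel n m \<and>
    (\<forall>i<n. \<forall>j<n. (\<Sum>a<m. U' (i, a) * U' (j, a)) = (\<Sum>b<m. V (i, b) * V (j, b))) \<and>
    (\<Sum>a<m. \<Sum>b<m. ((\<Sum>i<n. U' (i, a) * U (i, b)) - (if a = b then 1 else 0))\<^sup>2) \<le> (s\<^sup>2)\<^sup>2 \<and>
    (\<Sum>i<n. \<Sum>a<m. (U' (i, a) - U (i, a))\<^sup>2) \<le> 2 * s\<^sup>2 \<and>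
    riemannian_dist (matrix_indices n m) (stiefel n m) U U' \<le> ennreal (s / sqrt (1 - s\<^sup>2))"
proof -
  have U_orth: "orthonormal n m U" using U by (simp add: stiefel_iff)
  have s2: "s\<^sup>2 < 1" using s(2,3) by (simp add: power_less_one_iff)
  obtain E u q c where E: "orthonormal m m E" and u: "orthonormal n m u" and q: "orthonormal n m q"
    and U_eq: "\<forall>i<n. \<forall>a<m. U (i, a) = (\<Sum>k<m. u (i, k) * E (a, k))"
    and cross: "\<forall>k<m. \<forall>l<m. (\<Sum>i<n. u (i, k) * q (i, l)) = (if k = l then c k else 0)"
    and c: "\<forall>k<m. 0 < c k \<and> c k \<le> 1" and c_sum: "(\<Sum>k<m. 1 - (c k)\<^sup>2) = s\<^sup>2"
    and span: "\<forall>i<n. \<forall>j<n. (\<Sum>k<m. q (i, k) * q (j, k)) = (\<Sum>b<m. V (i, b) * V (j, b))"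
    using principal_vectors[OF U_orth V] s2 unfolding s(1)[symmetric] by blast
  define U' where "U' = cut_matrix n m (\<lambda>(i, a). \<Sum>k<m. q (i, k) * E (a, k))"
  have U'_eq: "U' (i, a) = (\<Sum>k<m. q (i, k) * E (a, k))" if "i < n" "a < m" for i a
    using that by (simp add: U'_def)
  have U_cut: "U = cut_matrix n m (\<lambda>(i, a). \<Sum>k<m. u (i, k) * E (a, k))"
    using U U_eq by (auto simp: fun_eq_iff cut_matrix_def matrix_indices_def stiefel_iff)
  have c_le: "1 - c k \<le> 1 - (c k)\<^sup>2" if "k < m" for k
  proof -
    have "c k * c k \<le> c k * 1" using c that by (intro mult_left_mono) auto
    then show ?thesis by (simp add: power2_eq_square)
  qed
  have "U' \<in> stiefel n m"
    unfolding U'_def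
  proof (rule cut_matrix_stiefel, unfold orthonormal_def, intro allI impI)
    fix a b assume "a < m" "b < m"
    then show "(\<Sum>i<n. (case (i, a) of (i, a) \<Rightarrow> \<Sum>k<m. q (i, k) * E (a, k)) *
        (case (i, b) of (i, a) \<Rightarrow> \<Sum>k<m. q (i, k) * E (a, k))) = (if a = b then 1 else 0)"
      using orthonormal_inner_comb[OF q, of "\<lambda>k. E (a, k)" "\<lambda>k. E (b, k)"]
        orthonormal_complete[OF E, of a b]
      by (simp add: mult.commute)
  qed
  moreover have "(\<Sum>a<m. U' (i, a) * U' (j, a)) = (\<Sum>b<m. V (i, b) * V (j, b))"
    if "i < n" "j < n" for i j
    using that span
    by (simp add: U'_eq orthonormal_inner_comb[OF E, of "\<lambda>k. q (i, k)" "\<lambda>k. q (j, k)"])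
  moreover have "(\<Sum>a<m. \<Sum>b<m. ((\<Sum>i<n. U' (i, a) * U (i, b)) - (if a = b then 1 else 0))\<^sup>2) \<le> (s\<^sup>2)\<^sup>2"
  proof -
    have entry: "(\<Sum>i<n. U' (i, a) * U (i, b)) - (if a = b then 1 else 0) =
        (\<Sum>k<m. (c k - 1) * E (a, k) * E (b, k))" if ab: "a < m" "b < m" for a b
    proof -
      have "(\<Sum>i<n. U' (i, a) * U (i, b)) =
          (\<Sum>i<n. \<Sum>k<m. \<Sum>l<m. E (a, k) * E (b, l) * (u (i, l) * q (i, k)))"
        using ab U_eq by (intro sum.cong refl) (simp add: U'_eq sum_product mult_ac)
      also have "\<dots> = (\<Sum>k<m. \<Sum>i<n. \<Sum>l<m. E (a, k) * E (b, l) * (u (i, l) * q (i, k)))"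
        by (rule sum.swap)
      also have "\<dots> = (\<Sum>k<m. \<Sum>l<m. \<Sum>i<n. E (a, k) * E (b, l) * (u (i, l) * q (i, k)))"
        by (rule sum.cong[OF refl], rule sum.swap)
      also have "\<dots> = (\<Sum>k<m. \<Sum>l<m. (E (a, k) * E (b, l) * c l) * (if l = k then 1 else 0))"
        using cross by (intro sum.cong refl) (simp add: sum_distrib_left[symmetric])
      also have "\<dots> = (\<Sum>k<m. E (a, k) * E (b, k) * c k)"
        by (intro sum.cong refl) (simp add: sum_delta_mult_less)
      finally show ?thesis
        unfolding orthonormal_complete[OF E ab, symmetric]
        by (simp add: sum_subtractf[symmetric] algebra_simps)
    qed
    have "(\<Sum>a<m. \<Sum>b<m. ((\<Sum>i<n. U' (i, a) * U (i, b)) - (if a = b then 1 else 0))\<^sup>2) =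
        (\<Sum>a<m. \<Sum>b<m. (\<Sum>k<m. (c k - 1) * E (a, k) * E (b, k)) * (\<Sum>k<m. (c k - 1) * E (a, k) * E (b, k)))"
      by (intro sum.cong refl) (simp only: lessThan_iff entry power2_eq_square)
    also have "\<dots> = (\<Sum>a<m. \<Sum>k<m. ((c k - 1) * E (a, k)) * ((c k - 1) * E (a, k)))"
      by (intro sum.cong[OF refl] orthonormal_inner_comb[OF E])
    also have "\<dots> = (\<Sum>k<m. (c k - 1)\<^sup>2 * (\<Sum>a<m. E (a, k) * E (a, k)))"
      by (subst sum.swap) (simp add: sum_distrib_left power2_eq_square mult_ac)
    also have "\<dots> = (\<Sum>k<m. (1 - c k) * (1 - c k))"
      by (intro sum.cong refl) (simp add: orthonormalD[OF E] power2_eq_square algebra_simps)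
    also have "\<dots> \<le> (\<Sum>k<m. (1 - c k) * s\<^sup>2)"
    proof (intro sum_mono mult_left_mono)
      fix k assume "k \<in> {..<m}"
      then have "1 - (c k)\<^sup>2 \<le> (\<Sum>k<m. 1 - (c k)\<^sup>2)"
        using c by (intro member_le_sum) (auto simp: power_le_one less_imp_le)
      then show "1 - c k \<le> s\<^sup>2" using c_le[of k] \<open>k \<in> {..<m}\<close> c_sum by simp
    qed (use c in auto)
    also have "\<dots> \<le> (\<Sum>k<m. (1 - (c k)\<^sup>2) * s\<^sup>2)"
      by (intro sum_mono mult_right_mono c_le) auto
    also have "\<dots> = (s\<^sup>2)\<^sup>2"
      by (simp only: sum_distrib_right[symmetric] c_sum power2_eq_square[of "s\<^sup>2"])
    finally show ?thesis .
  qed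
  moreover have "(\<Sum>i<n. \<Sum>a<m. (U' (i, a) - U (i, a))\<^sup>2) \<le> 2 * s\<^sup>2"
  proof -
    have "(\<Sum>i<n. \<Sum>a<m. (U' (i, a) - U (i, a))\<^sup>2) =
        (\<Sum>i<n. \<Sum>a<m. (\<Sum>k<m. (q (i, k) - u (i, k)) * E (a, k)) * (\<Sum>k<m. (q (i, k) - u (i, k)) * E (a, k)))"
      using U_eq by (intro sum.cong refl)
        (simp add: U'_eq power2_eq_square left_diff_distrib sum_subtractf)
    also have "\<dots> = (\<Sum>i<n. \<Sum>k<m. (q (i, k) - u (i, k)) * (q (i, k) - u (i, k)))"
      by (intro sum.cong[OF refl] orthonormal_inner_comb[OF E])
    also have "\<dots> = (\<Sum>k<m. \<Sum>i<n. q (i, k) * q (i, k) + u (i, k) * u (i, k) - 2 * (u (i, k) * q (i, k)))"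
      by (subst sum.swap, intro sum.cong refl) (simp add: algebra_simps)
    also have "\<dots> = (\<Sum>k<m. 2 * (1 - c k))"
      using cross by (intro sum.cong refl)
        (simp add: sum.distrib sum_subtractf sum_distrib_left[symmetric] orthonormalD[OF q] orthonormalD[OF u])
    also have "\<dots> \<le> (\<Sum>k<m. 2 * (1 - (c k)\<^sup>2))"
      by (intro sum_mono mult_left_mono c_le) auto
    also have "\<dots> = 2 * s\<^sup>2" by (simp only: sum_distrib_left[symmetric] c_sum)
    finally show ?thesis .
  qed
  moreover have "riemannian_dist (matrix_indices n m) (stiefel n m) U U' \<le> ennreal (s / sqrt (1 - s\<^sup>2))"
  proof -
    have "riemannian_dist (matrix_indices n m) (stiefel n m) U U' \<le>
        ennreal (sqrt (\<Sum>k<m. (arccos (c k))\<^sup>2))"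
      using cross c by (intro stiefel_dist_le_principal_angles[OF E u q _ _ U_cut U'_def]) auto
    also have "sqrt (\<Sum>k<m. (arccos (c k))\<^sup>2) \<le> s / sqrt (1 - s\<^sup>2)"
    proof (rule real_le_lsqrt)
      have "(arccos (c k))\<^sup>2 * (1 - s\<^sup>2) \<le> 1 - (c k)\<^sup>2" if "k < m" for k
      proof -
        have "1 - (c k)\<^sup>2 \<le> (\<Sum>k<m. 1 - (c k)\<^sup>2)"
          using that c by (intro member_le_sum) (auto simp: power_le_one less_imp_le)
        then have "(arccos (c k))\<^sup>2 * (1 - s\<^sup>2) \<le> (arccos (c k))\<^sup>2 * (c k)\<^sup>2"
          by (intro mult_left_mono) (simp_all add: c_sum)
        also have "\<dots> \<le> 1 - (c k)\<^sup>2" using c that by (intro arccos_power2_le) auto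
        finally show ?thesis .
      qed
      then have "(\<Sum>k<m. (arccos (c k))\<^sup>2) * (1 - s\<^sup>2) \<le> s\<^sup>2"
        unfolding c_sum[symmetric] sum_distrib_right by (intro sum_mono) simp
      then show "(\<Sum>k<m. (arccos (c k))\<^sup>2) \<le> (s / sqrt (1 - s\<^sup>2))\<^sup>2"
        using s2 by (simp add: power_divide pos_le_divide_eq)
    qed (use s(2) s2 in auto)
    finally show ?thesis by (simp add: ennreal_leI)
  qed
  ultimately show ?thesis by blast
qed

section \<open>Decompositions of nearby tensors\<close>

lemma matrix_mult_assoc:
  "matrix_mult h A (matrix_mult h' B C) = matrix_mult h' (matrix_mult h A B) C"
proof
  fix e :: "nat \<times> nat"
  obtain i k where e: "e = (i, k)" by (cases e)
  have "(\<Sum>r<h. A (i, r) * (\<Sum>s<h'. B (r, s) * C (s, k))) =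
      (\<Sum>r<h. \<Sum>s<h'. A (i, r) * B (r, s) * C (s, k))"
    by (simp add: sum_distrib_left mult_ac)
  also have "\<dots> = (\<Sum>s<h'. \<Sum>r<h. A (i, r) * B (r, s) * C (s, k))"
    by (rule sum.swap)
  finally show "matrix_mult h A (matrix_mult h' B C) e = matrix_mult h' (matrix_mult h A B) C e"
    by (simp add: e matrix_mult_def sum_distrib_right)
qed

text \<open>Exchanging the orthonormal factor \<open>W p\<close> for \<open>U' p\<close> changes the recovered core only by the
  deviation of \<open>U'\<^sub>p\<^sup>T U\<^sub>p\<close> from the identity, applied in mode \<open>p\<close>.\<close>

lemma core_exchange_factor:
  assumes p: "p < D" and C: "C \<in> tensors D m"
    and U: "\<And>j. j < D \<Longrightarrow> orthonormal (n j) (m j) (U j)"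
    and W: "\<And>j. j < D \<Longrightarrow> orthonormal (n j) (m j) (W j)" "W p = U p"
    and b: "(\<Sum>a<m p. \<Sum>c<m p. ((\<Sum>i<n p. U' (i, a) * U p (i, c)) - (if a = c then 1 else 0))\<^sup>2) \<le> b\<^sup>2"
      "0 \<le> b"
  defines "X \<equiv> multilinear_product D n m U C"
  shows "L2_set (\<lambda>k. multilinear_product D m n (\<lambda>j. matrix_transpose ((W(p := U')) j)) X k -
      multilinear_product D m n (\<lambda>j. matrix_transpose (W j)) X k) (tensor_indices D m)
    \<le> b * L2_set C (tensor_indices D m)"
proof -
  define A where "A = (\<lambda>e. matrix_mult (n p) (matrix_transpose U') (U p) e - id_matrix e)"
  define G where "G j = matrix_mult (n j) (matrix_transpose (W j)) (U j)" for j
  define Z where "Z = multilinear_product D n m U (multilinear_product D m m (in_mode p A) C)"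
  have upd: "multilinear_product D m n (\<lambda>j. matrix_transpose ((W(p := V)) j)) X =
      multilinear_product D m m (G(p := matrix_mult (n p) (matrix_transpose V) (U p))) C" for V
    unfolding X_def multilinear_product_compose
    by (rule multilinear_product_cong) (auto simp: G_def)
  have Gp: "G p (a, c) = id_matrix (a, c)" if "a < m p" "c < m p" for a c
    unfolding G_def W(2) using matrix_mult_transpose_orthonormal[OF U[OF p] that] .
  have Z: "multilinear_product D m n (\<lambda>j. matrix_transpose (W j)) Z =
      multilinear_product D m m (G(p := \<lambda>e. 1 * matrix_mult (n p) (matrix_transpose U') (U p) e +
        (- 1) * id_matrix e)) C"
    unfolding Z_def multilinear_product_compose
  proof (rule multilinear_product_cong)
    fix j a c assume j: "j < D" "a < m j" "c < m j"
    have "matrix_mult (n j) (matrix_transpose (W j)) (matrix_mult (m j) (U j) (in_mode p A j)) (a, c) =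
        matrix_mult (m j) (G j) (in_mode p A j) (a, c)"
      unfolding matrix_mult_assoc G_def ..
    also have "\<dots> = (G(p := \<lambda>e. 1 * matrix_mult (n p) (matrix_transpose U') (U p) e +
        (- 1) * id_matrix e)) j (a, c)"
    proof (cases "j = p")
      case True
      have "matrix_mult (m p) (G p) A (a, c) = matrix_mult (m p) id_matrix A (a, c)"
        using j True by (auto simp: matrix_mult_def Gp intro!: sum.cong)
      then show ?thesis
        using j True by (simp add: in_mode_def matrix_mult_id_left A_def)
    qed (use j in \<open>simp add: in_mode_def matrix_mult_id_right\<close>)
    finally show "matrix_mult (n j) (matrix_transpose (W j)) (matrix_mult (m j) (U j) (in_mode p A j)) (a, c)
        = (G(p := \<lambda>e. 1 * matrix_mult (n p) (matrix_transpose U') (U p) e + (- 1) * id_matrix e)) j (a, c)" .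
  qed simp
  have X: "multilinear_product D m n (\<lambda>j. matrix_transpose (W j)) X =
      multilinear_product D m m (G(p := id_matrix)) C"
  proof -
    have "multilinear_product D m n (\<lambda>j. matrix_transpose (W j)) X =
        multilinear_product D m m (G(p := G p)) C"
      unfolding X_def multilinear_product_compose fun_upd_triv by (simp add: G_def[abs_def])
    also have "\<dots> = multilinear_product D m m (G(p := id_matrix)) C"
      by (rule multilinear_product_cong) (auto simp: Gp)
    finally show ?thesis .
  qed
  have "(\<lambda>k. multilinear_product D m n (\<lambda>j. matrix_transpose ((W(p := U')) j)) X k -
      multilinear_product D m n (\<lambda>j. matrix_transpose (W j)) X k) =
      multilinear_product D m n (\<lambda>j. matrix_transpose (W j)) Z"
    unfolding Z X upd
    by (intro ext, subst multilinear_product_linear_in_factor[OF p]) simp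
  then have "L2_set (\<lambda>k. multilinear_product D m n (\<lambda>j. matrix_transpose ((W(p := U')) j)) X k -
      multilinear_product D m n (\<lambda>j. matrix_transpose (W j)) X k) (tensor_indices D m) \<le>
      L2_set Z (tensor_indices D n)"
    using multilinear_product_transpose_contraction[of D n m W Z, OF W(1)] by simp
  also have "\<dots> = L2_set (multilinear_product D m m (in_mode p A) C) (tensor_indices D m)"
    unfolding Z_def by (rule multilinear_product_isometry[of D n m U, OF U])
  also have "\<dots> \<le> b * L2_set C (tensor_indices D m)"
  proof (rule power2_le_imp_le)
    have "(L2_set (multilinear_product D m m (in_mode p A) C) (tensor_indices D m))\<^sup>2 =
        (\<Sum>i<m p. slice_form D m p C (\<lambda>r. A (i, r)))"
      using multilinear_product_in_mode_norm[OF p, of m "m p" A C] by simp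
    also have "\<dots> \<le> (\<Sum>i<m p. (\<Sum>r<m p. (A (i, r))\<^sup>2) * (L2_set C (tensor_indices D m))\<^sup>2)"
      by (intro sum_mono slice_form_le p)
    also have "\<dots> = (\<Sum>a<m p. \<Sum>c<m p. ((\<Sum>i<n p. U' (i, a) * U p (i, c)) - (if a = c then 1 else 0))\<^sup>2)
        * (L2_set C (tensor_indices D m))\<^sup>2"
      by (simp add: sum_distrib_right A_def matrix_mult_def matrix_transpose_def id_matrix_def)
    also have "\<dots> \<le> (b * L2_set C (tensor_indices D m))\<^sup>2"
      unfolding power_mult_distrib using b(1) by (intro mult_right_mono) auto
    finally show "(L2_set (multilinear_product D m m (in_mode p A) C) (tensor_indices D m))\<^sup>2 \<le>
        (b * L2_set C (tensor_indices D m))\<^sup>2" .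
  qed (use b(2) in simp)
  finally show ?thesis .
qed

text \<open>Exchange the factors one after the other and add up the changes.\<close>

lemma core_exchange_all_factors:
  assumes C: "C \<in> tensors D m"
    and U: "\<And>j. j < D \<Longrightarrow> orthonormal (n j) (m j) (U j)"
    and U': "\<And>j. j < D \<Longrightarrow> orthonormal (n j) (m j) (U' j)"
    and b: "\<And>j. j < D \<Longrightarrow> (\<Sum>a<m j. \<Sum>c<m j. ((\<Sum>i<n j. U' j (i, a) * U j (i, c)) -
        (if a = c then 1 else 0))\<^sup>2) \<le> (b j)\<^sup>2" "\<And>j. 0 \<le> b j"
  defines "X \<equiv> multilinear_product D n m U C"
  shows "L2_set (\<lambda>k. multilinear_product D m n (\<lambda>j. matrix_transpose (U' j)) X k - C k)
      (tensor_indices D m) \<le> (\<Sum>j<D. b j) * L2_set C (tensor_indices D m)"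
proof -
  define W where "W p j = (if j < p then U' j else U j)" for p j
  define T where "T p = multilinear_product D m n (\<lambda>j. matrix_transpose (W p j)) X" for p
  have "L2_set (\<lambda>k. T p k - C k) (tensor_indices D m) \<le> (\<Sum>j<p. b j) * L2_set C (tensor_indices D m)"
    if "p \<le> D" for p
    using that
  proof (induction p)
    case 0
    have "T 0 = C"
      unfolding T_def X_def W_def using multilinear_product_transpose_cancel[of D n m U C, OF U C]
      by simp
    then show ?case by (simp add: L2_set_0')
  next
    case (Suc p)
    have step: "W (Suc p) = (W p)(p := U' p)" by (auto simp: W_def fun_eq_iff less_Suc_eq)
    have "L2_set (\<lambda>k. T (Suc p) k - T p k) (tensor_indices D m) \<le> b p * L2_set C (tensor_indices D m)"
      unfolding T_def X_def step
      by (rule core_exchange_factor) (use Suc.prems C U U' b in \<open>auto simp: W_def\<close>)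
    moreover have "L2_set (\<lambda>k. T (Suc p) k - C k) (tensor_indices D m) \<le>
        L2_set (\<lambda>k. T (Suc p) k - T p k) (tensor_indices D m) +
        L2_set (\<lambda>k. T p k - C k) (tensor_indices D m)"
      by (rule order_trans[OF _ L2_set_triangle_ineq]) simp
    ultimately show ?case using Suc by (simp add: distrib_right)
  qed
  moreover have "T D = multilinear_product D m n (\<lambda>j. matrix_transpose (U' j)) X"
    unfolding T_def by (rule multilinear_product_cong) (simp_all add: W_def matrix_transpose_def)
  ultimately show ?thesis by (metis order_refl)
qed

lemma divide_sqrt_one_minus_mono:
  fixes t r :: real
  assumes "0 \<le> t" "t \<le> r" "r < 1"
  shows "t / sqrt (1 - t\<^sup>2) \<le> r / sqrt (1 - r\<^sup>2)"
proof -
  have "t\<^sup>2 \<le> r\<^sup>2" "r\<^sup>2 < 1" using assms by (auto simp: power_mono power_less_one_iff)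
  then show ?thesis using assms by (intro frac_le) auto
qed

text \<open>The gap between the column spaces of the \<open>d\<close>th factors of \<open>x\<close> and \<open>X\<close> is at most
  \<open>\<parallel>x - X\<parallel> / s d\<close>: the projection off the column space for \<open>x\<close> kills \<open>x\<close>, so it maps \<open>X\<close> to
  a tensor of norm at most \<open>\<parallel>x - X\<parallel>\<close>, and the flattening of the core amplifies the gap by at least
  \<open>s d\<close>.\<close>

lemma aligned_decomposition:
  assumes C: "C \<in> tensors D m" and U: "\<And>j. j < D \<Longrightarrow> U j \<in> stiefel (n j) (m j)"
    and s: "\<And>d. d < D \<Longrightarrow> 0 < s d"
      "\<And>d x. d < D \<Longrightarrow> (s d)\<^sup>2 * (\<Sum>r<m d. (x r)\<^sup>2) \<le> slice_form D m d C x"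
    and x: "x \<in> tensors_of_rank D n m"
  defines "X \<equiv> multilinear_product D n m U C"
  defines "e \<equiv> L2_set (\<lambda>i. x i - X i) (tensor_indices D n)"
  assumes e: "\<And>d. d < D \<Longrightarrow> e < s d"
  shows "\<exists>C' U'. C' \<in> tensors D m \<and> x = multilinear_product D n m U' C' \<and>
    L2_set (\<lambda>k. C' k - C k) (tensor_indices D m) \<le>
      e + (\<Sum>j<D. (e / s j)\<^sup>2) * L2_set C (tensor_indices D m) \<and>
    (\<forall>j<D. U' j \<in> stiefel (n j) (m j) \<and>
      (\<Sum>i<n j. \<Sum>a<m j. (U' j (i, a) - U j (i, a))\<^sup>2) \<le> 2 * (e / s j)\<^sup>2 \<and>
      riemannian_dist (matrix_indices (n j) (m j)) (stiefel (n j) (m j)) (U j) (U' j) \<le>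
        ennreal (if m j = n j then 0 else (e / s j) / sqrt (1 - (e / s j)\<^sup>2)))"
proof -
  obtain C'' V where "tucker_decomposition D n m x C'' V"
    using x unfolding tensors_of_rank_def has_multilinear_rank_def by blast
  then have V: "\<And>j. j < D \<Longrightarrow> V j \<in> stiefel (n j) (m j)"
    and x_eq: "x = multilinear_product D n m V C''"
    by (auto simp: tucker_decomposition_def)
  have V_orth: "orthonormal (n j) (m j) (V j)" and U_orth: "orthonormal (n j) (m j) (U j)"
    if "j < D" for j using V[OF that] U[OF that] by (simp_all add: stiefel_iff)
  have e_nonneg: "0 \<le> e" by (simp add: e_def)
  define t where "t j = sqrt (\<Sum>i<n j. \<Sum>a<m j. (matrix_mult (n j) (proj_off (m j) (V j)) (U j) (i, a))\<^sup>2)"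
    for j
  have t2: "(t j)\<^sup>2 = (\<Sum>i<n j. \<Sum>a<m j. (matrix_mult (n j) (proj_off (m j) (V j)) (U j) (i, a))\<^sup>2)" for j
    by (simp add: t_def sum_nonneg)
  have t_nonneg: "0 \<le> t j" for j by (simp add: t_def sum_nonneg)
  have t_le: "t j \<le> e / s j" if j: "j < D" for j
  proof -
    let ?Q = "in_mode j (proj_off (m j) (V j))"
    have "(s j * t j)\<^sup>2 \<le> (L2_set (multilinear_product D n n ?Q X) (tensor_indices D n))\<^sup>2"
      unfolding power_mult_distrib t2 X_def
      by (rule proj_off_tucker_norm[OF j]) (use U_orth s(2)[OF j] in auto)
    also have "multilinear_product D n n ?Q X = multilinear_product D n n ?Q (\<lambda>i. X i - x i)"
    proof
      fix i
      have "multilinear_product D n n ?Q x = (\<lambda>_. 0)"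
        unfolding x_eq using j V_orth[OF j] by (rule proj_off_tucker)
      then show "multilinear_product D n n ?Q X i = multilinear_product D n n ?Q (\<lambda>i. X i - x i) i"
        by (simp add: multilinear_product_diff)
    qed
    also have "(L2_set (multilinear_product D n n ?Q (\<lambda>i. X i - x i)) (tensor_indices D n))\<^sup>2 \<le> e\<^sup>2"
      unfolding e_def L2_set_diff_commute[of x X]
      by (intro power_mono proj_off_contraction[of j D n "m j" "V j", OF j V_orth[OF j]]) simp
    finally have "s j * t j \<le> e"
      using e_nonneg by (rule power2_le_imp_le)
    then show ?thesis using s(1)[OF j] by (simp add: pos_le_divide_eq mult.commute)
  qed
  have e_s: "e / s j < 1" if "j < D" for j using e[OF that] s(1)[OF that] by simp
  \<comment> \<open>a square factor spans the whole space, so nothing is lost in this mode\<close>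
  have t_square: "t j = 0" if "j < D" "m j = n j" for j
  proof -
    have "matrix_mult (n j) (proj_off (m j) (V j)) (U j) (i, a) = 0" if "i < n j" for i a
      using orthonormal_complete_expansion[of "n j" "V j" i "\<lambda>l. U j (l, a)"] V_orth[OF \<open>j < D\<close>]
        \<open>m j = n j\<close> that
      by (simp add: matrix_mult_proj_off)
    then show ?thesis by (simp add: t_def)
  qed
  have "\<forall>j. \<exists>U'. j < D \<longrightarrow> U' \<in> stiefel (n j) (m j) \<and>
      (\<forall>i<n j. \<forall>l<n j. (\<Sum>a<m j. U' (i, a) * U' (l, a)) = (\<Sum>b<m j. V j (i, b) * V j (l, b))) \<and>
      (\<Sum>a<m j. \<Sum>b<m j. ((\<Sum>i<n j. U' (i, a) * U j (i, b)) - (if a = b then 1 else 0))\<^sup>2) \<le> ((t j)\<^sup>2)\<^sup>2 \<and>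
      (\<Sum>i<n j. \<Sum>a<m j. (U' (i, a) - U j (i, a))\<^sup>2) \<le> 2 * (t j)\<^sup>2 \<and>
      riemannian_dist (matrix_indices (n j) (m j)) (stiefel (n j) (m j)) (U j) U' \<le>
        ennreal (t j / sqrt (1 - (t j)\<^sup>2))"
    using aligned_factor[OF U V_orth t2 t_nonneg] t_le e_s by (meson le_less_trans)
  then obtain U' where U'0: "\<forall>j. j < D \<longrightarrow> U' j \<in> stiefel (n j) (m j) \<and>
      (\<forall>i<n j. \<forall>l<n j. (\<Sum>a<m j. U' j (i, a) * U' j (l, a)) = (\<Sum>b<m j. V j (i, b) * V j (l, b))) \<and>
      (\<Sum>a<m j. \<Sum>b<m j. ((\<Sum>i<n j. U' j (i, a) * U j (i, b)) - (if a = b then 1 else 0))\<^sup>2) \<le> ((t j)\<^sup>2)\<^sup>2 \<and>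
      (\<Sum>i<n j. \<Sum>a<m j. (U' j (i, a) - U j (i, a))\<^sup>2) \<le> 2 * (t j)\<^sup>2 \<and>
      riemannian_dist (matrix_indices (n j) (m j)) (stiefel (n j) (m j)) (U j) (U' j) \<le>
        ennreal (t j / sqrt (1 - (t j)\<^sup>2))"
    unfolding choice_iff by blast
  then have U': "\<And>j. j < D \<Longrightarrow> U' j \<in> stiefel (n j) (m j)"
    and span: "\<And>j i l. j < D \<Longrightarrow> i < n j \<Longrightarrow> l < n j \<Longrightarrow>
      (\<Sum>a<m j. U' j (i, a) * U' j (l, a)) = (\<Sum>b<m j. V j (i, b) * V j (l, b))"
    and gram: "\<And>j. j < D \<Longrightarrow> (\<Sum>a<m j. \<Sum>b<m j. ((\<Sum>i<n j. U' j (i, a) * U j (i, b)) -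
      (if a = b then 1 else 0))\<^sup>2) \<le> ((t j)\<^sup>2)\<^sup>2"
    and near: "\<And>j. j < D \<Longrightarrow> (\<Sum>i<n j. \<Sum>a<m j. (U' j (i, a) - U j (i, a))\<^sup>2) \<le> 2 * (t j)\<^sup>2"
    and dist: "\<And>j. j < D \<Longrightarrow>
      riemannian_dist (matrix_indices (n j) (m j)) (stiefel (n j) (m j)) (U j) (U' j) \<le>
        ennreal (t j / sqrt (1 - (t j)\<^sup>2))"
    by simp_all
  have U'_orth: "orthonormal (n j) (m j) (U' j)" if "j < D" for j
    using U'[OF that] by (simp add: stiefel_iff)
  have t2_le: "(t j)\<^sup>2 \<le> (e / s j)\<^sup>2" if "j < D" for j
    using t_le[OF that] t_nonneg by (intro power_mono) auto
  let ?U'T = "\<lambda>j. matrix_transpose (U' j)"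
  define C' where "C' = multilinear_product D m n ?U'T x"
  have "multilinear_product D n m U' C' = multilinear_product D n m V C''"
    unfolding C'_def x_eq multilinear_product_compose
  proof (rule multilinear_product_cong)
    fix j i a assume j: "j < D" "i < n j" "a < m j"
    have "matrix_mult (m j) (U' j) (matrix_mult (n j) (matrix_transpose (U' j)) (V j)) (i, a) =
        matrix_mult (n j) (proj_onto (m j) (U' j)) (V j) (i, a)"
      unfolding matrix_mult_assoc proj_onto_def ..
    also have "\<dots> = matrix_mult (n j) (proj_onto (m j) (V j)) (V j) (i, a)"
      using j span by (simp add: matrix_mult_def proj_onto_def matrix_transpose_def)
    also have "\<dots> = V j (i, a)"
      using j orthonormalD[OF V_orth[OF j(1)]]
      by (simp add: matrix_mult_proj_onto sum_delta_mult_less)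
    finally show "matrix_mult (m j) (U' j) (matrix_mult (n j) (matrix_transpose (U' j)) (V j)) (i, a)
        = V j (i, a)" .
  qed simp
  then have x_C': "x = multilinear_product D n m U' C'" using x_eq by simp
  have "L2_set (\<lambda>k. C' k - C k) (tensor_indices D m) \<le>
      L2_set (\<lambda>k. C' k - multilinear_product D m n ?U'T X k) (tensor_indices D m) +
      L2_set (\<lambda>k. multilinear_product D m n ?U'T X k - C k) (tensor_indices D m)"
    by (rule order_trans[OF _ L2_set_triangle_ineq]) simp
  also have "L2_set (\<lambda>k. C' k - multilinear_product D m n ?U'T X k) (tensor_indices D m) \<le> e"
  proof -
    have "(\<lambda>k. C' k - multilinear_product D m n ?U'T X k) =
        multilinear_product D m n ?U'T (\<lambda>i. x i - X i)"
      by (simp add: C'_def fun_eq_iff multilinear_product_diff)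
    then show ?thesis
      unfolding e_def using multilinear_product_transpose_contraction[of D n m U', OF U'_orth] by simp
  qed
  also have "L2_set (\<lambda>k. multilinear_product D m n ?U'T X k - C k) (tensor_indices D m) \<le>
      (\<Sum>j<D. (t j)\<^sup>2) * L2_set C (tensor_indices D m)"
    unfolding X_def by (rule core_exchange_all_factors[OF C U_orth U'_orth gram]) auto
  also have "\<dots> \<le> (\<Sum>j<D. (e / s j)\<^sup>2) * L2_set C (tensor_indices D m)"
    using t2_le by (intro mult_right_mono sum_mono) auto
  finally have core_near: "L2_set (\<lambda>k. C' k - C k) (tensor_indices D m) \<le>
      e + (\<Sum>j<D. (e / s j)\<^sup>2) * L2_set C (tensor_indices D m)" by simp
  have "(\<Sum>i<n j. \<Sum>a<m j. (U' j (i, a) - U j (i, a))\<^sup>2) \<le> 2 * (e / s j)\<^sup>2" if "j < D" for j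
    using near[OF that] t2_le[OF that] by linarith
  moreover have "riemannian_dist (matrix_indices (n j) (m j)) (stiefel (n j) (m j)) (U j) (U' j) \<le>
        ennreal (if m j = n j then 0 else (e / s j) / sqrt (1 - (e / s j)\<^sup>2))" if "j < D" for j
  proof (cases "m j = n j")
    case True
    then show ?thesis using dist[OF that] t_square[OF that] by simp
  next
    case False
    have "t j / sqrt (1 - (t j)\<^sup>2) \<le> (e / s j) / sqrt (1 - (e / s j)\<^sup>2)"
      using t_nonneg t_le[OF that] e_s[OF that] by (rule divide_sqrt_one_minus_mono)
    then show ?thesis using False dist[OF that] by (simp add: ennreal_leI order_trans)
  qed
  ultimately show ?thesis
    using x_C' core_near U' multilinear_product_in_tensors[of D m n ?U'T x, folded C'_def]
    by (intro exI[of _ C'] exI[of _ U']) blast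
qed

section \<open>Bounding condition numbers\<close>

lemma ennreal_ratio_le:
  assumes "a \<le> ennreal b" "ennreal e \<le> d" "0 \<le> b" "0 < e"
  shows "a / d \<le> ennreal (b / e)"
proof -
  have "a / d \<le> ennreal b / d" using assms(1) by (rule divide_right_mono_ennreal)
  also have "\<dots> \<le> ennreal (b / e)"
  proof (cases d)
    case (real r)
    then have "e \<le> r" using assms(2) by (simp add: ennreal_le_iff)
    then show ?thesis
      using real assms(3,4) by (simp add: divide_ennreal frac_le ennreal_leI)
  qed simp
  finally show ?thesis .
qed

lemma ennreal_ratio_ge:
  assumes "ennreal b \<le> a" "d \<le> ennreal e" "0 \<le> b" "0 < e"
  shows "ennreal (b / e) \<le> a / d"
proof -
  have "ennreal (b / e) \<le> ennreal b / d"
  proof (cases d)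
    case (real r)
    then have "r \<le> e" using assms(2,4) by (simp add: ennreal_le_iff)
    show ?thesis
    proof (cases "r = 0 \<or> b = 0")
      case True
      then show ?thesis
        using real assms(3) by (cases "b = 0") (auto simp: ennreal_divide_zero)
    next
      case False
      then show ?thesis
        using real assms(3) \<open>r \<le> e\<close> by (simp add: divide_ennreal frac_le ennreal_leI)
    qed
  qed (use assms(2) in \<open>simp add: top_unique\<close>)
  also have "\<dots> \<le> a / d" using assms(1) by (rule divide_right_mono_ennreal)
  finally show ?thesis .
qed

lemma condition_number_on_le:
  assumes "\<forall>\<^sub>F x in at x0 within XX. \<exists>y z. y \<in> YY \<and> z \<in> W \<and> F x y z = c \<and> dY y0 y / dX x0 x \<le> g x"
    and "(g \<longlongrightarrow> \<kappa>) (at x0 within XX)"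
  shows "condition_number_on XX dX YY dY W F c x0 y0 \<le> \<kappa>"
proof (cases "at x0 within XX = bot")
  case False
  have "condition_number_on XX dX YY dY W F c x0 y0 \<le> Limsup (at x0 within XX) g"
    unfolding condition_number_on_def
  proof (rule Limsup_mono, rule eventually_mono[OF assms(1)])
    fix x assume "\<exists>y z. y \<in> YY \<and> z \<in> W \<and> F x y z = c \<and> dY y0 y / dX x0 x \<le> g x"
    then obtain y z where "y \<in> YY" "z \<in> W" "F x y z = c" "dY y0 y / dX x0 x \<le> g x" by blast
    then show "(INF (y, z)\<in>{(y, z). y \<in> YY \<and> z \<in> W \<and> F x y z = c}. dY y0 y / dX x0 x) \<le> g x"
      by (intro INF_lower2[of "(y, z)"]) auto
  qed
  also have "\<dots> = \<kappa>" using False assms(2) by (intro lim_imp_Limsup) auto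
  finally show ?thesis .
qed (simp add: condition_number_on_def bot_ennreal)

text \<open>A lower bound for all solutions along a single path of inputs suffices.\<close>

lemma condition_number_on_ge:
  fixes P :: "real \<Rightarrow> 'x::topological_space"
  assumes P: "filterlim P (at x0 within XX) (at_right 0)"
    and "\<forall>\<^sub>F t in at_right 0. \<forall>y\<in>YY. \<forall>z\<in>W. F (P t) y z = c \<longrightarrow> g t \<le> dY y0 y / dX x0 (P t)"
    and "(g \<longlongrightarrow> \<kappa>) (at_right 0)"
  shows "\<kappa> \<le> condition_number_on XX dX YY dY W F c x0 y0"
proof -
  let ?f = "\<lambda>x. INF (y, z)\<in>{(y, z). y \<in> YY \<and> z \<in> W \<and> F x y z = c}. dY y0 y / dX x0 x"
  have "\<kappa> = Limsup (at_right 0) g"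
    using assms(3) by (intro lim_imp_Limsup[symmetric]) auto
  also have "\<dots> \<le> Limsup (at_right 0) (\<lambda>t. ?f (P t))"
    by (rule Limsup_mono, rule eventually_mono[OF assms(2)]) (auto intro!: INF_greatest)
  also have "\<dots> \<le> Limsup (filtermap P (at_right 0)) ?f"
    by (rule Limsup_filtermap_ge)
  also have "\<dots> \<le> Limsup (at x0 within XX) ?f"
    using P unfolding filterlim_def Limsup_def by (intro INF_superset_mono) (auto simp: le_filter_def)
  finally show ?thesis by (simp add: condition_number_on_def)
qed

text \<open>If the value is the same for all neighbourhoods, the whole latent space can serve as the
  sufficiently small one.\<close>

lemma has_condition_numberI:
  assumes "z0 \<in> ZZ"
    and "\<And>W. neighbourhood_within ZZ z0 W \<Longrightarrow> condition_number_on XX dX YY dY W F c x0 y0 = \<kappa>"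
  shows "has_condition_number XX dX YY dY ZZ F c x0 y0 z0 \<kappa>"
  unfolding has_condition_number_def
proof (intro exI conjI allI impI)
  show "neighbourhood_within ZZ z0 ZZ"
    unfolding neighbourhood_within_def using assms(1) by (auto intro: exI[of _ ZZ])
qed (use assms(2) in blast)

lemma neighbourhood_within_eventually:
  assumes "neighbourhood_within ZZ z0 W" and lim: "(z \<longlongrightarrow> z0) F" and "\<forall>\<^sub>F x in F. z x \<in> ZZ"
  shows "\<forall>\<^sub>F x in F. z x \<in> W"
proof -
  obtain O' where O': "open O'" "z0 \<in> O'" "ZZ \<inter> O' \<subseteq> W"
    using assms(1) unfolding neighbourhood_within_def openin_open by blast
  have "\<forall>\<^sub>F x in F. z x \<in> O'" using lim O'(1,2) by (rule topological_tendstoD)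
  with assms(3) show ?thesis
    by eventually_elim (use O'(3) in blast)
qed

lemma tendsto_fun_iff:
  fixes f :: "'a \<Rightarrow> 'i \<Rightarrow> 'b::topological_space"
  shows "(f \<longlongrightarrow> l) F \<longleftrightarrow> (\<forall>i. ((\<lambda>x. f x i) \<longlongrightarrow> l i) F)"
  using limitin_componentwise[of "\<lambda>_. euclidean" UNIV f l F]
  by (simp add: euclidean_product_topology)

section \<open>The condition numbers of the Tucker decomposition\<close>

lemma slice_form_scale_core: "slice_form D m d (\<lambda>k. t * C k) x = t\<^sup>2 * slice_form D m d C x"
proof -
  have "(\<Sum>r<m d. x r * (t * C (k(d := r)))) = t * (\<Sum>r<m d. x r * C (k(d := r)))" for k
    by (simp add: sum_distrib_left mult_ac)
  then show ?thesis
    by (simp only: slice_form_def power_mult_distrib sum_distrib_left[of "t\<^sup>2"])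
qed

lemma nondegenerate_scale:
  assumes "nondegenerate D m C" "0 < t"
  shows "nondegenerate D m (\<lambda>k. t * C k)"
  unfolding nondegenerate_def
proof (intro allI impI)
  fix d assume "d < D"
  then obtain s where s: "0 < s" "\<And>x. s\<^sup>2 * (\<Sum>r<m d. (x r)\<^sup>2) \<le> slice_form D m d C x"
    using assms(1) unfolding nondegenerate_def by blast
  have "(t * s)\<^sup>2 * (\<Sum>r<m d. (x r)\<^sup>2) \<le> slice_form D m d (\<lambda>k. t * C k) x" for x
    unfolding slice_form_scale_core power_mult_distrib mult.assoc
    by (intro mult_left_mono s(2)) simp
  then show "\<exists>s>0. \<forall>x. s\<^sup>2 * (\<Sum>r<m d. (x r)\<^sup>2) \<le> slice_form D m d (\<lambda>k. t * C k) x"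
    using s(1) assms(2) by (intro exI[of _ "t * s"]) simp
qed

lemma L2_set_scale: "0 \<le> t \<Longrightarrow> L2_set (\<lambda>i. t * f i) I = t * L2_set f I"
  by (rule L2_set_right_distrib[symmetric])

lemma sin_over_id_tendsto: "((\<lambda>t::real. sin t / t) \<longlongrightarrow> 1) (at_right 0)"
proof -
  have "((\<lambda>t::real. (sin t - sin 0) / (t - 0)) \<longlongrightarrow> cos 0) (at 0)"
    using DERIV_sin[of "0::real"] unfolding has_field_derivative_iff .
  then have "((\<lambda>t::real. sin t / t) \<longlongrightarrow> 1) (at 0)" by simp
  then show ?thesis by (rule tendsto_within_subset) simp
qed

lemma sum_matrix_indices:
  "(\<Sum>e\<in>matrix_indices n m. f e) = (\<Sum>i<n. \<Sum>a<m. f (i, a))"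
  by (simp add: matrix_indices_def sum.cartesian_product)

lemma id_tendsto_at_right_0: "((\<lambda>t::real. t) \<longlongrightarrow> 0) (at_right 0)"
  by (rule tendsto_ident_at)

lemma eventually_at_right_0_pos: "\<forall>\<^sub>F t::real in at_right 0. 0 < t \<and> t < 1"
  unfolding eventually_at_right_field by (intro exI[of _ 1]) auto

lemma F_T_eq_0_iff: "F_T D n m x C' V = (\<lambda>_. 0) \<longleftrightarrow> x = multilinear_product D n m V C'"
  by (auto simp: F_T_def G_T_def fun_eq_iff)

lemma L2_set_tensor_eq_0:
  assumes "x \<in> tensors D n" "y \<in> tensors D n" "L2_set (\<lambda>i. x i - y i) (tensor_indices D n) = 0"
  shows "x = y"
proof
  fix i show "x i = y i"
    using assms by (cases "i \<in> tensor_indices D n") (auto simp: tensors_def L2_set_eq_0_iff)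
qed

lemma L2_set_tendsto_0:
  assumes "\<And>i. i \<in> I \<Longrightarrow> ((\<lambda>x. f x i) \<longlongrightarrow> 0) F"
  shows "((\<lambda>x. L2_set (f x) I) \<longlongrightarrow> 0) F"
proof -
  have "((\<lambda>x. L2_set (f x) I) \<longlongrightarrow> sqrt (\<Sum>i\<in>I. 0\<^sup>2)) F"
    unfolding L2_set_def by (intro tendsto_intros assms)
  then show ?thesis by simp
qed

text \<open>The fixed data: a tensor \<open>X\<close> with a given Tucker decomposition, the manifold \<open>XX\<close> of tensors of
  its rank, and the distance \<open>gap x\<close> of \<open>x\<close> from \<open>X\<close> in the ambient space. All tensors within \<open>\<rho>\<close> of
  the core are again cores of full rank.\<close>

locale tucker_problem =
  fixes D :: nat and n m :: "nat \<Rightarrow> nat" and C :: tensor and U :: "nat \<Rightarrow> matrix"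
  assumes D: "1 \<le> D" and m: "\<And>j. j < D \<Longrightarrow> 1 \<le> m j"
    and core: "C \<in> core_tensors D m" and U: "\<And>j. j < D \<Longrightarrow> U j \<in> stiefel (n j) (m j)"
begin

definition "\<sigma> d = sigma_min (flattening D m d C)"
definition "X = multilinear_product D n m U C"
definition "XX = tensors_of_rank D n m"
definition "gap x = L2_set (\<lambda>i. x i - X i) (tensor_indices D n)"

lemma C_tensor: "C \<in> tensors D m"
  using core by (simp add: tensors_of_rank_def)

lemma U_orth: "j < D \<Longrightarrow> orthonormal (n j) (m j) (U j)"
  using U by (simp add: stiefel_iff)

lemma \<sigma>_pos: "d < D \<Longrightarrow> 0 < \<sigma> d"
  unfolding \<sigma>_def using core_sigma_min_pos[OF core] m by blast

lemma \<sigma>_le: "d < D \<Longrightarrow> (\<sigma> d)\<^sup>2 * (\<Sum>r<m d. (x r)\<^sup>2) \<le> slice_form D m d C x"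
  unfolding \<sigma>_def using sigma_min_flattening(2)[of d D m] m by blast

definition "\<rho> = Min (\<sigma> ` {..<D})"

lemma \<rho>: "0 < \<rho>" "d < D \<Longrightarrow> \<rho> \<le> \<sigma> d"
proof -
  have "\<rho> \<in> \<sigma> ` {..<D}" unfolding \<rho>_def using D by (intro Min_in) (auto simp: lessThan_empty_iff)
  then show "0 < \<rho>" using \<sigma>_pos by auto
  show "d < D \<Longrightarrow> \<rho> \<le> \<sigma> d" unfolding \<rho>_def by (intro Min_le) auto
qed

lemma core_near:
  assumes "C' \<in> tensors D m" "L2_set (\<lambda>k. C' k - C k) (tensor_indices D m) < \<rho>"
  shows "C' \<in> core_tensors D m"
proof (rule core_perturbation[OF assms(1) \<rho>(1)])
  fix d x assume d: "d < D"
  have "\<rho>\<^sup>2 * (\<Sum>r<m d. (x r)\<^sup>2) \<le> (\<sigma> d)\<^sup>2 * (\<Sum>r<m d. (x r)\<^sup>2)"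
    using \<rho>(1) \<rho>(2)[OF d] by (intro mult_right_mono power_mono) (auto simp: sum_nonneg)
  then show "\<rho>\<^sup>2 * (\<Sum>r<m d. (x r)\<^sup>2) \<le> slice_form D m d C x"
    using \<sigma>_le[OF d, of x] by linarith
qed (use assms(2) L2_set_diff_commute[of C C' "tensor_indices D m"] in simp)

lemma X_in_XX: "X \<in> XX"
  unfolding X_def XX_def using core C_tensor m U by (intro nondegenerate_imp_rank core_nondegenerate)

lemma gap_pos:
  assumes "x \<in> XX" "x \<noteq> X"
  shows "0 < gap x"
proof -
  have "x \<in> tensors D n" "X \<in> tensors D n"
    using assms(1) X_in_XX by (simp_all add: XX_def tensors_of_rank_def)
  then have "gap x \<noteq> 0"
    using L2_set_tensor_eq_0[of x D n X] assms(2) unfolding gap_def by blast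
  moreover have "0 \<le> gap x" by (simp add: gap_def)
  ultimately show ?thesis by linarith
qed

lemma gap_le_dist: "ennreal (gap x) \<le> riemannian_dist (tensor_indices D n) XX X x"
  unfolding gap_def by (rule chord_le_riemannian_dist) simp

lemma gap_tendsto: "(gap \<longlongrightarrow> 0) (at X within XX)"
  unfolding gap_def[abs_def]
proof (rule L2_set_tendsto_0)
  fix i
  have "((\<lambda>x. x i) \<longlongrightarrow> X i) (at X within XX)"
    using tendsto_ident_at[of X XX] unfolding tendsto_fun_iff by blast
  then show "((\<lambda>x. x i - X i) \<longlongrightarrow> 0) (at X within XX)"
    using tendsto_diff[of "\<lambda>x. x i" "X i" _ "\<lambda>_. X i" "X i"] by simp
qed

text \<open>The first-order term comes from the contraction applied to \<open>x - X\<close>, the second-order term from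
  replacing the factors by the aligned ones.\<close>

definition "core_bound e = e + (\<Sum>j<D. (e / \<sigma> j)\<^sup>2) * L2_set C (tensor_indices D m)"

lemma core_bound_tendsto: "((\<lambda>x. core_bound (gap x)) \<longlongrightarrow> 0) (at X within XX)"
proof -
  have "((\<lambda>x. core_bound (gap x)) \<longlongrightarrow>
      0 + (\<Sum>j<D. (0 / \<sigma> j)\<^sup>2) * L2_set C (tensor_indices D m)) (at X within XX)"
    unfolding core_bound_def by (intro tendsto_intros gap_tendsto) (auto dest: \<sigma>_pos)
  then show ?thesis by simp
qed

definition aligned :: "tensor \<Rightarrow> tensor \<Rightarrow> (nat \<Rightarrow> matrix) \<Rightarrow> bool" where
  "aligned x C' U' \<longleftrightarrow> C' \<in> core_tensors D m \<and> x = multilinear_product D n m U' C' \<and>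
    L2_set (\<lambda>k. C' k - C k) (tensor_indices D m) \<le> core_bound (gap x) \<and>
    L2_set (\<lambda>k. C' k - C k) (tensor_indices D m) < \<rho> \<and>
    (\<forall>j<D. U' j \<in> stiefel (n j) (m j) \<and>
      riemannian_dist (matrix_indices (n j) (m j)) (stiefel (n j) (m j)) (U j) (U' j) \<le>
        ennreal (if m j = n j then 0 else (gap x / \<sigma> j) / sqrt (1 - (gap x / \<sigma> j)\<^sup>2)))"

text \<open>A choice of a decomposition of every nearby tensor that is aligned with the given one. It is
  continuous at \<open>X\<close> and first-order optimal for all factors and the core at once.\<close>

lemma aligned_selection:
  "\<exists>C' U'. (\<forall>\<^sub>F x in at X within XX. aligned x (C' x) (U' x)) \<and>
    (C' \<longlongrightarrow> C) (at X within XX) \<and>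
    (\<forall>j<D. ((\<lambda>x. U' x j) \<longlongrightarrow> U j) (at X within XX))"
proof -
  define good where "good x C' U' \<longleftrightarrow> C' \<in> tensors D m \<and> x = multilinear_product D n m U' C' \<and>
    L2_set (\<lambda>k. C' k - C k) (tensor_indices D m) \<le> core_bound (gap x) \<and>
    (\<forall>j<D. U' j \<in> stiefel (n j) (m j) \<and>
      (\<Sum>i<n j. \<Sum>a<m j. (U' j (i, a) - U j (i, a))\<^sup>2) \<le> 2 * (gap x / \<sigma> j)\<^sup>2 \<and>
      riemannian_dist (matrix_indices (n j) (m j)) (stiefel (n j) (m j)) (U j) (U' j) \<le>
        ennreal (if m j = n j then 0 else (gap x / \<sigma> j) / sqrt (1 - (gap x / \<sigma> j)\<^sup>2)))"
    for x C' and U' :: "nat \<Rightarrow> matrix"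
  have "\<exists>C' U'. good x C' U'" if "x \<in> XX" "gap x < \<rho>" for x
    unfolding good_def core_bound_def gap_def X_def
  proof (rule aligned_decomposition[OF C_tensor U \<sigma>_pos \<sigma>_le])
    show "x \<in> tensors_of_rank D n m" using that(1) by (simp add: XX_def)
    fix d assume "d < D"
    then show "L2_set (\<lambda>i. x i - multilinear_product D n m U C i) (tensor_indices D n) < \<sigma> d"
      using that(2) \<rho>(2)[of d] by (simp add: gap_def X_def)
  qed
  then have "\<forall>x. \<exists>C' U'. x \<in> XX \<and> gap x < \<rho> \<longrightarrow> good x C' U'" by blast
  then obtain C' U' where CU: "\<forall>x. x \<in> XX \<and> gap x < \<rho> \<longrightarrow> good x (C' x) (U' x)"
    unfolding choice_iff by blast
  have "\<forall>\<^sub>F x in at X within XX. gap x < \<rho>"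
    using gap_tendsto \<rho>(1) by (rule order_tendstoD(2))
  moreover have "\<forall>\<^sub>F x in at X within XX. x \<in> XX"
    by (auto simp: eventually_at_topological intro: exI[of _ UNIV])
  ultimately have good: "\<forall>\<^sub>F x in at X within XX. good x (C' x) (U' x)"
    by eventually_elim (use CU in blast)
  have "\<forall>\<^sub>F x in at X within XX. core_bound (gap x) < \<rho>"
    using core_bound_tendsto \<rho>(1) by (rule order_tendstoD(2))
  with good have "\<forall>\<^sub>F x in at X within XX. aligned x (C' x) (U' x)"
  proof eventually_elim
    case (elim x)
    then have near: "L2_set (\<lambda>k. C' x k - C k) (tensor_indices D m) < \<rho>"
      unfolding good_def by linarith
    moreover have "C' x \<in> tensors D m" using elim unfolding good_def by blast
    ultimately have "C' x \<in> core_tensors D m" by (intro core_near)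
    with near elim show ?case unfolding good_def aligned_def by blast
  qed
  moreover have "(C' \<longlongrightarrow> C) (at X within XX)"
    unfolding tendsto_fun_iff
  proof
    fix k
    have "\<forall>\<^sub>F x in at X within XX. norm (C' x k - C k) \<le> core_bound (gap x)"
      using good
    proof eventually_elim
      case (elim x)
      show ?case
      proof (cases "k \<in> tensor_indices D m")
        case True
        then have "\<bar>C' x k - C k\<bar> \<le> L2_set (\<lambda>k. C' x k - C k) (tensor_indices D m)"
          by (rule abs_le_L2_set[OF finite_tensor_indices])
        then show ?thesis using elim by (simp add: good_def)
      next
        case False
        then have "C' x k - C k = 0"
          using elim C_tensor by (simp add: good_def tensors_def)
        then show ?thesis
          using elim L2_set_nonneg[of "\<lambda>k. C' x k - C k" "tensor_indices D m"]
          unfolding good_def by (simp del: L2_set_nonneg)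
      qed
    qed
    then have "((\<lambda>x. C' x k - C k) \<longlongrightarrow> 0) (at X within XX)"
      using core_bound_tendsto by (rule Lim_null_comparison)
    then show "((\<lambda>x. C' x k) \<longlongrightarrow> C k) (at X within XX)" by (simp add: LIM_zero_iff)
  qed
  moreover have "((\<lambda>x. U' x j) \<longlongrightarrow> U j) (at X within XX)" if j: "j < D" for j
    unfolding tendsto_fun_iff
  proof
    fix e
    have "\<forall>\<^sub>F x in at X within XX. norm (U' x j e - U j e) \<le> sqrt (2 * (gap x / \<sigma> j)\<^sup>2)"
      using good
    proof eventually_elim
      case (elim x)
      show ?case
      proof (cases "e \<in> matrix_indices (n j) (m j)")
        case True
        have "finite (matrix_indices (n j) (m j))" by (simp add: matrix_indices_def)
        then have "\<bar>U' x j e - U j e\<bar> \<le> L2_set (\<lambda>e. U' x j e - U j e) (matrix_indices (n j) (m j))"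
          using True by (rule abs_le_L2_set)
        also have "\<dots> = sqrt (\<Sum>i<n j. \<Sum>a<m j. (U' x j (i, a) - U j (i, a))\<^sup>2)"
          by (simp add: L2_set_def matrix_indices_def sum.cartesian_product)
        also have "\<dots> \<le> sqrt (2 * (gap x / \<sigma> j)\<^sup>2)"
          using elim j by (simp add: good_def)
        finally show ?thesis by simp
      next
        case False
        then have "U' x j e - U j e = 0"
          using elim j U[OF j] by (cases e) (simp add: good_def stiefel_iff)
        then show ?thesis by simp
      qed
    qed
    moreover have "((\<lambda>x. sqrt (2 * (gap x / \<sigma> j)\<^sup>2)) \<longlongrightarrow> sqrt (2 * (0 / \<sigma> j)\<^sup>2)) (at X within XX)"
      using \<sigma>_pos[OF j] by (intro tendsto_intros gap_tendsto) auto
    then have "((\<lambda>x. sqrt (2 * (gap x / \<sigma> j)\<^sup>2)) \<longlongrightarrow> 0) (at X within XX)" by simp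
    ultimately have "((\<lambda>x. U' x j e - U j e) \<longlongrightarrow> 0) (at X within XX)"
      by (rule Lim_null_comparison)
    then show "((\<lambda>x. U' x j e) \<longlongrightarrow> U j e) (at X within XX)" by (simp add: LIM_zero_iff)
  qed
  ultimately show ?thesis by blast
qed

lemma restrict_tendsto:
  assumes "\<And>j. j \<in> J \<Longrightarrow> ((\<lambda>x. U' x j) \<longlongrightarrow> U j) F"
  shows "((\<lambda>x. restrict (U' x) J) \<longlongrightarrow> restrict U J) F"
  unfolding tendsto_fun_iff[where f = "\<lambda>x. restrict (U' x) J"] using assms by (auto simp: restrict_def)

lemma core_segment:
  assumes "C' \<in> tensors D m" "L2_set (\<lambda>k. C' k - C k) (tensor_indices D m) < \<rho>"
  shows "riemannian_dist (tensor_indices D m) (core_tensors D m) C C' \<le>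
    ennreal (L2_set (\<lambda>k. C' k - C k) (tensor_indices D m))"
proof (rule riemannian_dist_le_segment)
  fix t :: real assume t: "0 \<le> t" "t \<le> 1"
  have "L2_set (\<lambda>k. C k + t * (C' k - C k) - C k) (tensor_indices D m) =
      t * L2_set (\<lambda>k. C' k - C k) (tensor_indices D m)"
    using t(1) L2_set_right_distrib[of t "\<lambda>k. C' k - C k" "tensor_indices D m"] by simp
  also have "\<dots> \<le> L2_set (\<lambda>k. C' k - C k) (tensor_indices D m)"
    using t by (simp add: mult_left_le_one_le)
  finally show "(\<lambda>k. C k + t * (C' k - C k)) \<in> core_tensors D m"
    using assms C_tensor by (intro core_near) (auto simp: tensors_def)
qed

text \<open>The segment from \<open>C\<close> to the core of the aligned decomposition consists of cores of full rank, so
  its length bounds the distance.\<close>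

theorem core_condition_le:
  assumes W: "neighbourhood_within (\<Pi>\<^sub>E j\<in>{..<D}. stiefel (n j) (m j)) (restrict U {..<D}) W"
  shows "condition_number_on XX (riemannian_dist (tensor_indices D n) XX) (core_tensors D m)
    (riemannian_dist (tensor_indices D m) (core_tensors D m)) W (\<lambda>X' C' V. F_T D n m X' C' V) (\<lambda>_. 0)
    X C \<le> 1"
proof -
  obtain C' U' where CU: "\<forall>\<^sub>F x in at X within XX. aligned x (C' x) (U' x)"
    and U'_lim: "\<forall>j<D. ((\<lambda>x. U' x j) \<longlongrightarrow> U j) (at X within XX)"
    using aligned_selection by blast
  let ?V = "\<lambda>x. restrict (U' x) {..<D}"
  let ?K = "(\<Sum>j<D. (1 / \<sigma> j)\<^sup>2) * L2_set C (tensor_indices D m)"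
  have "(?V \<longlongrightarrow> restrict U {..<D}) (at X within XX)"
    by (rule restrict_tendsto) (simp add: U'_lim)
  moreover have "\<forall>\<^sub>F x in at X within XX. ?V x \<in> (\<Pi>\<^sub>E j\<in>{..<D}. stiefel (n j) (m j))"
    using CU by eventually_elim (auto simp: PiE_iff aligned_def)
  ultimately have V_W: "\<forall>\<^sub>F x in at X within XX. ?V x \<in> W"
    by (rule neighbourhood_within_eventually[OF W])
  have inside: "\<forall>\<^sub>F x in at X within XX. x \<in> XX \<and> x \<noteq> X"
    by (auto simp: eventually_at_topological intro: exI[of _ UNIV])
  show ?thesis
  proof (rule condition_number_on_le[where g = "\<lambda>x. ennreal (1 + ?K * gap x)"])
    show "\<forall>\<^sub>F x in at X within XX. \<exists>y z. y \<in> core_tensors D m \<and> z \<in> W \<and> F_T D n m x y z = (\<lambda>_. 0) \<and>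
        riemannian_dist (tensor_indices D m) (core_tensors D m) C y /
        riemannian_dist (tensor_indices D n) XX X x \<le> ennreal (1 + ?K * gap x)"
      using CU V_W inside
    proof eventually_elim
      case (elim x)
      let ?c = "L2_set (\<lambda>k. C' x k - C k) (tensor_indices D m)"
      have e: "0 < gap x" using elim by (intro gap_pos) auto
      have K_nonneg: "0 \<le> ?K" by (intro mult_nonneg_nonneg sum_nonneg) auto
      have "riemannian_dist (tensor_indices D m) (core_tensors D m) C (C' x) \<le> ennreal ?c"
        using elim by (intro core_segment) (simp_all add: aligned_def tensors_of_rank_def)
      also have "\<dots> \<le> ennreal (gap x * (1 + ?K * gap x))"
      proof (rule ennreal_leI)
        have "core_bound (gap x) = gap x * (1 + ?K * gap x)"
          by (simp add: core_bound_def power_divide sum_distrib_left sum_distrib_right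
              power2_eq_square algebra_simps)
        then show "?c \<le> gap x * (1 + ?K * gap x)" using elim by (simp add: aligned_def)
      qed
      finally have "riemannian_dist (tensor_indices D m) (core_tensors D m) C (C' x) /
          riemannian_dist (tensor_indices D n) XX X x \<le> ennreal (gap x * (1 + ?K * gap x) / gap x)"
        using e K_nonneg by (intro ennreal_ratio_le gap_le_dist) auto
      moreover have "F_T D n m x (C' x) (?V x) = (\<lambda>_. 0)"
        unfolding F_T_eq_0_iff
        using elim multilinear_product_cong[of D n m "?V x" "U' x" "C' x" "C' x"] by (simp add: aligned_def)
      moreover have "gap x * (1 + ?K * gap x) / gap x = 1 + ?K * gap x" using e by simp
      moreover have "C' x \<in> core_tensors D m" "?V x \<in> W" using elim by (simp_all add: aligned_def)
      ultimately show ?case by (intro exI[of _ "C' x"] exI[of _ "?V x"]) simp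
    qed
    have "((\<lambda>x. ennreal (1 + ?K * gap x)) \<longlongrightarrow> ennreal (1 + ?K * 0)) (at X within XX)"
      by (intro tendsto_ennrealI tendsto_intros gap_tendsto)
    then show "((\<lambda>x. ennreal (1 + ?K * gap x)) \<longlongrightarrow> 1) (at X within XX)" by simp
  qed
qed

theorem factor_condition_le:
  assumes d: "d < D"
    and W: "neighbourhood_within (core_tensors D m \<times> (\<Pi>\<^sub>E j\<in>{..<D} - {d}. stiefel (n j) (m j)))
      (C, restrict U ({..<D} - {d})) W"
  shows "condition_number_on XX (riemannian_dist (tensor_indices D n) XX) (stiefel (n d) (m d))
    (riemannian_dist (matrix_indices (n d) (m d)) (stiefel (n d) (m d))) W
    (\<lambda>X' Ud (C', V). F_T D n m X' C' (V(d := Ud))) (\<lambda>_. 0) X (U d)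
    \<le> (if m d = n d then 0 else ennreal (inverse (\<sigma> d)))"
proof -
  obtain C' U' where CU: "\<forall>\<^sub>F x in at X within XX. aligned x (C' x) (U' x)"
    and C'_lim: "(C' \<longlongrightarrow> C) (at X within XX)"
    and U'_lim: "\<forall>j<D. ((\<lambda>x. U' x j) \<longlongrightarrow> U j) (at X within XX)"
    using aligned_selection by blast
  let ?J = "{..<D} - {d}"
  let ?V = "\<lambda>x. restrict (U' x) ?J"
  let ?b = "\<lambda>x. if m d = n d then 0 else (gap x / \<sigma> d) / sqrt (1 - (gap x / \<sigma> d)\<^sup>2)"
  let ?g = "\<lambda>x. if m d = n d then 0 else inverse (\<sigma> d) / sqrt (1 - (gap x / \<sigma> d)\<^sup>2)"
  have "(?V \<longlongrightarrow> restrict U ?J) (at X within XX)"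
    by (rule restrict_tendsto) (simp add: U'_lim)
  then have "((\<lambda>x. (C' x, ?V x)) \<longlongrightarrow> (C, restrict U ?J)) (at X within XX)"
    by (intro tendsto_Pair C'_lim)
  moreover have "\<forall>\<^sub>F x in at X within XX. (C' x, ?V x) \<in>
      core_tensors D m \<times> (\<Pi>\<^sub>E j\<in>?J. stiefel (n j) (m j))"
    using CU by eventually_elim (auto simp: PiE_iff aligned_def)
  ultimately have V_W: "\<forall>\<^sub>F x in at X within XX. (C' x, ?V x) \<in> W"
    by (rule neighbourhood_within_eventually[OF W])
  have inside: "\<forall>\<^sub>F x in at X within XX. x \<in> XX \<and> x \<noteq> X"
    by (auto simp: eventually_at_topological intro: exI[of _ UNIV])
  have small: "\<forall>\<^sub>F x in at X within XX. gap x < \<sigma> d"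
    using gap_tendsto \<sigma>_pos[OF d] by (rule order_tendstoD(2))
  show ?thesis
  proof (rule condition_number_on_le[where g = "\<lambda>x. ennreal (?g x)"])
    show "\<forall>\<^sub>F x in at X within XX. \<exists>y z. y \<in> stiefel (n d) (m d) \<and> z \<in> W \<and>
        (case z of (C', V) \<Rightarrow> F_T D n m x C' (V(d := y))) = (\<lambda>_. 0) \<and>
        riemannian_dist (matrix_indices (n d) (m d)) (stiefel (n d) (m d)) (U d) y /
        riemannian_dist (tensor_indices D n) XX X x \<le> ennreal (?g x)"
      using CU V_W inside small
    proof eventually_elim
      case (elim x)
      have e: "0 < gap x" using elim by (intro gap_pos) auto
      have "(gap x / \<sigma> d)\<^sup>2 < 1"
        using e elim \<sigma>_pos[OF d] by (simp add: power_less_one_iff abs_square_less_1)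
      then have b_nonneg: "0 \<le> ?b x" using e \<sigma>_pos[OF d] by simp
      have "riemannian_dist (matrix_indices (n d) (m d)) (stiefel (n d) (m d)) (U d) (U' x d) \<le>
          ennreal (?b x)"
        using elim d by (simp add: aligned_def)
      then have "riemannian_dist (matrix_indices (n d) (m d)) (stiefel (n d) (m d)) (U d) (U' x d) /
          riemannian_dist (tensor_indices D n) XX X x \<le> ennreal (?b x / gap x)"
        using e b_nonneg by (intro ennreal_ratio_le gap_le_dist)
      also have "?b x / gap x = ?g x"
        using e by (simp add: divide_inverse)
      finally have "riemannian_dist (matrix_indices (n d) (m d)) (stiefel (n d) (m d)) (U d) (U' x d) /
          riemannian_dist (tensor_indices D n) XX X x \<le> ennreal (?g x)" .
      moreover have "F_T D n m x (C' x) ((?V x)(d := U' x d)) = (\<lambda>_. 0)"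
        unfolding F_T_eq_0_iff
        using elim multilinear_product_cong[of D n m "(?V x)(d := U' x d)" "U' x" "C' x" "C' x"]
        by (simp add: aligned_def)
      moreover have "U' x d \<in> stiefel (n d) (m d)" "(C' x, ?V x) \<in> W"
        using elim d by (simp_all add: aligned_def)
      ultimately show ?case by (intro exI[of _ "U' x d"] exI[of _ "(C' x, ?V x)"]) simp
    qed
    have "((\<lambda>x. ennreal (inverse (\<sigma> d) / sqrt (1 - (gap x / \<sigma> d)\<^sup>2))) \<longlongrightarrow>
        ennreal (inverse (\<sigma> d) / sqrt (1 - (0 / \<sigma> d)\<^sup>2))) (at X within XX)"
      using \<sigma>_pos[OF d] by (intro tendsto_ennrealI tendsto_intros gap_tendsto) auto
    then show "((\<lambda>x. ennreal (?g x)) \<longlongrightarrow> (if m d = n d then 0 else ennreal (inverse (\<sigma> d))))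
        (at X within XX)"
      by simp
  qed
qed

lemma X_norm: "L2_set X (tensor_indices D n) = L2_set C (tensor_indices D m)"
  unfolding X_def by (rule multilinear_product_isometry) (rule U_orth)

lemma C_norm_pos: "0 < L2_set C (tensor_indices D m)"
proof -
  have "0 < D" using D by simp
  let ?x = "\<lambda>r::nat. if r = 0 then 1 else 0 :: real"
  have "(\<Sum>r<m 0. (?x r)\<^sup>2) = 1"
    using m[OF \<open>0 < D\<close>] by (simp add: if_distrib[of "\<lambda>x. x\<^sup>2"] cong: if_cong)
  then have "(\<sigma> 0)\<^sup>2 \<le> (L2_set C (tensor_indices D m))\<^sup>2"
    using order_trans[OF \<sigma>_le[OF \<open>0 < D\<close>, of ?x] slice_form_le[OF \<open>0 < D\<close>, of m C ?x]] by simp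
  then have "L2_set C (tensor_indices D m) \<noteq> 0"
    using \<sigma>_pos[OF \<open>0 < D\<close>] by auto
  then show ?thesis using L2_set_nonneg[of C "tensor_indices D m"] by linarith
qed

lemma scaled_X_in_XX:
  assumes "0 < t" shows "(\<lambda>i. t * X i) \<in> XX"
proof -
  have "multilinear_product D n m U (\<lambda>k. t * C k) \<in> XX"
    unfolding XX_def using core m U C_tensor assms
    by (intro nondegenerate_imp_rank nondegenerate_scale core_nondegenerate) (auto simp: tensors_def)
  moreover have "multilinear_product D n m U (\<lambda>k. t * C k) = (\<lambda>i. t * X i)"
    using multilinear_product_linear[of D n m U t C 0 C] by (simp add: X_def fun_eq_iff)
  ultimately show ?thesis by simp
qed

text \<open>Stretching \<open>X\<close> by a factor \<open>1 + t\<close> stretches every possible core by the same factor in norm,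
  because the norm of a core is that of its tensor.\<close>

theorem core_condition_ge:
  assumes W: "W \<subseteq> (\<Pi>\<^sub>E j\<in>{..<D}. stiefel (n j) (m j))"
  shows "1 \<le> condition_number_on XX (riemannian_dist (tensor_indices D n) XX) (core_tensors D m)
    (riemannian_dist (tensor_indices D m) (core_tensors D m)) W (\<lambda>X' C' V. F_T D n m X' C' V) (\<lambda>_. 0)
    X C"
proof (rule condition_number_on_ge[where g = "\<lambda>_. 1" and P = "\<lambda>t i. (1 + t) * X i"])
  let ?x = "L2_set X (tensor_indices D n)"
  have x_pos: "0 < ?x" using C_norm_pos X_norm by simp
  have in_XX: "(\<lambda>i. (1 + t) * X i) \<in> XX" if "0 \<le> t" for t
    using that by (intro scaled_X_in_XX) simp
  have norm_diff: "L2_set (\<lambda>i. (1 + t) * X i - X i) (tensor_indices D n) = t * ?x" if "0 \<le> t" for t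
    using L2_set_scale[OF that, of X "tensor_indices D n"] by (simp add: algebra_simps)
  show "filterlim (\<lambda>t i. (1 + t) * X i) (at X within XX) (at_right 0)"
    unfolding filterlim_at
  proof
    show "\<forall>\<^sub>F t in at_right 0. (\<lambda>i. (1 + t) * X i) \<in> XX \<and> (\<lambda>i. (1 + t) * X i) \<noteq> X"
      using eventually_at_right_0_pos
    proof eventually_elim
      case (elim t)
      have "(\<lambda>i. (1 + t) * X i) \<noteq> X"
      proof
        assume eq: "(\<lambda>i. (1 + t) * X i) = X"
        have "(1 + t) * X i - X i = 0" for i using fun_cong[OF eq, of i] by simp
        then have "L2_set (\<lambda>i. (1 + t) * X i - X i) (tensor_indices D n) = 0"
          by (intro L2_set_0') blast
        then show False using norm_diff[of t] elim x_pos by simp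
      qed
      then show ?case using in_XX elim by simp
    qed
    have "((\<lambda>t. (1 + t) * X i) \<longlongrightarrow> (1 + 0) * X i) (at_right 0)" for i
      by (intro tendsto_intros id_tendsto_at_right_0)
    then show "((\<lambda>t i. (1 + t) * X i) \<longlongrightarrow> X) (at_right 0)"
      by (simp add: tendsto_fun_iff)
  qed
  show "\<forall>\<^sub>F t in at_right 0. \<forall>C'\<in>core_tensors D m. \<forall>V\<in>W.
      F_T D n m (\<lambda>i. (1 + t) * X i) C' V = (\<lambda>_. 0) \<longrightarrow>
      1 \<le> riemannian_dist (tensor_indices D m) (core_tensors D m) C C' /
        riemannian_dist (tensor_indices D n) XX X (\<lambda>i. (1 + t) * X i)"
    using eventually_at_right_0_pos
  proof eventually_elim
    case (elim t)
    show ?case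
    proof (intro ballI impI)
      fix C' V assume "C' \<in> core_tensors D m" "V \<in> W"
        and "F_T D n m (\<lambda>i. (1 + t) * X i) C' V = (\<lambda>_. 0)"
      then have eq: "(\<lambda>i. (1 + t) * X i) = multilinear_product D n m V C'"
        and V: "\<And>j. j < D \<Longrightarrow> orthonormal (n j) (m j) (V j)"
        using W unfolding F_T_eq_0_iff by (auto simp: stiefel_iff PiE_iff)
      have "L2_set C' (tensor_indices D m) = (1 + t) * ?x"
        using multilinear_product_isometry[of D n m V C', OF V] elim
          L2_set_scale[of "1 + t" X "tensor_indices D n"] unfolding eq[symmetric] by simp
      moreover have "L2_set C' (tensor_indices D m) \<le>
          L2_set (\<lambda>k. C' k - C k) (tensor_indices D m) + L2_set C (tensor_indices D m)"
        using L2_set_triangle_ineq[of "\<lambda>k. C' k - C k" C "tensor_indices D m"] by simp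
      ultimately have "t * ?x \<le> L2_set (\<lambda>k. C' k - C k) (tensor_indices D m)"
        using X_norm by (simp add: algebra_simps)
      then have "ennreal (t * ?x) \<le> riemannian_dist (tensor_indices D m) (core_tensors D m) C C'"
        by (rule order_trans[OF ennreal_leI chord_le_riemannian_dist[OF finite_tensor_indices]])
      moreover have "riemannian_dist (tensor_indices D n) XX X (\<lambda>i. (1 + t) * X i) \<le> ennreal (t * ?x)"
      proof -
        have "riemannian_dist (tensor_indices D n) XX X (\<lambda>i. (1 + t) * X i) \<le>
            ennreal (L2_set (\<lambda>i. (1 + t) * X i - X i) (tensor_indices D n))"
        proof (rule riemannian_dist_le_segment)
          fix s :: real assume "0 \<le> s"
          have "(\<lambda>i. X i + s * ((1 + t) * X i - X i)) = (\<lambda>i. (1 + s * t) * X i)"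
            by (auto simp: algebra_simps)
          then show "(\<lambda>i. X i + s * ((1 + t) * X i - X i)) \<in> XX"
            using in_XX[of "s * t"] \<open>0 \<le> s\<close> elim by simp
        qed
        then show ?thesis using norm_diff[of t] elim by simp
      qed
      ultimately have "ennreal (t * ?x / (t * ?x)) \<le>
          riemannian_dist (tensor_indices D m) (core_tensors D m) C C' /
          riemannian_dist (tensor_indices D n) XX X (\<lambda>i. (1 + t) * X i)"
        using elim x_pos by (intro ennreal_ratio_ge) auto
      then show "1 \<le> riemannian_dist (tensor_indices D m) (core_tensors D m) C C' /
          riemannian_dist (tensor_indices D n) XX X (\<lambda>i. (1 + t) * X i)"
        using elim x_pos by simp
    qed
  qed
qed simp

text \<open>Two decompositions of one tensor have the same column space in mode \<open>d\<close>. So the unit vector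
  \<open>A w\<close> is a combination of the columns of \<open>V d\<close> with a coefficient vector of norm 1, and its
  component along a unit vector \<open>v\<close> orthogonal to the columns of \<open>U d\<close> bounds the distance of
  \<open>V d\<close> from \<open>U d\<close> from below.\<close>

lemma factor_displacement:
  assumes d: "d < D" and A: "orthonormal (n d) (m d) A" and Y: "orthonormal (n d) (m d) (V d)"
    and eq: "multilinear_product D n m (U(d := A)) C = multilinear_product D n m V C'"
    and w: "(\<Sum>a<m d. (w a)\<^sup>2) = 1"
    and v: "(\<Sum>i<n d. (v i)\<^sup>2) = 1" "\<And>a. a < m d \<Longrightarrow> (\<Sum>i<n d. v i * U d (i, a)) = 0"
  shows "(\<Sum>i<n d. v i * (\<Sum>a<m d. w a * A (i, a))) \<le>
    L2_set (\<lambda>e. V d e - U d e) (matrix_indices (n d) (m d))"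
proof -
  let ?R = "matrix_mult (n d) (proj_off (m d) (V d)) A"
  have "(\<sigma> d)\<^sup>2 * (\<Sum>i<n d. \<Sum>r<m d. (matrix_mult (n d) (proj_off (m d) (V d)) ((U(d := A)) d) (i, r))\<^sup>2) \<le>
      (L2_set (multilinear_product D n n (in_mode d (proj_off (m d) (V d)))
        (multilinear_product D n m (U(d := A)) C)) (tensor_indices D n))\<^sup>2"
    by (rule proj_off_tucker_norm[OF d _ \<sigma>_le[OF d]]) (use A U_orth in auto)
  also have "\<dots> = 0"
    unfolding eq proj_off_tucker[of d D n m V C', OF d Y] by (simp add: L2_set_0')
  finally have "(\<Sum>i<n d. \<Sum>r<m d. (?R (i, r))\<^sup>2) \<le> 0"
    using \<sigma>_pos[OF d] by (simp add: mult_le_0_iff)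
  then have "(\<Sum>i<n d. \<Sum>r<m d. (?R (i, r))\<^sup>2) = 0"
    by (simp add: order_antisym sum_nonneg)
  then have R0: "?R (i, r) = 0" if "i < n d" "r < m d" for i r
    using that by (subst (asm) sum_nonneg_eq_0_iff; simp add: sum_nonneg sum_nonneg_eq_0_iff)
  define z where "z b = (\<Sum>a<m d. w a * (\<Sum>j<n d. V d (j, b) * A (j, a)))" for b
  have Aw: "(\<Sum>a<m d. w a * A (i, a)) = (\<Sum>b<m d. z b * V d (i, b))" if "i < n d" for i
  proof -
    have "(\<Sum>a<m d. w a * A (i, a)) =
        (\<Sum>a<m d. w a * (\<Sum>b<m d. (\<Sum>j<n d. V d (j, b) * A (j, a)) * V d (i, b)))"
      using R0[OF that] that by (intro sum.cong refl) (simp add: matrix_mult_proj_off)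
    also have "\<dots> = (\<Sum>b<m d. z b * V d (i, b))"
      unfolding z_def sum_distrib_left sum_distrib_right by (subst sum.swap) (simp add: mult_ac)
    finally show ?thesis .
  qed
  have "(\<Sum>b<m d. z b * z b) = (\<Sum>i<n d. (\<Sum>a<m d. w a * A (i, a)) * (\<Sum>a<m d. w a * A (i, a)))"
    by (simp add: Aw orthonormal_inner_comb[OF Y])
  also have "\<dots> = 1"
    using w by (simp add: orthonormal_inner_comb[OF A] power2_eq_square)
  finally have z: "(\<Sum>b<m d. z b * z b) = 1" .
  let ?vz = "\<lambda>(i, b). v i * z b"
  have "(\<Sum>i<n d. v i * (\<Sum>b<m d. z b * U d (i, b))) = (\<Sum>b<m d. z b * (\<Sum>i<n d. v i * U d (i, b)))"
    unfolding sum_distrib_left by (subst sum.swap) (simp add: mult_ac)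
  also have "\<dots> = 0" by (simp add: v(2))
  finally have "(\<Sum>i<n d. v i * (\<Sum>a<m d. w a * A (i, a))) =
      (\<Sum>i<n d. v i * (\<Sum>b<m d. z b * V d (i, b))) - (\<Sum>i<n d. v i * (\<Sum>b<m d. z b * U d (i, b)))"
    by (simp add: Aw)
  also have "\<dots> = inner_on (matrix_indices (n d) (m d)) ?vz (\<lambda>e. V d e - U d e)"
    by (simp add: inner_on_def sum_matrix_indices sum_subtractf[symmetric] sum_distrib_left
        right_diff_distrib mult_ac)
  also have "\<dots> \<le> L2_set ?vz (matrix_indices (n d) (m d)) *
      L2_set (\<lambda>e. V d e - U d e) (matrix_indices (n d) (m d))"
    using abs_inner_on_le[of "matrix_indices (n d) (m d)" ?vz] by (simp add: abs_le_iff)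
  also have "L2_set ?vz (matrix_indices (n d) (m d)) = 1"
  proof -
    have "inner_on (matrix_indices (n d) (m d)) ?vz ?vz = (\<Sum>i<n d. (v i)\<^sup>2) * (\<Sum>b<m d. z b * z b)"
      by (simp add: inner_on_def sum_matrix_indices sum_product power2_eq_square mult_ac)
    then show ?thesis by (simp add: L2_set_eq_sqrt_inner_on z v(1))
  qed
  finally show ?thesis by simp
qed

text \<open>The extremal perturbation rotates the image of a left singular vector \<open>w\<close> for the smallest
  singular value out of the column space of \<open>U d\<close>. The tensor then moves at speed \<open>\<sigma> d\<close>.\<close>

theorem factor_condition_ge:
  assumes d: "d < D" and less: "m d < n d"
    and W: "W \<subseteq> core_tensors D m \<times> (\<Pi>\<^sub>E j\<in>{..<D} - {d}. stiefel (n j) (m j))"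
  shows "ennreal (inverse (\<sigma> d)) \<le>
    condition_number_on XX (riemannian_dist (tensor_indices D n) XX) (stiefel (n d) (m d))
    (riemannian_dist (matrix_indices (n d) (m d)) (stiefel (n d) (m d))) W
    (\<lambda>X' Ud (C', V). F_T D n m X' C' (V(d := Ud))) (\<lambda>_. 0) X (U d)"
proof -
  obtain w where w: "(\<Sum>a<m d. (w a)\<^sup>2) = 1" "slice_form D m d C w = (\<sigma> d)\<^sup>2"
    using sigma_min_flattening(3)[of d D m C] d m unfolding \<sigma>_def by blast
  obtain v where v: "(\<Sum>i<n d. (v i)\<^sup>2) = 1" "\<And>a. a < m d \<Longrightarrow> (\<Sum>i<n d. v i * U d (i, a)) = 0"
    by (rule orthonormal_unit_complement[OF U_orth[OF d] less]) (erule that, assumption)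
  define u where "u i = (\<Sum>a<m d. w a * U d (i, a))" for i
  have uu: "(\<Sum>i<n d. u i * u i) = 1"
    using w(1) unfolding u_def by (simp add: orthonormal_inner_comb[OF U_orth[OF d]] power2_eq_square)
  have uU: "(\<Sum>i<n d. u i * U d (i, a)) = w a" if "a < m d" for a
    unfolding u_def by (rule orthonormal_inner_column[OF U_orth[OF d] that])
  have vu: "(\<Sum>i<n d. v i * u i) = 0"
  proof -
    have "(\<Sum>i<n d. v i * u i) = (\<Sum>a<m d. w a * (\<Sum>i<n d. v i * U d (i, a)))"
      unfolding u_def sum_distrib_left by (subst sum.swap) (simp add: mult_ac)
    then show ?thesis by (simp add: v(2))
  qed
  have vv: "(\<Sum>i<n d. v i * v i) = 1" using v(1) by (simp add: power2_eq_square)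
  \<comment> \<open>\<open>A t\<close> sends \<open>w\<close> to \<open>cos t u + sin t v\<close> and agrees with \<open>U d\<close> on the complement of \<open>w\<close>\<close>
  define f where "f t i = (cos t - 1) * u i + sin t * v i" for t i
  define A where "A t = (\<lambda>(i, a). U d (i, a) + f t i * w a)" for t
  define P where "P t = multilinear_product D n m (U(d := A t)) C" for t
  define E1 where "E1 = multilinear_product D n m (U(d := \<lambda>(i, a). u i * w a)) C"
  define E2 where "E2 = multilinear_product D n m (U(d := \<lambda>(i, a). v i * w a)) C"
  have ff: "(\<Sum>i<n d. f t i * f t i) = 2 - 2 * cos t" for t
  proof -
    have "(\<Sum>i<n d. f t i * f t i) = (cos t - 1)\<^sup>2 * (\<Sum>i<n d. u i * u i)
        + 2 * (cos t - 1) * sin t * (\<Sum>i<n d. v i * u i) + (sin t)\<^sup>2 * (\<Sum>i<n d. v i * v i)"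
      by (simp add: f_def algebra_simps sum.distrib sum_subtractf sum_distrib_left power2_eq_square)
    also have "\<dots> = 2 - 2 * cos t"
      by (simp add: uu vu vv power2_diff sin_squared_eq)
    finally show ?thesis .
  qed
  have fU: "(\<Sum>i<n d. f t i * U d (i, a)) = (cos t - 1) * w a" if "a < m d" for t a
  proof -
    have "(\<Sum>i<n d. f t i * U d (i, a)) =
        (cos t - 1) * (\<Sum>i<n d. u i * U d (i, a)) + sin t * (\<Sum>i<n d. v i * U d (i, a))"
      by (simp add: f_def algebra_simps sum.distrib sum_subtractf sum_distrib_left)
    then show ?thesis by (simp add: uU[OF that] v(2)[OF that])
  qed
  have A_orth: "orthonormal (n d) (m d) (A t)" for t
    unfolding orthonormal_def
  proof (intro allI impI)
    fix a b assume ab: "a < m d" "b < m d"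
    have "(\<Sum>i<n d. A t (i, a) * A t (i, b)) = (\<Sum>i<n d. U d (i, a) * U d (i, b))
        + w b * (\<Sum>i<n d. f t i * U d (i, a)) + w a * (\<Sum>i<n d. f t i * U d (i, b))
        + w a * w b * (\<Sum>i<n d. f t i * f t i)"
      by (simp add: A_def algebra_simps sum.distrib sum_distrib_left)
    then show "(\<Sum>i<n d. A t (i, a) * A t (i, b)) = (if a = b then 1 else 0)"
      using orthonormalD[OF U_orth[OF d] ab] by (simp add: fU[OF ab(1)] fU[OF ab(2)] ff algebra_simps)
  qed
  have P_eq: "P t i = X i + ((cos t - 1) * E1 i + sin t * E2 i)" for t i
  proof -
    have "A t = (\<lambda>e. 1 * U d e + 1 * ((cos t - 1) * (case e of (i, a) \<Rightarrow> u i * w a) +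
        sin t * (case e of (i, a) \<Rightarrow> v i * w a)))"
      by (auto simp: A_def f_def algebra_simps)
    then show ?thesis
      unfolding P_def E1_def E2_def X_def
      by (simp only: multilinear_product_linear_in_factor[OF d] fun_upd_triv) simp
  qed
  have P_in: "P t \<in> XX" for t
  proof -
    have "P t = multilinear_product D n m (U(d := cut_matrix (n d) (m d) (A t))) C"
      unfolding P_def by (rule multilinear_product_cong) auto
    also have "\<dots> \<in> XX"
      unfolding XX_def
      using U cut_matrix_stiefel[OF A_orth] core_nondegenerate[OF core m]
      by (intro nondegenerate_imp_rank C_tensor) auto
    finally show ?thesis .
  qed
  have P_speed: "L2_set (\<lambda>i. - sin t * E1 i + cos t * E2 i) (tensor_indices D n) = \<sigma> d" for t
  proof -
    define h where "h i = - sin t * u i + cos t * v i" for i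
    have "(\<Sum>i<n d. h i * h i) = (sin t)\<^sup>2 * (\<Sum>i<n d. u i * u i)
        - 2 * sin t * cos t * (\<Sum>i<n d. v i * u i) + (cos t)\<^sup>2 * (\<Sum>i<n d. v i * v i)"
      by (simp add: h_def algebra_simps sum.distrib sum_subtractf sum_distrib_left power2_eq_square)
    then have "(\<Sum>i<n d. h i * h i) = 1" by (simp add: uu vu vv)
    then have hh: "(\<Sum>i<n d. (h i)\<^sup>2) = 1" by (simp add: power2_eq_square)
    have "(\<lambda>i. - sin t * E1 i + cos t * E2 i) =
        multilinear_product D n m (U(d := \<lambda>e. - sin t * (case e of (i, a) \<Rightarrow> u i * w a) +
        cos t * (case e of (i, a) \<Rightarrow> v i * w a))) C"
      unfolding E1_def E2_def multilinear_product_linear_in_factor[OF d] by simp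
    also have "(\<lambda>e. - sin t * (case e of (i, a) \<Rightarrow> u i * w a) + cos t * (case e of (i, a) \<Rightarrow> v i * w a)) =
        (\<lambda>(i, a). h i * w a)"
      by (auto simp: h_def algebra_simps)
    finally have velocity: "(\<lambda>i. - sin t * E1 i + cos t * E2 i) =
        multilinear_product D n m (U(d := \<lambda>(i, a). h i * w a)) C" .
    have "(L2_set (\<lambda>i. - sin t * E1 i + cos t * E2 i) (tensor_indices D n))\<^sup>2 =
        (\<Sum>i<n d. slice_form D m d C (\<lambda>r. case (i, r) of (i, a) \<Rightarrow> h i * w a))"
      unfolding velocity by (rule multilinear_product_update_norm[OF d]) (rule U_orth)
    also have "\<dots> = (\<Sum>i<n d. slice_form D m d C (\<lambda>r. h i * w r))" by simp
    also have "\<dots> = (\<sigma> d)\<^sup>2"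
      by (simp add: slice_form_scale w(2) hh flip: sum_distrib_right)
    finally show ?thesis using \<sigma>_pos[OF d] by (simp add: power2_eq_iff_nonneg)
  qed
  have P_dist: "riemannian_dist (tensor_indices D n) XX X (P t) \<le> ennreal (t * \<sigma> d)" if "0 \<le> t" for t
  proof (rule riemannian_dist_le_curve[where \<gamma> = "\<lambda>s. P (s * t)"
        and \<gamma>' = "\<lambda>s i. t * (- sin (s * t) * E1 i + cos (s * t) * E2 i)"])
    show "((\<lambda>s. P (s * t) i) has_real_derivative t * (- sin (s * t) * E1 i + cos (s * t) * E2 i)) (at s)"
      for s i
      unfolding P_eq by (auto intro!: derivative_eq_intros simp: algebra_simps)
    show "continuous_on UNIV (\<lambda>s. t * (- sin (s * t) * E1 i + cos (s * t) * E2 i))" for i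
      by (intro continuous_intros)
    show "L2_set (\<lambda>i. t * (- sin (s * t) * E1 i + cos (s * t) * E2 i)) (tensor_indices D n) \<le> t * \<sigma> d" for s
      unfolding L2_set_scale[OF that] P_speed by simp
    show "X = P (0 * t)" by (simp add: fun_eq_iff P_eq)
  qed (simp_all add: P_in)
  have gap_sin: "sin t \<le> L2_set (\<lambda>e. V d e - U d e) (matrix_indices (n d) (m d))"
    if "P t = multilinear_product D n m V C'" "orthonormal (n d) (m d) (V d)" for t V C'
  proof -
    have "(\<Sum>a<m d. w a * A t (i, a)) = cos t * u i + sin t * v i" for i
    proof -
      have "(\<Sum>a<m d. w a * A t (i, a)) = u i + f t i * (\<Sum>a<m d. (w a)\<^sup>2)"
        by (simp add: A_def u_def algebra_simps sum.distrib sum_distrib_left power2_eq_square)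
      then show ?thesis by (simp add: w(1) f_def algebra_simps)
    qed
    then have "(\<Sum>i<n d. v i * (\<Sum>a<m d. w a * A t (i, a))) =
        cos t * (\<Sum>i<n d. v i * u i) + sin t * (\<Sum>i<n d. v i * v i)"
      by (simp add: algebra_simps sum.distrib sum_distrib_left)
    then show ?thesis
      using factor_displacement[OF d A_orth that(2) that(1)[unfolded P_def] w(1) v]
      by (simp add: vu vv)
  qed
  have sin_pos: "0 < sin t" if "0 < t" "t < 1" for t :: real
    using that pi_gt3 by (intro sin_gt_zero) auto
  show ?thesis
  proof (rule condition_number_on_ge[where P = P and g = "\<lambda>t. ennreal (sin t / (t * \<sigma> d))"])
    show "filterlim P (at X within XX) (at_right 0)"
      unfolding filterlim_at
    proof
      show "\<forall>\<^sub>F t in at_right 0. P t \<in> XX \<and> P t \<noteq> X"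
        using eventually_at_right_0_pos
      proof eventually_elim
        case (elim t)
        have "P t \<noteq> X"
        proof
          assume "P t = X"
          then have "sin t \<le> L2_set (\<lambda>e. U d e - U d e) (matrix_indices (n d) (m d))"
            using gap_sin[of t U C] U_orth[OF d] by (simp add: X_def)
          then show False using sin_pos[of t] elim by (simp add: L2_set_0')
        qed
        then show ?case using P_in by simp
      qed
      have "((\<lambda>t. X i + ((cos t - 1) * E1 i + sin t * E2 i)) \<longlongrightarrow>
          X i + ((cos 0 - 1) * E1 i + sin 0 * E2 i)) (at_right 0)" for i
        by (intro tendsto_intros id_tendsto_at_right_0)
      then show "(P \<longlongrightarrow> X) (at_right 0)"
        by (simp add: tendsto_fun_iff P_eq)
    qed
    show "\<forall>\<^sub>F t in at_right 0. \<forall>y\<in>stiefel (n d) (m d). \<forall>z\<in>W.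
        (case z of (C', V) \<Rightarrow> F_T D n m (P t) C' (V(d := y))) = (\<lambda>_. 0) \<longrightarrow>
        ennreal (sin t / (t * \<sigma> d)) \<le>
        riemannian_dist (matrix_indices (n d) (m d)) (stiefel (n d) (m d)) (U d) y /
        riemannian_dist (tensor_indices D n) XX X (P t)"
      using eventually_at_right_0_pos
    proof eventually_elim
      case (elim t)
      show ?case
      proof (intro ballI impI)
        fix y z assume y: "y \<in> stiefel (n d) (m d)" and "z \<in> W"
          and F: "(case z of (C', V) \<Rightarrow> F_T D n m (P t) C' (V(d := y))) = (\<lambda>_. 0)"
        obtain C' V where "z = (C', V)" by (cases z)
        then have "P t = multilinear_product D n m (V(d := y)) C'"
          using F by (simp add: F_T_eq_0_iff)
        then have "sin t \<le> L2_set (\<lambda>e. y e - U d e) (matrix_indices (n d) (m d))"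
          using gap_sin[of t "V(d := y)" C'] y by (simp add: stiefel_iff)
        then have "ennreal (sin t) \<le>
            riemannian_dist (matrix_indices (n d) (m d)) (stiefel (n d) (m d)) (U d) y"
          by (rule order_trans[OF ennreal_leI chord_le_riemannian_dist]) (simp add: matrix_indices_def)
        then show "ennreal (sin t / (t * \<sigma> d)) \<le>
            riemannian_dist (matrix_indices (n d) (m d)) (stiefel (n d) (m d)) (U d) y /
            riemannian_dist (tensor_indices D n) XX X (P t)"
          using elim sin_pos[of t] \<sigma>_pos[OF d] by (intro ennreal_ratio_ge P_dist) auto
      qed
    qed
    have "((\<lambda>t. ennreal (sin t / t * inverse (\<sigma> d))) \<longlongrightarrow> ennreal (1 * inverse (\<sigma> d))) (at_right 0)"
      by (intro tendsto_ennrealI tendsto_intros sin_over_id_tendsto)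
    then show "((\<lambda>t. ennreal (sin t / (t * \<sigma> d))) \<longlongrightarrow> ennreal (inverse (\<sigma> d))) (at_right 0)"
      by (simp add: divide_inverse mult_ac)
  qed
qed

theorem has_condition_number_factor_X:
  assumes d: "d < D"
  shows "has_condition_number_factor D n m d X C U
    (if m d = n d then 0 else ennreal (inverse (\<sigma> d)))"
  unfolding has_condition_number_factor_def
proof (rule has_condition_numberI)
  show "(C, restrict U ({..<D} - {d})) \<in>
      core_tensors D m \<times> (\<Pi>\<^sub>E j\<in>{..<D} - {d}. stiefel (n j) (m j))"
    using core U by auto
  fix W assume W: "neighbourhood_within
      (core_tensors D m \<times> (\<Pi>\<^sub>E j\<in>{..<D} - {d}. stiefel (n j) (m j))) (C, restrict U ({..<D} - {d})) W"
  then have sub: "W \<subseteq> core_tensors D m \<times> (\<Pi>\<^sub>E j\<in>{..<D} - {d}. stiefel (n j) (m j))"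
    by (simp add: neighbourhood_within_def)
  show "condition_number_on (tensors_of_rank D n m)
      (riemannian_dist (tensor_indices D n) (tensors_of_rank D n m)) (stiefel (n d) (m d))
      (riemannian_dist (matrix_indices (n d) (m d)) (stiefel (n d) (m d))) W
      (\<lambda>X' Ud (C', V). F_T D n m X' C' (V(d := Ud))) (\<lambda>_. 0) X (U d) =
      (if m d = n d then 0 else ennreal (inverse (\<sigma> d)))"
  proof (cases "m d = n d")
    case True
    then show ?thesis using factor_condition_le[OF d W] unfolding XX_def by simp
  next
    case False
    then have "m d < n d" using orthonormal_card_le[OF U_orth[OF d]] by simp
    then show ?thesis
      using antisym[OF factor_condition_le[OF d W]] factor_condition_ge[OF d _ sub] False
      unfolding XX_def by simp
  qed
qed

theorem has_condition_number_core_X: "has_condition_number_core D n m X C U 1"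
  unfolding has_condition_number_core_def
proof (rule has_condition_numberI)
  show "restrict U {..<D} \<in> (\<Pi>\<^sub>E j\<in>{..<D}. stiefel (n j) (m j))"
    using U by auto
  fix W assume W: "neighbourhood_within (\<Pi>\<^sub>E j\<in>{..<D}. stiefel (n j) (m j)) (restrict U {..<D}) W"
  then have sub: "W \<subseteq> (\<Pi>\<^sub>E j\<in>{..<D}. stiefel (n j) (m j))"
    by (simp add: neighbourhood_within_def)
  show "condition_number_on (tensors_of_rank D n m)
      (riemannian_dist (tensor_indices D n) (tensors_of_rank D n m)) (core_tensors D m)
      (riemannian_dist (tensor_indices D m) (core_tensors D m)) W
      (\<lambda>X' C' V. F_T D n m X' C' V) (\<lambda>_. 0) X C = 1"
    using antisym[OF core_condition_le[OF W] core_condition_ge[OF sub]] unfolding XX_def .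
qed

end

theorem proposition13:
  fixes D :: nat and n m :: "nat \<Rightarrow> nat" and X C :: tensor and U :: "nat \<Rightarrow> matrix"
  assumes "1 \<le> D" and "\<forall>j<D. 1 \<le> m j"
    and "X \<in> tensors_of_rank D n m"
    and "C \<in> core_tensors D m" and "\<forall>j<D. U j \<in> stiefel (n j) (m j)"
    and "X = G_T D n m C U"
  shows "(\<forall>d<D. has_condition_number_factor D n m d X C U
            (if m d = n d then 0 else ennreal (inverse (sigma_min (flattening D m d C)))))
       \<and> has_condition_number_core D n m X C U 1"
proof -
  interpret tucker_problem D n m C U
    by unfold_locales (use assms(1,2,4,5) in simp_all)
  have X_eq: "X = tucker_problem.X D n m C U"
    unfolding X_def assms(6) G_T_def ..
  show ?thesis
    unfolding X_eq
    by (intro conjI allI impI has_condition_number_core_X has_condition_number_factor_X[unfolded \<sigma>_def])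
qed

end
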